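(* Let $\Lambda\subseteq\mathbb{R}^{2d}$ be an arbitrary lattice and $\nu$ a submultiplicative, even weight on $\mathbb{R}^{2d}$. Then there exist finitely many functions $\varphi_1,\dots,\varphi_n\in M^1_\nu(\mathbb{R}^d)$ such that $\bigcup_{j=1}^n\mathcal{G}(\varphi_j,\Lambda)$ is a multi-window Gabor frame for $L^2(\mathbb{R}^d)$.
   Context: A lattice is $\Lambda=A_0\mathbb{Z}^{2d}$ with $A_0$ an invertible real $2d\times 2d$ matrix. For $z=(x,\omega)\in\mathbb{R}^{2d}$, $\pi(z)f(t)=e^{2\pi i\omega\cdot t}f(t-x)$, and $\mathcal{V}_gf(z)=\langle f,\pi(z)g\rangle$. Weights are positive measurable functions; $\nu$ is submultiplicative if $\nu(z_1+z_2)\le\nu(z_1)\nu(z_2)$ and even if $\nu(-z)=\nu(z)$. With $g(t)=e^{-\pi t\cdot t}$, $M^1_\nu(\mathbb{R}^d)$ is the space of $f\in L^2(\mathbb{R}^d)$ with $\|f\|_{M^1_\nu}=\int_{\mathbb{R}^{2d}}|\mathcal{V}_gf(z)|\nu(z)\,dz<\infty$. $\mathcal{G}(\varphi,\Lambda)=\{\pi(\lambda)\varphi:\lambda\in\Lambda\}$. $\bigcup_{j=1}^n\mathcal{G}(\varphi_j,\Lambda)$ is a multi-window Gabor frame if the frame operator $Sf=\sum_{j=1}^n\sum_{\lambda\in\Lambda}\langle f,\pi(\lambda)\varphi_j\rangle\pi(\lambda)\varphi_j$ is bounded and invertible on $L^2(\mathbb{R}^d)$, equivalently there are $A,B>0$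 with $A\|f\|_2^2\le\sum_{j=1}^n\sum_{\lambda\in\Lambda}|\langle f,\pi(\lambda)\varphi_j\rangle|^2\le B\|f\|_2^2$ for all $f\in L^2(\mathbb{R}^d)$. *)

theory Defs
  imports "HOL-Analysis.Analysis"
begin

text \<open>
  The configuration space is \<^typ>\<open>real ^ 'd\<close> and phase space is
  \<^typ>\<open>(real ^ 'd) \<times> (real ^ 'd)\<close>, with elements \<open>z = (x, \<omega>)\<close>.
  Elements of $L^2$ are represented by functions; identities between them are understood
  almost everywhere, i.e. up to \<open>L2_norm\<close>-distance zero.
\<close>

type_synonym 'd phase = "(real ^ 'd) \<times> (real ^ 'd)"
type_synonym 'd signal = "real ^ 'd \<Rightarrow> complex"


definition L2 :: "('d::finite) signal set" where
  "L2 = {f. f \<in> borel_measurable lebesgue \<and> integrable lebesgue (\<lambda>t. (cmod (f t))\<^sup>2)}"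

definition L2_inner :: "('d::finite) signal \<Rightarrow> 'd signal \<Rightarrow> complex" where
  "L2_inner f g = (\<integral>t. f t * cnj (g t) \<partial>lebesgue)"

definition L2_norm :: "('d::finite) signal \<Rightarrow> real" where
  "L2_norm f = sqrt (\<integral>t. (cmod (f t))\<^sup>2 \<partial>lebesgue)"

text \<open>Unconditional convergence of a series in the $L^2$-norm, as in \<^const>\<open>has_sum\<close>. It is
  meaningful only for terms and sum in \<^const>\<open>L2\<close>, since Bochner integrals of non-integrable
  functions are zero.\<close>

definition L2_has_sum :: "('i \<Rightarrow> ('d::finite) signal) \<Rightarrow> 'i set \<Rightarrow> 'd signal \<Rightarrow> bool" where
  "L2_has_sum F I h \<longleftrightarrow>
     ((\<lambda>X. L2_norm (\<lambda>t. h t - (\<Sum>i\<in>X. F i t))) \<longlongrightarrow> 0) (finite_subsets_at_top I)"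


definition tf_shift :: "('d::finite) phase \<Rightarrow> 'd signal \<Rightarrow> 'd signal" where
  "tf_shift = (\<lambda>(x, \<omega>) f t. cis (2 * pi * (\<omega> \<bullet> t)) * f (t - x))"

definition stft :: "('d::finite) signal \<Rightarrow> 'd signal \<Rightarrow> 'd phase \<Rightarrow> complex" where
  "stft g f z = L2_inner f (tf_shift z g)"

definition gaussian :: "('d::finite) signal" where
  "gaussian t = complex_of_real (exp (- pi * (t \<bullet> t)))"


definition weight :: "(('d::finite) phase \<Rightarrow> real) \<Rightarrow> bool" where
  "weight \<nu> \<longleftrightarrow> \<nu> \<in> borel_measurable lebesgue \<and> (\<forall>z. 0 < \<nu> z)"

definition submultiplicative :: "(('d::finite) phase \<Rightarrow> real) \<Rightarrow> bool" where
  "submultiplicative \<nu> \<longleftrightarrow> (\<forall>z w. \<nu> (z + w) \<le> \<nu> z * \<nu> w)"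

definition even_weight :: "(('d::finite) phase \<Rightarrow> real) \<Rightarrow> bool" where
  "even_weight \<nu> \<longleftrightarrow> (\<forall>z. \<nu> (- z) = \<nu> z)"

definition M1_norm :: "(('d::finite) phase \<Rightarrow> real) \<Rightarrow> 'd signal \<Rightarrow> ennreal" where
  "M1_norm \<nu> f = (\<integral>\<^sup>+ z. ennreal (cmod (stft gaussian f z) * \<nu> z) \<partial>lebesgue)"

definition M1 :: "(('d::finite) phase \<Rightarrow> real) \<Rightarrow> 'd signal set" where
  "M1 \<nu> = {f \<in> L2. M1_norm \<nu> f < \<infinity>}"


text \<open>
  A real $2d \times 2d$ matrix is indexed by the sum type \<^typ>\<open>'d + 'd\<close>; the left summand carries
  the first $d$ coordinates (time), the right summand the last $d$ ones (frequency).
\<close>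

definition to_phase :: "real ^ ('d::finite + 'd) \<Rightarrow> 'd phase" where
  "to_phase v = ((\<chi> i. v $ Inl i), (\<chi> i. v $ Inr i))"

definition is_lattice :: "('d::finite) phase set \<Rightarrow> bool" where
  "is_lattice \<Lambda> \<longleftrightarrow>
     (\<exists>A :: real ^ ('d + 'd) ^ ('d + 'd).
        invertible A \<and> \<Lambda> = {to_phase (A *v k) | k. \<forall>i. k $ i \<in> \<int>})"


text \<open>
  \<open>frame_op n \<phi> \<Lambda> f h\<close> says that the series defining the frame operator at \<open>f\<close> converges in $L^2$
  and that its sum is (the class of) \<open>h\<close>. The system is a family indexed by \<open>(j, \<lambda>)\<close>, so
  repeated windows count with multiplicity.
\<close>

definition frame_op ::
  "nat \<Rightarrow> (nat \<Rightarrow> ('d::finite) signal) \<Rightarrow> 'd phase set \<Rightarrow> 'd signal \<Rightarrow> 'd signal \<Rightarrow> bool" where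
  "frame_op n \<phi> \<Lambda> f h \<longleftrightarrow>
     h \<in> L2 \<and>
     L2_has_sum (\<lambda>(j, l) t. L2_inner f (tf_shift l (\<phi> j)) * tf_shift l (\<phi> j) t)
       ({1..n} \<times> \<Lambda>) h"

text \<open>
  The frame operator is defined on all of $L^2$, bounded, surjective and bounded below. The lower
  bound gives injectivity and boundedness of the inverse, the operator being linear.
\<close>

definition multi_window_gabor_frame ::
  "nat \<Rightarrow> (nat \<Rightarrow> ('d::finite) signal) \<Rightarrow> 'd phase set \<Rightarrow> bool" where
  "multi_window_gabor_frame n \<phi> \<Lambda> \<longleftrightarrow>
     (\<forall>j\<in>{1..n}. \<phi> j \<in> L2) \<and>
     (\<forall>f\<in>L2. \<exists>h. frame_op n \<phi> \<Lambda> f h) \<and>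
     (\<exists>B. \<forall>f\<in>L2. \<forall>h. frame_op n \<phi> \<Lambda> f h \<longrightarrow> L2_norm h \<le> B * L2_norm f) \<and>
     (\<forall>h\<in>L2. \<exists>f\<in>L2. frame_op n \<phi> \<Lambda> f h) \<and>
     (\<exists>C. \<forall>f\<in>L2. \<forall>h. frame_op n \<phi> \<Lambda> f h \<longrightarrow> L2_norm f \<le> C * L2_norm h)"

end

theory Submission
  imports Defs "HOL-Probability.Characteristic_Functions"
begin

text \<open>All windows are time-frequency shifts \<open>\<phi>\<^sub>j = \<pi>(\<zeta>\<^sub>j) g\<close> of the Gaussian \<open>g\<close>. Such a coherent state
  lies in \<open>M1 \<nu>\<close> for every admissible weight: its short-time Fourier transform is again a Gaussian,
  while a submultiplicative weight grows at most exponentially. Only the choice of the points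
  \<open>\<zeta>\<^sub>j\<close> depends on the lattice. They form a finite \<open>\<epsilon>\<close>-net of a compact set \<open>Q\<close> whose translates by
  \<open>\<Lambda>\<close> cover phase space, so that the points \<open>l + \<zeta>\<^sub>j\<close> sample phase space \<open>\<epsilon>\<close>-densely.

  The upper frame bound is Schur's test. The Gram matrix of coherent states decays like a Gaussian
  in the distance of their indices (\<open>coherent_inner_norm\<close>), and Gaussian sums over a lattice are
  finite (\<open>lattice_Gaussian_sum_bounded\<close>).

  The lower frame bound compares samples with the full transform, which cannot lose energy:
  the integral of \<open>\<bar>\<langle>f, \<pi>(z) g\<rangle>\<bar>\<^sup>2\<close> over phase space is at least \<open>\<parallel>g\<parallel>\<^sup>2 \<parallel>f\<parallel>\<^sup>2\<close>
  (\<open>coherent_total_energy_lower\<close>, for \<open>f\<close> in a dense class). Covering phase space by the cells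
  \<open>l + Q\<close> bounds this integral by an average over \<open>q \<in> Q\<close> of the sums over \<open>l\<close> of
  \<open>\<bar>\<langle>f, \<pi>(l + q) g\<rangle>\<bar>\<^sup>2\<close>. For fixed \<open>q\<close> take a net point \<open>\<zeta>\<^sub>j\<close> within \<open>\<epsilon>\<close> of \<open>q\<close>. After multiplication by a
  suitable unimodular factor, \<open>\<pi>(l + \<zeta>\<^sub>j) g\<close> is close in norm to \<open>\<pi>(l + q) g\<close>, uniformly in \<open>l\<close>, and
  the differences still have Gaussian off-diagonal decay. The geometric mean of the two estimates
  makes the differences a Bessel family with a bound that tends to \<open>0\<close> with \<open>\<epsilon>\<close>
  (\<open>coherent_diff_Bessel\<close>), so the error is absorbed into the left-hand side once \<open>\<epsilon>\<close> is small.

  Both bounds together make the frame operator bounded and invertible: its series converges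
  because $L^2$ is complete (\<open>L2_complete\<close>), and it is inverted by iterating a contraction
  (\<open>frame_rel_surj\<close>).\<close>

section \<open>The space of square-integrable functions\<close>

lemma borel_measurable_cnj [measurable]: "cnj \<in> borel_measurable borel"
  by (intro borel_measurable_continuous_onI continuous_intros)

lemma L2_measurable: "f \<in> L2 \<Longrightarrow> f \<in> borel_measurable lebesgue"
  and L2_integrable: "f \<in> L2 \<Longrightarrow> integrable lebesgue (\<lambda>t. (cmod (f t))\<^sup>2)"
  by (auto simp: L2_def)

lemma L2_zero [simp]: "(\<lambda>t. 0) \<in> L2"
  by (simp add: L2_def)

lemma L2_scale: 
  assumes "f \<in> L2" shows "(\<lambda>t. c * f t) \<in> L2"
proof -
  have [measurable]: "f \<in> borel_measurable lebesgue" by (rule L2_measurable[OF assms])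
  show ?thesis using L2_integrable[OF assms] by (simp add: L2_def norm_mult power_mult_distrib)
qed

lemma L2_add:
  assumes "f \<in> L2" "g \<in> L2" shows "(\<lambda>t. f t + g t) \<in> L2"
proof -
  have [measurable]: "f \<in> borel_measurable lebesgue" "g \<in> borel_measurable lebesgue" 
    using assms by (auto simp: L2_def)
  have "integrable lebesgue (\<lambda>t. (cmod (f t + g t))\<^sup>2)"
  proof (rule Bochner_Integration.integrable_bound)
    show "integrable lebesgue (\<lambda>t. 2 * (cmod (f t))\<^sup>2 + 2 * (cmod (g t))\<^sup>2)"
      using assms by (auto simp: L2_def)
    have "(cmod (f t + g t))\<^sup>2 \<le> 2 * (cmod (f t))\<^sup>2 + 2 * (cmod (g t))\<^sup>2" for t
    proof -
      have "(cmod (f t + g t))\<^sup>2 \<le> (cmod (f t) + cmod (g t))\<^sup>2"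
        by (simp add: norm_triangle_ineq power_mono)
      also have "\<dots> \<le> 2 * (cmod (f t))\<^sup>2 + 2 * (cmod (g t))\<^sup>2"
        using sum_squares_bound[of "cmod (f t)" "cmod (g t)"] by (simp add: power2_sum)
      finally show ?thesis .
    qed
    then show "AE t in lebesgue. norm ((cmod (f t + g t))\<^sup>2) \<le> norm (2 * (cmod (f t))\<^sup>2 + 2 * (cmod (g t))\<^sup>2)"
      by (intro AE_I2) simp
  qed simp
  then show ?thesis by (simp add: L2_def)
qed

lemma L2_diff:
  assumes "f \<in> L2" "g \<in> L2" shows "(\<lambda>t. f t - g t) \<in> L2"
  using L2_add[OF assms(1) L2_scale[OF assms(2), of "-1"]] by simp

lemma L2_sum:
  assumes "\<And>i. i \<in> X \<Longrightarrow> F i \<in> L2" shows "(\<lambda>t. \<Sum>i\<in>X. F i t) \<in> L2"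
  using assms by (induction X rule: infinite_finite_induct) (auto intro: L2_add)

lemma L2_integrable_mult:
  assumes "f \<in> L2" "g \<in> L2" shows "integrable lebesgue (\<lambda>t. f t * cnj (g t))"
proof (rule Bochner_Integration.integrable_bound)
  have [measurable]: "f \<in> borel_measurable lebesgue" "g \<in> borel_measurable lebesgue" 
    using assms by (auto simp: L2_def)
  show "integrable lebesgue (\<lambda>t. (cmod (f t))\<^sup>2 + (cmod (g t))\<^sup>2)"
    using assms by (auto simp: L2_def)
  show "(\<lambda>t. f t * cnj (g t)) \<in> borel_measurable lebesgue" by measurable
  have "cmod (f t) * cmod (g t) \<le> (cmod (f t))\<^sup>2 + (cmod (g t))\<^sup>2" for t
    using sum_squares_bound[of "cmod (f t)" "cmod (g t)"] 
      mult_nonneg_nonneg[OF norm_ge_zero[of "f t"] norm_ge_zero[of "g t"]]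
    by linarith
  then show "AE t in lebesgue. norm (f t * cnj (g t)) \<le> norm ((cmod (f t))\<^sup>2 + (cmod (g t))\<^sup>2)"
    by (intro AE_I2) (simp add: norm_mult)
qed

lemma L2_inner_scale_left: "L2_inner (\<lambda>t. c * f t) h = c * L2_inner f h"
  by (simp add: L2_inner_def mult.assoc)

lemma L2_inner_commute: "L2_inner g f = cnj (L2_inner f g)"
proof -
  have "cnj (L2_inner f g) = (\<integral>t. cnj (f t * cnj (g t)) \<partial>lebesgue)"
    unfolding L2_inner_def by (simp only: Bochner_Integration.integral_cnj)
  then show ?thesis by (simp add: L2_inner_def mult.commute)
qed

lemma L2_inner_diff_left:
  assumes "f \<in> L2" "g \<in> L2" "h \<in> L2"
  shows "L2_inner (\<lambda>t. f t - g t) h = L2_inner f h - L2_inner g h"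
  using assms by (simp add: L2_inner_def ring_distribs L2_integrable_mult)

lemma L2_inner_diff_right:
  assumes "f \<in> L2" "g \<in> L2" "h \<in> L2"
  shows "L2_inner h (\<lambda>t. f t - g t) = L2_inner h f - L2_inner h g"
  using assms by (simp add: L2_inner_def ring_distribs L2_integrable_mult)

lemma L2_inner_scale_right: "L2_inner h (\<lambda>t. c * f t) = cnj c * L2_inner h f"
  by (simp add: L2_inner_def mult.left_commute)

lemma L2_inner_sum_left:
  assumes "\<And>i. i \<in> X \<Longrightarrow> F i \<in> L2" "h \<in> L2"
  shows "L2_inner (\<lambda>t. \<Sum>i\<in>X. F i t) h = (\<Sum>i\<in>X. L2_inner (F i) h)"
  using assms by (simp add: L2_inner_def sum_distrib_right L2_integrable_mult)

lemma L2_inner_sum_right: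
  assumes "\<And>i. i \<in> X \<Longrightarrow> F i \<in> L2" "h \<in> L2"
  shows "L2_inner h (\<lambda>t. \<Sum>i\<in>X. F i t) = (\<Sum>i\<in>X. L2_inner h (F i))"
  using assms by (simp add: L2_inner_def sum_distrib_left L2_integrable_mult)

lemma L2_norm_nonneg [simp]: "0 \<le> L2_norm f"
  by (simp add: L2_norm_def)

lemma L2_norm_square: "(L2_norm f)\<^sup>2 = (\<integral>t. (cmod (f t))\<^sup>2 \<partial>lebesgue)"
  by (simp add: L2_norm_def)

lemma L2_inner_self: "L2_inner f f = of_real ((L2_norm f)\<^sup>2)"
  by (simp add: L2_inner_def L2_norm_square complex_norm_square[symmetric] 
        flip: integral_complex_of_real)

lemma L2_norm_square_Re: "(L2_norm f)\<^sup>2 = Re (L2_inner f f)"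
  by (simp add: L2_inner_self)

lemma L2_norm_scale: "L2_norm (\<lambda>t. c * f t) = cmod c * L2_norm f"
  by (simp add: L2_norm_def norm_mult power_mult_distrib real_sqrt_mult)

lemma L2_norm_minus_commute: "L2_norm (\<lambda>t. f t - g t) = L2_norm (\<lambda>t. g t - f t)"
  by (simp add: L2_norm_def norm_minus_commute)

lemma L2_norm_diff_square:
  assumes "f \<in> L2" "g \<in> L2"
  shows "(L2_norm (\<lambda>t. f t - g t))\<^sup>2 = (L2_norm f)\<^sup>2 - 2 * Re (L2_inner f g) + (L2_norm g)\<^sup>2"
  using assms
  by (simp add: L2_norm_square_Re L2_inner_diff_left L2_inner_diff_right L2_diff 
        L2_inner_commute[of g f])

lemma L2_norm_diff_scale_square:
  assumes "f \<in> L2" "g \<in> L2"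
  shows "(L2_norm (\<lambda>t. f t - c * g t))\<^sup>2 
    = (L2_norm f)\<^sup>2 - 2 * Re (cnj c * L2_inner f g) + (cmod c)\<^sup>2 * (L2_norm g)\<^sup>2"
  using assms
  by (simp add: L2_norm_diff_square L2_scale L2_inner_scale_right L2_norm_scale power_mult_distrib)

text \<open>Expanding the norm of \<open>f - s \<langle>f, g\<rangle> g\<close> gives a polynomial in the real number \<open>s\<close> that is
  nonnegative everywhere.\<close>

lemma L2_Cauchy_Schwarz:
  assumes "f \<in> L2" "g \<in> L2" 
  shows "cmod (L2_inner f g) \<le> L2_norm f * L2_norm g"
proof -
  define a where "a = L2_inner f g"
  have *: "0 \<le> (L2_norm f)\<^sup>2 - 2 * (s * (cmod a)\<^sup>2) + s\<^sup>2 * (cmod a)\<^sup>2 * (L2_norm g)\<^sup>2" for s :: real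
  proof -
    have re: "Re (cnj (of_real s * a) * L2_inner f g) = s * (cmod a)\<^sup>2"
      unfolding a_def[symmetric] cmod_power2 by (simp add: power2_eq_square algebra_simps)
    have ns: "(cmod (of_real s * a))\<^sup>2 = s\<^sup>2 * (cmod a)\<^sup>2" 
      by (simp add: norm_mult power_mult_distrib)
    have "0 \<le> (L2_norm (\<lambda>t. f t - (of_real s * a) * g t))\<^sup>2" by simp
    also note L2_norm_diff_scale_square[OF assms, of "of_real s * a", unfolded re ns]
    finally show ?thesis .
  qed
  have "(cmod a)\<^sup>2 \<le> (L2_norm f)\<^sup>2 * (L2_norm g)\<^sup>2"
  proof (cases "L2_norm g = 0")
    case True
    have "cmod a = 0"
    proof (rule ccontr)
      assume "cmod a \<noteq> 0"
      then have "0 \<le> (L2_norm f)\<^sup>2 - 2 * ((L2_norm f)\<^sup>2 + 1)"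
        using *[of "((L2_norm f)\<^sup>2 + 1) / (cmod a)\<^sup>2"] True by simp
      then have "(L2_norm f)\<^sup>2 \<le> - 2" by simp
      moreover have "0 \<le> (L2_norm f)\<^sup>2" by simp
      ultimately show False by simp
    qed
    then show ?thesis by simp
  next
    case False
    define G where "G = (L2_norm g)\<^sup>2"
    have G: "G > 0" using False by (simp add: G_def)
    then have "(1 / G)\<^sup>2 * (cmod a)\<^sup>2 * G = (cmod a)\<^sup>2 / G" by (simp add: power2_eq_square)
    with *[of "1 / G"] have "(cmod a)\<^sup>2 / G \<le> (L2_norm f)\<^sup>2" by (simp flip: G_def)
    then show ?thesis using G by (simp add: pos_divide_le_eq flip: G_def)
  qed
  then have "(cmod a)\<^sup>2 \<le> (L2_norm f * L2_norm g)\<^sup>2" by (simp add: power_mult_distrib)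
  then show ?thesis unfolding a_def by (rule power2_le_imp_le) simp
qed

lemma L2_triangle:
  assumes "f \<in> L2" "g \<in> L2" 
  shows "L2_norm (\<lambda>t. f t + g t) \<le> L2_norm f + L2_norm g"
proof (rule power2_le_imp_le)
  have "(L2_norm (\<lambda>t. f t + g t))\<^sup>2 = (L2_norm f)\<^sup>2 + 2 * Re (L2_inner f g) + (L2_norm g)\<^sup>2"
    using L2_norm_diff_scale_square[OF assms, of "-1"] by simp
  also have "\<dots> \<le> (L2_norm f)\<^sup>2 + 2 * (L2_norm f * L2_norm g) + (L2_norm g)\<^sup>2"
    using L2_Cauchy_Schwarz[OF assms] complex_Re_le_cmod[of "L2_inner f g"] by simp
  finally show "(L2_norm (\<lambda>t. f t + g t))\<^sup>2 \<le> (L2_norm f + L2_norm g)\<^sup>2" by (simp add: power2_sum)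
qed simp

lemma L2_triangle_diff:
  assumes "f \<in> L2" "g \<in> L2" "h \<in> L2"
  shows "L2_norm (\<lambda>t. f t - h t) \<le> L2_norm (\<lambda>t. f t - g t) + L2_norm (\<lambda>t. g t - h t)"
  using L2_triangle[OF L2_diff[OF assms(1,2)] L2_diff[OF assms(2,3)]] by simp

lemma L2_norm_le_add:
  assumes "f \<in> L2" "g \<in> L2"
  shows "L2_norm f \<le> L2_norm g + L2_norm (\<lambda>t. f t - g t)"
  using L2_triangle[OF assms(2) L2_diff[OF assms]] by simp

lemma L2_norm_square_nn:
  assumes "f \<in> L2"
  shows "(\<integral>\<^sup>+t. ennreal ((cmod (f t))\<^sup>2) \<partial>lebesgue) = ennreal ((L2_norm f)\<^sup>2)"
  unfolding L2_norm_square using L2_integrable[OF assms] by (intro nn_integral_eq_integral) auto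

lemma L2_I_nn:
  assumes "f \<in> borel_measurable lebesgue" 
    and "(\<integral>\<^sup>+t. ennreal ((cmod (f t))\<^sup>2) \<partial>lebesgue) \<le> ennreal (C\<^sup>2)" "0 \<le> C"
  shows "f \<in> L2" "L2_norm f \<le> C"
proof -
  have "(\<lambda>t. (cmod (f t))\<^sup>2) \<in> borel_measurable lebesgue" using assms(1) by measurable
  then show 1: "f \<in> L2" 
    using assms le_less_trans[OF assms(2)]  by (simp add: L2_def integrable_iff_bounded)
  have "(L2_norm f)\<^sup>2 \<le> C\<^sup>2"
    using assms(2) unfolding L2_norm_square_nn[OF 1] by simp
  then show "L2_norm f \<le> C" using assms(3) by (rule power2_le_imp_le)
qed

text \<open>The Riesz--Fischer theorem for geometrically convergent sequences. The series of the absolute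
  values of the increments has finite $L^2$-norm by monotone convergence, so the sequence converges
  almost everywhere, and Fatou's lemma turns the pointwise limit into an $L^2$-limit.\<close>

lemma L2_complete:
  fixes s :: "nat \<Rightarrow> ('d::finite) signal"
  assumes s: "\<And>k. s k \<in> L2" and q: "0 \<le> q" "q < 1" and "0 \<le> C"
    and step: "\<And>k. L2_norm (\<lambda>t. s (Suc k) t - s k t) \<le> C * q ^ k"
  shows "\<exists>h\<in>L2. (\<lambda>k. L2_norm (\<lambda>t. h t - s k t)) \<longlonglongrightarrow> 0"
proof -
  define R where "R k = C * q ^ k / (1 - q)" for k
  have R_nonneg: "0 \<le> R k" for k using q \<open>0 \<le> C\<close> by (simp add: R_def)
  have R_step: "C * q ^ k + R (Suc k) = R k" for k using q by (simp add: R_def field_simps)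
  have R_lim: "R \<longlonglongrightarrow> 0" 
    unfolding R_def using LIMSEQ_power_zero[of q] q by (intro tendsto_eq_intros | simp)+
  have [measurable]: "s k \<in> borel_measurable lebesgue" for k using s by (rule L2_measurable)
  have cauchy: "L2_norm (\<lambda>t. s (k + m) t - s k t) \<le> R k - R (k + m)" for k m
  proof (induction m)
    case (Suc m)
    have "L2_norm (\<lambda>t. s (k + Suc m) t - s k t) 
      \<le> L2_norm (\<lambda>t. s (k + Suc m) t - s (k + m) t) + L2_norm (\<lambda>t. s (k + m) t - s k t)"
      by (rule L2_triangle_diff[OF s s s])
    also have "\<dots> \<le> C * q ^ (k + m) + (R k - R (k + m))" using step[of "k + m"] Suc by simp
    also have "\<dots> = R k - R (k + Suc m)" using R_step[of "k + m"] by simp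
    finally show ?case .
  qed (simp add: L2_norm_def)
  define a where "a k t = cmod (s (Suc k) t - s k t)" for k t
  have [measurable]: "a k \<in> borel_measurable lebesgue" for k unfolding a_def by measurable
  define G where "G K t = complex_of_real (\<Sum>k<K. a k t)" for K t
  have a_L2: "(\<lambda>t. complex_of_real (a k t)) \<in> L2" for k
    using L2_diff[OF s s, of "Suc k" k] by (simp add: L2_def a_def) 
  have G_L2: "G K \<in> L2" for K
    unfolding G_def of_real_sum by (intro L2_sum a_L2)
  have G_norm: "L2_norm (G K) \<le> R 0 - R K" for K
  proof (induction K)
    case (Suc K)
    have "L2_norm (G (Suc K)) \<le> L2_norm (G K) + L2_norm (\<lambda>t. complex_of_real (a K t))"
      using L2_triangle[OF G_L2[of K] a_L2[of K]] by (simp add: G_def[abs_def])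
    also have "L2_norm (\<lambda>t. complex_of_real (a K t)) = L2_norm (\<lambda>t. s (Suc K) t - s K t)"
      by (simp add: L2_norm_def a_def)
    finally show ?case using Suc step[of K] R_step[of K] by simp
  qed (simp add: G_def L2_norm_def)
  have "(\<integral>\<^sup>+t. (SUP K. ennreal ((cmod (G K t))\<^sup>2)) \<partial>lebesgue) 
      = (SUP K. \<integral>\<^sup>+t. ennreal ((cmod (G K t))\<^sup>2) \<partial>lebesgue)"
  proof (rule nn_integral_monotone_convergence_SUP)
    show "incseq (\<lambda>K t. ennreal ((cmod (G K t))\<^sup>2))"
      by (auto simp: incseq_Suc_iff le_fun_def G_def a_def norm_of_real simp del: of_real_sum
          intro!: ennreal_leI power_mono sum_nonneg)
    show "(\<lambda>t. ennreal ((cmod (G K t))\<^sup>2)) \<in> borel_measurable lebesgue" for K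
      unfolding G_def by measurable
  qed
  also have "\<dots> \<le> ennreal ((R 0)\<^sup>2)"
  proof (rule SUP_least)
    fix K
    have "L2_norm (G K) \<le> R 0" using G_norm[of K] R_nonneg[of K] by simp
    then show "(\<integral>\<^sup>+t. ennreal ((cmod (G K t))\<^sup>2) \<partial>lebesgue) \<le> ennreal ((R 0)\<^sup>2)"
      using L2_norm_square_nn[OF G_L2] by (simp add: power_mono)
  qed
  finally have "(\<integral>\<^sup>+t. (SUP K. ennreal ((cmod (G K t))\<^sup>2)) \<partial>lebesgue) \<noteq> \<infinity>"
    by (metis ennreal_less_top infinity_ennreal_def leD)
  then have "AE t in lebesgue. (SUP K. ennreal ((cmod (G K t))\<^sup>2)) \<noteq> \<infinity>"
    by (rule nn_integral_PInf_AE[rotated]) (unfold G_def, measurable)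
  then have conv: "AE t in lebesgue. convergent (\<lambda>k. s k t)"
  proof (rule AE_mp, intro AE_I2 impI)
    fix t assume "(SUP K. ennreal ((cmod (G K t))\<^sup>2)) \<noteq> \<infinity>"
    then obtain B where B: "0 \<le> B" "(SUP K. ennreal ((cmod (G K t))\<^sup>2)) = ennreal B"
      by (metis ennreal_cases infinity_ennreal_def)
    have le: "(\<Sum>k<K. a k t) \<le> sqrt B" for K
    proof -
      have "ennreal ((cmod (G K t))\<^sup>2) \<le> ennreal B" unfolding B(2)[symmetric] by (rule SUP_upper) simp
      then have "(cmod (G K t))\<^sup>2 \<le> B" using B(1) by simp
      moreover have "cmod (G K t) = (\<Sum>k<K. a k t)"
        by (simp add: G_def a_def norm_of_real sum_nonneg del: of_real_sum)
      ultimately show ?thesis by (simp add: real_le_rsqrt)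
    qed
    have "summable (\<lambda>k. a k t)"
    proof (rule bounded_imp_summable)
      show "0 \<le> a k t" for k by (simp add: a_def)
      show "(\<Sum>k\<le>n. a k t) \<le> sqrt B" for n
        using le[of "Suc n"] by (simp only: lessThan_Suc_atMost)
    qed
    then have "summable (\<lambda>k. s (Suc k) t - s k t)" 
      unfolding a_def by (rule summable_norm_cancel)
    then have "convergent (\<lambda>n. \<Sum>k<n. s (Suc k) t - s k t)" by (simp add: summable_iff_convergent)
    then have "convergent (\<lambda>n. s n t - s 0 t)" by (simp add: sum_lessThan_telescope[of "\<lambda>k. s k t"])
    then show "convergent (\<lambda>n. s n t)" 
      using convergent_add[OF _ convergent_const[of "s 0 t"]] by fastforce
  qed
  define h where "h t = lim (\<lambda>k. s k t)" for t
  have [measurable]: "h \<in> borel_measurable lebesgue" unfolding h_def by measurable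
  have tail: "(\<integral>\<^sup>+t. ennreal ((cmod (h t - s k t))\<^sup>2) \<partial>lebesgue) \<le> ennreal ((R k)\<^sup>2)" for k
  proof -
    have "(\<integral>\<^sup>+t. ennreal ((cmod (h t - s k t))\<^sup>2) \<partial>lebesgue)
      = (\<integral>\<^sup>+t. liminf (\<lambda>m. ennreal ((cmod (s (k + m) t - s k t))\<^sup>2)) \<partial>lebesgue)"
    proof (rule nn_integral_cong_AE, use conv in \<open>rule AE_mp\<close>, intro AE_I2 impI)
      fix t assume "convergent (\<lambda>k. s k t)"
      then have "(\<lambda>m. s m t) \<longlonglongrightarrow> h t" by (simp add: h_def convergent_LIMSEQ_iff)
      then have "(\<lambda>m. s (k + m) t) \<longlonglongrightarrow> h t" by (subst add.commute, rule LIMSEQ_ignore_initial_segment)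
      then have "(\<lambda>m. ennreal ((cmod (s (k + m) t - s k t))\<^sup>2)) \<longlonglongrightarrow> ennreal ((cmod (h t - s k t))\<^sup>2)"
        by (intro tendsto_intros tendsto_ennrealI)
      then show "ennreal ((cmod (h t - s k t))\<^sup>2) = liminf (\<lambda>m. ennreal ((cmod (s (k + m) t - s k t))\<^sup>2))"
        by (rule lim_imp_Liminf[OF sequentially_bot, symmetric])
    qed
    also have "\<dots> \<le> liminf (\<lambda>m. \<integral>\<^sup>+t. ennreal ((cmod (s (k + m) t - s k t))\<^sup>2) \<partial>lebesgue)"
      by (rule nn_integral_liminf) measurable
    also have "\<dots> \<le> liminf (\<lambda>m. ennreal ((R k)\<^sup>2))"
    proof (intro Liminf_mono always_eventually allI)
      fix m
      have "L2_norm (\<lambda>t. s (k + m) t - s k t) \<le> R k" 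
        using cauchy[where k = k and m = m] R_nonneg[of "k + m"] by simp
      then show "(\<integral>\<^sup>+t. ennreal ((cmod (s (k + m) t - s k t))\<^sup>2) \<partial>lebesgue) \<le> ennreal ((R k)\<^sup>2)"
        by (simp add: L2_norm_square_nn[OF L2_diff[OF s s]] power_mono)
    qed
    finally show ?thesis by (simp add: Liminf_const)
  qed
  have "(\<lambda>t. h t - s k t) \<in> L2" and bound: "L2_norm (\<lambda>t. h t - s k t) \<le> R k" for k
    using L2_I_nn[OF _ tail R_nonneg] by measurable
  from L2_add[OF this(1)[of 0] s[of 0]] have "h \<in> L2" by simp
  moreover have "(\<lambda>k. L2_norm (\<lambda>t. h t - s k t)) \<longlonglongrightarrow> 0"
    by (rule tendsto_sandwich[OF _ _ tendsto_const R_lim]) (auto intro: always_eventually bound)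
  ultimately show ?thesis by blast
qed

section \<open>Bessel families, frames and the frame operator\<close>

text \<open>Taking the inner product with a fixed vector is continuous, so it can be done term by term.\<close>

lemma L2_has_sum_inner:
  assumes "L2_has_sum F I h" "\<And>i. i \<in> I \<Longrightarrow> F i \<in> L2" "h \<in> L2" "g \<in> L2"
  shows "((\<lambda>i. L2_inner (F i) g) has_sum L2_inner h g) I"
proof -
  let ?D = "\<lambda>X. L2_norm (\<lambda>t. h t - (\<Sum>i\<in>X. F i t))"
  have "((\<lambda>X. L2_inner h g - (\<Sum>i\<in>X. L2_inner (F i) g)) \<longlongrightarrow> 0) (finite_subsets_at_top I)"
  proof (rule Lim_null_comparison)
    show "\<forall>\<^sub>F X in finite_subsets_at_top I. 
      norm (L2_inner h g - (\<Sum>i\<in>X. L2_inner (F i) g)) \<le> ?D X * L2_norm g"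
    proof (rule eventually_finite_subsets_at_top_weakI)
      fix X assume X: "finite X" "X \<subseteq> I"
      have S: "(\<lambda>t. \<Sum>i\<in>X. F i t) \<in> L2" using X assms(2) by (intro L2_sum) auto
      have "L2_inner h g - (\<Sum>i\<in>X. L2_inner (F i) g) 
          = L2_inner (\<lambda>t. h t - (\<Sum>i\<in>X. F i t)) g"
        using X assms(2) 
        by (subst L2_inner_diff_left[OF assms(3) S assms(4)], subst L2_inner_sum_left) (auto intro: assms)
      then show "norm (L2_inner h g - (\<Sum>i\<in>X. L2_inner (F i) g)) \<le> ?D X * L2_norm g"
        using L2_Cauchy_Schwarz[OF L2_diff[OF assms(3) S] assms(4)] by simp
    qed
    show "((\<lambda>X. ?D X * L2_norm g) \<longlongrightarrow> 0) (finite_subsets_at_top I)"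
      using assms(1) unfolding L2_has_sum_def by (rule tendsto_mult_left_zero)
  qed
  then have "((\<lambda>X. L2_inner h g - (L2_inner h g - (\<Sum>i\<in>X. L2_inner (F i) g))) 
      \<longlongrightarrow> L2_inner h g - 0) (finite_subsets_at_top I)"
    by (intro tendsto_diff tendsto_const)
  then show ?thesis by (simp add: has_sum_def)
qed

locale L2_Bessel =
  fixes e :: "'i \<Rightarrow> ('d::finite) signal" and I :: "'i set" and B :: real
  assumes e_L2: "i \<in> I \<Longrightarrow> e i \<in> L2"
    and B_pos: "0 < B"
    and Bessel: "\<lbrakk>finite X; X \<subseteq> I; f \<in> L2\<rbrakk> 
      \<Longrightarrow> (\<Sum>i\<in>X. (cmod (L2_inner f (e i)))\<^sup>2) \<le> B * (L2_norm f)\<^sup>2"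
begin

abbreviation coeff :: "'d signal \<Rightarrow> 'i \<Rightarrow> complex" where
  "coeff f i \<equiv> L2_inner f (e i)"

text \<open>The frame operator is a relation rather than a function, because the sum of its series is
  determined only up to equality almost everywhere.\<close>

definition frame_rel :: "'d signal \<Rightarrow> 'd signal \<Rightarrow> bool" where
  "frame_rel f h \<longleftrightarrow> h \<in> L2 \<and> L2_has_sum (\<lambda>i t. coeff f i * e i t) I h"

lemma term_L2: "i \<in> I \<Longrightarrow> (\<lambda>t. c * e i t) \<in> L2"
  by (intro L2_scale e_L2)

lemma synth_L2: "X \<subseteq> I \<Longrightarrow> (\<lambda>t. \<Sum>i\<in>X. a i * e i t) \<in> L2"
  by (intro L2_sum term_L2) auto

text \<open>The synthesis map is the adjoint of the analysis map and has the same norm. With \<open>y\<close> the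
  synthesized vector, expand \<open>\<parallel>y\<parallel>\<^sup>2\<close> as the sum of \<open>a\<^sub>i \<langle>e\<^sub>i, y\<rangle>\<close> and split each product with weight \<open>B\<close>, so that the
  Bessel inequality for \<open>y\<close> returns half of \<open>\<parallel>y\<parallel>\<^sup>2\<close>.\<close>

lemma synth_norm_le:
  assumes X: "finite X" "X \<subseteq> I"
  shows "(L2_norm (\<lambda>t. \<Sum>i\<in>X. a i * e i t))\<^sup>2 \<le> B * (\<Sum>i\<in>X. (cmod (a i))\<^sup>2)"
proof -
  define y where "y = (\<lambda>t. \<Sum>i\<in>X. a i * e i t)"
  have y: "y \<in> L2" unfolding y_def using X by (intro synth_L2)
  have "L2_inner y y = (\<Sum>i\<in>X. a i * L2_inner (e i) y)"
    by (subst (1) y_def, subst L2_inner_sum_left) 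
      (use X y in \<open>auto simp: L2_inner_scale_left intro!: term_L2\<close>)
  then have "L2_inner y y = (\<Sum>i\<in>X. a i * cnj (coeff y i))"
    by (simp only: L2_inner_commute[of "e _" y])
  then have "(L2_norm y)\<^sup>2 = Re (\<Sum>i\<in>X. a i * cnj (coeff y i))" by (simp add: L2_norm_square_Re)
  also have "\<dots> \<le> (\<Sum>i\<in>X. cmod (a i) * cmod (coeff y i))"
    unfolding Re_sum by (intro sum_mono order_trans[OF complex_Re_le_cmod]) (simp add: norm_mult)
  also have "\<dots> \<le> (\<Sum>i\<in>X. (B * (cmod (a i))\<^sup>2 + (cmod (coeff y i))\<^sup>2 / B) / 2)"
  proof (rule sum_mono)
    fix i
    have "0 \<le> (B * cmod (a i) - cmod (coeff y i))\<^sup>2 / B" using B_pos by simp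
    also have "\<dots> = B * (cmod (a i))\<^sup>2 - 2 * (cmod (a i) * cmod (coeff y i)) + (cmod (coeff y i))\<^sup>2 / B"
      using B_pos by (simp add: power2_diff field_simps power2_eq_square)
    finally show "cmod (a i) * cmod (coeff y i) \<le> (B * (cmod (a i))\<^sup>2 + (cmod (coeff y i))\<^sup>2 / B) / 2"
      by simp
  qed
  also have "\<dots> = (B * (\<Sum>i\<in>X. (cmod (a i))\<^sup>2) + (\<Sum>i\<in>X. (cmod (coeff y i))\<^sup>2) / B) / 2"
    by (simp add: sum.distrib sum_distrib_left flip: sum_divide_distrib)
  also have "\<dots> \<le> (B * (\<Sum>i\<in>X. (cmod (a i))\<^sup>2) + (L2_norm y)\<^sup>2) / 2"
    using Bessel[OF X y] B_pos by (simp add: pos_divide_le_eq mult.commute)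
  finally show ?thesis by (simp add: y_def)
qed

lemma coeff_summable: "f \<in> L2 \<Longrightarrow> (\<lambda>i. (cmod (coeff f i))\<^sup>2) summable_on I"
  by (rule nonneg_bdd_above_summable_on) (auto intro!: bdd_aboveI2[where M = "B * (L2_norm f)\<^sup>2"] Bessel)

lemma coeff_infsum_le: "f \<in> L2 \<Longrightarrow> (\<Sum>\<^sub>\<infinity>i\<in>I. (cmod (coeff f i))\<^sup>2) \<le> B * (L2_norm f)\<^sup>2"
  by (rule infsum_le_finite_sums) (auto intro: Bessel coeff_summable)

text \<open>The squared coefficients are summable, so outside a large finite index set every finite partial
  sum has small norm. Along a nested sequence of such sets the partial sums converge geometrically;
  their limit is then the unconditional sum.\<close>

lemma frame_rel_exists:
  assumes f: "f \<in> L2"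
  shows "\<exists>h. frame_rel f h"
proof -
  let ?c = "\<lambda>i. (cmod (coeff f i))\<^sup>2"
  let ?s = "\<lambda>X t. \<Sum>i\<in>X. coeff f i * e i t"
  define \<epsilon> where "\<epsilon> k = (1/4::real) ^ k / B" for k :: nat
  have \<epsilon>_pos: "\<epsilon> k > 0" for k using B_pos by (simp add: \<epsilon>_def)
  have "\<exists>Y. finite Y \<and> Y \<subseteq> I \<and> (\<forall>Z. finite Z \<and> Z \<subseteq> I \<and> Z \<inter> Y = {} \<longrightarrow> sum ?c Z \<le> \<epsilon> k)" for k
  proof -
    let ?T = "infsum ?c I"
    have "(sum ?c \<longlongrightarrow> ?T) (finite_subsets_at_top I)"
      using has_sum_infsum[OF coeff_summable[OF f]] by (simp add: has_sum_def)
    then have "\<forall>\<^sub>F X in finite_subsets_at_top I. ?T - \<epsilon> k < sum ?c X"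
      using \<epsilon>_pos[of k] by (intro order_tendstoD) auto
    then obtain Y where Y: "finite Y" "Y \<subseteq> I" "?T - \<epsilon> k < sum ?c Y"
      by (auto simp: eventually_finite_subsets_at_top)
    have "sum ?c Z \<le> \<epsilon> k" if "finite Z" "Z \<subseteq> I" "Z \<inter> Y = {}" for Z
    proof -
      have "sum ?c Z + sum ?c Y = sum ?c (Z \<union> Y)" using that Y by (simp add: sum.union_disjoint)
      also have "\<dots> \<le> ?T" using that Y 
        by (intro finite_sum_le_infsum coeff_summable f) auto
      finally show ?thesis using Y(3) by simp
    qed
    then show ?thesis using Y by blast
  qed
  then obtain Y where Y: "\<And>k. finite (Y k)" "\<And>k. Y k \<subseteq> I" 
    "\<And>k Z. \<lbrakk>finite Z; Z \<subseteq> I; Z \<inter> Y k = {}\<rbrakk> \<Longrightarrow> sum ?c Z \<le> \<epsilon> k"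
    by metis
  define X where "X k = (\<Union>j\<le>k. Y j)" for k
  have X: "finite (X k)" "X k \<subseteq> I" "Y k \<subseteq> X k" "X k \<subseteq> X (Suc k)" for k
    using Y(1,2) by (fastforce simp: X_def)+
  have close: "L2_norm (\<lambda>t. ?s Z t - ?s (X k) t) \<le> 1 * (1/2) ^ k" 
    if "finite Z" "X k \<subseteq> Z" "Z \<subseteq> I" for k Z
  proof (rule power2_le_imp_le)
    have "(\<lambda>t. ?s Z t - ?s (X k) t) = ?s (Z - X k)"
      using that by (simp add: sum_diff fun_eq_iff)
    then have "(L2_norm (\<lambda>t. ?s Z t - ?s (X k) t))\<^sup>2 \<le> B * sum ?c (Z - X k)"
      using synth_norm_le[of "Z - X k" "coeff f"] that by (simp add: subset_eq)
    also have "\<dots> \<le> B * \<epsilon> k"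
      using that X(3) B_pos by (intro mult_left_mono Y(3)) auto
    also have "\<dots> = (1 * (1/2) ^ k)\<^sup>2" 
      using B_pos by (simp add: \<epsilon>_def power_mult[symmetric] mult.commute[of k] power_mult power2_eq_square)
        (simp add: power_mult_distrib[symmetric])
    finally show "(L2_norm (\<lambda>t. ?s Z t - ?s (X k) t))\<^sup>2 \<le> (1 * (1/2) ^ k)\<^sup>2" .
  qed simp
  have sX: "?s (X k) \<in> L2" for k using X by (intro synth_L2)
  have "\<exists>h\<in>L2. (\<lambda>k. L2_norm (\<lambda>t. h t - ?s (X k) t)) \<longlonglongrightarrow> 0"
    by (rule L2_complete[where q = "1/2" and C = 1]) (use sX X close in auto)
  then obtain h where h: "h \<in> L2" and lim: "(\<lambda>k. L2_norm (\<lambda>t. h t - ?s (X k) t)) \<longlonglongrightarrow> 0" by blast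
  have "L2_has_sum (\<lambda>i t. coeff f i * e i t) I h"
    unfolding L2_has_sum_def
  proof (rule tendstoI)
    fix r :: real assume "r > 0"
    have "(\<lambda>k. L2_norm (\<lambda>t. h t - ?s (X k) t) + (1/2) ^ k) \<longlonglongrightarrow> 0 + 0"
      by (intro tendsto_add lim LIMSEQ_power_zero) simp
    then have "\<forall>\<^sub>F k in sequentially. L2_norm (\<lambda>t. h t - ?s (X k) t) + (1/2) ^ k < r"
      using \<open>r > 0\<close> by (intro order_tendstoD) auto
    then obtain k where k: "L2_norm (\<lambda>t. h t - ?s (X k) t) + (1/2) ^ k < r"
      by (auto simp: eventually_sequentially)
    show "\<forall>\<^sub>F Z in finite_subsets_at_top I. dist (L2_norm (\<lambda>t. h t - ?s Z t)) 0 < r"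
      unfolding eventually_finite_subsets_at_top
    proof (intro exI[of _ "X k"] conjI allI impI X)
      fix Z assume Z: "finite Z \<and> X k \<subseteq> Z \<and> Z \<subseteq> I"
      have "L2_norm (\<lambda>t. h t - ?s Z t) \<le> L2_norm (\<lambda>t. h t - ?s (X k) t) + L2_norm (\<lambda>t. ?s (X k) t - ?s Z t)"
        using Z by (intro L2_triangle_diff h sX synth_L2) auto
      also have "L2_norm (\<lambda>t. ?s (X k) t - ?s Z t) \<le> (1/2) ^ k"
        using close[of Z k] Z by (subst L2_norm_minus_commute) auto
      finally show "dist (L2_norm (\<lambda>t. h t - ?s Z t)) 0 < r" using k by simp
    qed
  qed
  with h show ?thesis by (auto simp: frame_rel_def)
qed

lemma frame_rel_has_sum:
  assumes "frame_rel f h" "f \<in> L2"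
  shows "((\<lambda>i. (cmod (coeff f i))\<^sup>2) has_sum Re (L2_inner h f)) I"
proof -
  have "((\<lambda>i. L2_inner (\<lambda>t. coeff f i * e i t) f) has_sum L2_inner h f) I"
    using assms by (intro L2_has_sum_inner) (auto simp: frame_rel_def intro: term_L2)
  moreover have "L2_inner (\<lambda>t. coeff f i * e i t) f = complex_of_real ((cmod (coeff f i))\<^sup>2)" for i
    unfolding L2_inner_scale_left L2_inner_commute[of "e i" f] by (rule complex_norm_square[symmetric])
  ultimately have "((\<lambda>i. complex_of_real ((cmod (coeff f i))\<^sup>2)) has_sum L2_inner h f) I" by simp
  from has_sum_Re[OF this] show ?thesis by simp
qed

text \<open>For a positive operator \<open>S\<close> with \<open>S \<le> B\<close> this is \<open>S\<^sup>2 \<le> B S\<close>; it is stronger than the norm bound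
  and is what makes \<open>I - S / B\<close> a contraction in the presence of a lower bound.\<close>

lemma frame_rel_norm_square_le:
  assumes "frame_rel f h" "f \<in> L2"
  shows "(L2_norm h)\<^sup>2 \<le> B * Re (L2_inner h f)"
proof -
  let ?s = "\<lambda>X t. \<Sum>i\<in>X. coeff f i * e i t"
  have h: "h \<in> L2" and lim: "((\<lambda>X. L2_norm (\<lambda>t. h t - ?s X t)) \<longlongrightarrow> 0) (finite_subsets_at_top I)"
    using assms by (auto simp: frame_rel_def L2_has_sum_def)
  let ?q = "Re (L2_inner h f)"
  note hs = frame_rel_has_sum[OF assms]
  have q: "0 \<le> ?q" using hs by (rule has_sum_nonneg) simp
  have "L2_norm h \<le> sqrt (B * ?q) + 0"
  proof (rule tendsto_lowerbound)
    show "((\<lambda>X. sqrt (B * ?q) + L2_norm (\<lambda>t. h t - ?s X t)) \<longlongrightarrow> sqrt (B * ?q) + 0) (finite_subsets_at_top I)"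
      by (intro tendsto_add tendsto_const lim)
    show "\<forall>\<^sub>F X in finite_subsets_at_top I. L2_norm h \<le> sqrt (B * ?q) + L2_norm (\<lambda>t. h t - ?s X t)"
    proof (rule eventually_finite_subsets_at_top_weakI)
      fix X assume X: "finite X" "X \<subseteq> I"
      have "(L2_norm (?s X))\<^sup>2 \<le> B * (\<Sum>i\<in>X. (cmod (coeff f i))\<^sup>2)" by (rule synth_norm_le[OF X])
      also have "\<dots> \<le> B * ?q" 
        using X hs B_pos by (intro mult_left_mono has_sum_mono_neutral[OF has_sum_finite[OF X(1)] hs]) auto
      finally have "L2_norm (?s X) \<le> sqrt (B * ?q)" by (rule real_le_rsqrt)
      then show "L2_norm h \<le> sqrt (B * ?q) + L2_norm (\<lambda>t. h t - ?s X t)"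
        using L2_norm_le_add[OF h synth_L2[OF X(2)], of "coeff f"] by simp
    qed
  qed simp
  then have "(L2_norm h)\<^sup>2 \<le> (sqrt (B * ?q))\<^sup>2" by (intro power_mono) auto
  then show ?thesis using q B_pos by simp
qed

lemma frame_rel_norm_le:
  assumes "frame_rel f h" "f \<in> L2"
  shows "L2_norm h \<le> B * L2_norm f"
proof (cases "L2_norm h = 0")
  case False
  have h: "h \<in> L2" using assms by (simp add: frame_rel_def)
  have "L2_norm h * L2_norm h \<le> B * Re (L2_inner h f)"
    using frame_rel_norm_square_le[OF assms] by (simp add: power2_eq_square)
  also have "\<dots> \<le> B * (L2_norm h * L2_norm f)"
    using L2_Cauchy_Schwarz[OF h assms(2)] complex_Re_le_cmod[of "L2_inner h f"] B_pos 
    by (intro mult_left_mono) auto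
  also have "\<dots> = L2_norm h * (B * L2_norm f)" by simp
  finally show ?thesis by (rule mult_left_le_imp_le) (use False L2_norm_nonneg[of h] in linarith)
qed (use B_pos in simp)

lemma frame_rel_diff:
  assumes "frame_rel f h" "f \<in> L2" "frame_rel g k" "g \<in> L2"
  shows "frame_rel (\<lambda>t. f t - g t) (\<lambda>t. h t - k t)"
proof -
  have L2: "h \<in> L2" "k \<in> L2" using assms by (auto simp: frame_rel_def)
  let ?s = "\<lambda>f X t. \<Sum>i\<in>X. coeff f i * e i t"
  have "((\<lambda>X. L2_norm (\<lambda>t. (h t - k t) - ?s (\<lambda>t. f t - g t) X t)) \<longlongrightarrow> 0) (finite_subsets_at_top I)"
  proof (rule tendsto_sandwich[OF _ _ tendsto_const])
    show "((\<lambda>X. L2_norm (\<lambda>t. h t - ?s f X t) + L2_norm (\<lambda>t. k t - ?s g X t)) \<longlongrightarrow> 0) (finite_subsets_at_top I)"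
      using assms by (intro tendsto_add_zero) (auto simp: frame_rel_def L2_has_sum_def)
    show "\<forall>\<^sub>F X in finite_subsets_at_top I. L2_norm (\<lambda>t. (h t - k t) - ?s (\<lambda>t. f t - g t) X t) 
      \<le> L2_norm (\<lambda>t. h t - ?s f X t) + L2_norm (\<lambda>t. k t - ?s g X t)"
    proof (rule eventually_finite_subsets_at_top_weakI)
      fix X assume X: "finite X" "X \<subseteq> I"
      have "?s (\<lambda>t. f t - g t) X t = ?s f X t - ?s g X t" for t
        unfolding sum_subtractf[symmetric] using X
        by (intro sum.cong refl) (auto simp: L2_inner_diff_left assms e_L2 subset_eq ring_distribs)
      then have "(\<lambda>t. (h t - k t) - ?s (\<lambda>t. f t - g t) X t) 
        = (\<lambda>t. (h t - ?s f X t) - (k t - ?s g X t))" by (simp add: fun_eq_iff)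
      then have "L2_norm (\<lambda>t. (h t - k t) - ?s (\<lambda>t. f t - g t) X t) 
        = L2_norm (\<lambda>t. (h t - ?s f X t) + (-1) * (k t - ?s g X t))"
        by (simp only: mult_minus1 add_uminus_conv_diff)
      also have "\<dots> \<le> L2_norm (\<lambda>t. h t - ?s f X t) + L2_norm (\<lambda>t. (-1) * (k t - ?s g X t))"
        using X L2 by (intro L2_triangle L2_scale L2_diff synth_L2)
      also have "L2_norm (\<lambda>t. (-1) * (k t - ?s g X t)) = L2_norm (\<lambda>t. k t - ?s g X t)"
        by (subst L2_norm_scale) simp
      finally show "L2_norm (\<lambda>t. (h t - k t) - ?s (\<lambda>t. f t - g t) X t) 
        \<le> L2_norm (\<lambda>t. h t - ?s f X t) + L2_norm (\<lambda>t. k t - ?s g X t)" .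
    qed
  qed (auto intro: always_eventually)
  then show ?thesis using L2 by (simp add: frame_rel_def L2_has_sum_def L2_diff)
qed

lemma frame_rel_cong_norm:
  assumes "frame_rel f h" "k \<in> L2" "L2_norm (\<lambda>t. k t - h t) = 0"
  shows "frame_rel f k"
proof -
  let ?s = "\<lambda>X t. \<Sum>i\<in>X. coeff f i * e i t"
  have h: "h \<in> L2" and lim: "((\<lambda>X. L2_norm (\<lambda>t. h t - ?s X t)) \<longlongrightarrow> 0) (finite_subsets_at_top I)"
    using assms by (auto simp: frame_rel_def L2_has_sum_def)
  have "((\<lambda>X. L2_norm (\<lambda>t. k t - ?s X t)) \<longlongrightarrow> 0) (finite_subsets_at_top I)"
  proof (rule tendsto_sandwich[OF _ _ tendsto_const lim])
    show "\<forall>\<^sub>F X in finite_subsets_at_top I. L2_norm (\<lambda>t. k t - ?s X t) \<le> L2_norm (\<lambda>t. h t - ?s X t)"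
      using L2_triangle_diff[OF assms(2) h synth_L2] assms(3)
      by (intro eventually_finite_subsets_at_top_weakI) fastforce
  qed (auto intro: always_eventually)
  then show ?thesis using assms(2) by (simp add: frame_rel_def L2_has_sum_def)
qed

text \<open>The Bessel inequality makes both sides continuous in \<open>f\<close>. The factor \<open>4\<close> pays for
  using \<open>(x + y)\<^sup>2 \<le> 2 x\<^sup>2 + 2 y\<^sup>2\<close> twice.\<close>

lemma lower_bound_from_dense:
  assumes a: "0 < a" and dense: "\<And>f \<epsilon>. \<lbrakk>f \<in> L2; 0 < \<epsilon>\<rbrakk> \<Longrightarrow> \<exists>g\<in>D. g \<in> L2 \<and> L2_norm (\<lambda>t. f t - g t) < \<epsilon>"
    and lower: "\<And>g. g \<in> D \<Longrightarrow> g \<in> L2 \<Longrightarrow> a * (L2_norm g)\<^sup>2 \<le> (\<Sum>\<^sub>\<infinity>i\<in>I. (cmod (coeff g i))\<^sup>2)"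
    and f: "f \<in> L2"
  shows "(a / 4) * (L2_norm f)\<^sup>2 \<le> (\<Sum>\<^sub>\<infinity>i\<in>I. (cmod (coeff f i))\<^sup>2)"
proof -
  let ?S = "\<lambda>f. \<Sum>\<^sub>\<infinity>i\<in>I. (cmod (coeff f i))\<^sup>2"
  have "a * (L2_norm f)\<^sup>2 \<le> 4 * ?S f + r" if r: "0 < r" for r
  proof -
    define \<epsilon> where "\<epsilon> = sqrt (r / (2 * a + 4 * B))"
    have \<epsilon>: "0 < \<epsilon>" "(2 * a + 4 * B) * \<epsilon>\<^sup>2 = r" using r a B_pos by (simp_all add: \<epsilon>_def)
    obtain g where g: "g \<in> D" "g \<in> L2" "L2_norm (\<lambda>t. f t - g t) < \<epsilon>" using dense[OF f \<epsilon>(1)] by blast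
    let ?d = "L2_norm (\<lambda>t. f t - g t)"
    have d: "?d\<^sup>2 \<le> \<epsilon>\<^sup>2" using g(3) by (intro power_mono) auto
    have d_L2: "(\<lambda>t. f t - g t) \<in> L2" by (intro L2_diff f g)
    have "(L2_norm f)\<^sup>2 \<le> (L2_norm g + ?d)\<^sup>2" using L2_norm_le_add[OF f g(2)] by (intro power_mono) auto
    also have "\<dots> \<le> 2 * (L2_norm g)\<^sup>2 + 2 * ?d\<^sup>2"
      using sum_squares_bound[of "L2_norm g" ?d] by (simp add: power2_sum)
    finally have 1: "a * (L2_norm f)\<^sup>2 \<le> 2 * (a * (L2_norm g)\<^sup>2) + 2 * a * ?d\<^sup>2"
      using mult_left_mono[of _ _ a] a by (fastforce simp: ring_distribs)
    have "?S g \<le> (\<Sum>\<^sub>\<infinity>i\<in>I. 2 * (cmod (coeff f i))\<^sup>2 + 2 * (cmod (coeff (\<lambda>t. f t - g t) i))\<^sup>2)"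
    proof (rule infsum_mono)
      show "(\<lambda>i. 2 * (cmod (coeff f i))\<^sup>2 + 2 * (cmod (coeff (\<lambda>t. f t - g t) i))\<^sup>2) summable_on I"
        by (intro summable_on_add summable_on_cmult_right coeff_summable f d_L2)
      fix i assume i: "i \<in> I"
      have "coeff g i = coeff f i - coeff (\<lambda>t. f t - g t) i"
        by (subst L2_inner_diff_left[OF f g(2) e_L2[OF i]]) simp
      then have "cmod (coeff g i) \<le> cmod (coeff f i) + cmod (coeff (\<lambda>t. f t - g t) i)"
        by (simp only: norm_triangle_ineq4)
      then have "(cmod (coeff g i))\<^sup>2 \<le> (cmod (coeff f i) + cmod (coeff (\<lambda>t. f t - g t) i))\<^sup>2"
        by (intro power_mono) auto
      then show "(cmod (coeff g i))\<^sup>2 \<le> 2 * (cmod (coeff f i))\<^sup>2 + 2 * (cmod (coeff (\<lambda>t. f t - g t) i))\<^sup>2"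
        using sum_squares_bound[of "cmod (coeff f i)" "cmod (coeff (\<lambda>t. f t - g t) i)"] by (simp add: power2_sum)
    qed (intro coeff_summable g)
    also have "\<dots> = 2 * ?S f + 2 * ?S (\<lambda>t. f t - g t)"
      by (simp add: infsum_add infsum_cmult_right summable_on_cmult_right coeff_summable f d_L2)
    also have "\<dots> \<le> 2 * ?S f + 2 * (B * ?d\<^sup>2)" using coeff_infsum_le[OF d_L2] by simp
    finally have "a * (L2_norm f)\<^sup>2 \<le> 4 * ?S f + (2 * a + 4 * B) * ?d\<^sup>2"
      using 1 lower[OF g(1,2)] by (simp add: algebra_simps)
    also have "(2 * a + 4 * B) * ?d\<^sup>2 \<le> (2 * a + 4 * B) * \<epsilon>\<^sup>2" using d a B_pos by (intro mult_left_mono) auto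
    finally show ?thesis using \<epsilon>(2) by simp
  qed
  then have "a * (L2_norm f)\<^sup>2 \<le> 4 * ?S f" by (rule field_le_epsilon)
  then show ?thesis by simp
qed

end

locale L2_frame = L2_Bessel +
  fixes A :: real
  assumes A_pos: "0 < A"
    and lower_bound: "f \<in> L2 \<Longrightarrow> A * (L2_norm f)\<^sup>2 \<le> (\<Sum>\<^sub>\<infinity>i\<in>I. (cmod (L2_inner f (e i)))\<^sup>2)"
begin

lemma frame_rel_lower:
  assumes "frame_rel f h" "f \<in> L2"
  shows "A * (L2_norm f)\<^sup>2 \<le> Re (L2_inner h f)"
  using lower_bound[OF assms(2)] infsumI[OF frame_rel_has_sum[OF assms]] by simp

lemma norm_le_frame_rel:
  assumes "frame_rel f h" "f \<in> L2"
  shows "L2_norm f \<le> (1 / A) * L2_norm h"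
proof (cases "L2_norm f = 0")
  case False
  have h: "h \<in> L2" using assms by (simp add: frame_rel_def)
  have "L2_norm f * (A * L2_norm f) \<le> Re (L2_inner h f)"
    using frame_rel_lower[OF assms] by (simp add: power2_eq_square mult_ac)
  also have "\<dots> \<le> L2_norm f * L2_norm h"
    using L2_Cauchy_Schwarz[OF h assms(2)] complex_Re_le_cmod[of "L2_inner h f"] 
    by (simp add: mult.commute)
  finally have "A * L2_norm f \<le> L2_norm h" 
    by (rule mult_left_le_imp_le) (use False L2_norm_nonneg[of f] in linarith)
  then show ?thesis using A_pos by (simp add: field_simps)
qed (use A_pos in simp)

text \<open>Expand the square and use \<open>S\<^sup>2 \<le> B S\<close> and then \<open>S \<ge> A\<close>, where \<open>S\<close> is the frame operator.\<close>

lemma contraction: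
  assumes "frame_rel f h" "f \<in> L2"
  shows "(L2_norm (\<lambda>t. f t - of_real (1 / B) * h t))\<^sup>2 \<le> (1 - A / B) * (L2_norm f)\<^sup>2"
proof -
  have h: "h \<in> L2" using assms by (simp add: frame_rel_def)
  let ?q = "Re (L2_inner h f)"
  have "Re (cnj (of_real (1 / B)) * L2_inner f h) = ?q / B"
    by (simp add: L2_inner_commute[of f h])
  then have "(L2_norm (\<lambda>t. f t - of_real (1 / B) * h t))\<^sup>2 
      = (L2_norm f)\<^sup>2 - 2 * (?q / B) + (1 / B)\<^sup>2 * (L2_norm h)\<^sup>2"
    using L2_norm_diff_scale_square[OF assms(2) h, of "of_real (1 / B)"] B_pos
    by (simp add: norm_divide)
  also have "\<dots> \<le> (L2_norm f)\<^sup>2 - 2 * (?q / B) + (1 / B)\<^sup>2 * (B * ?q)"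
    using frame_rel_norm_square_le[OF assms] by (simp add: mult_left_mono)
  also have "(1 / B)\<^sup>2 * (B * ?q) = ?q / B" using B_pos by (simp add: power2_eq_square)
  also have "(L2_norm f)\<^sup>2 - 2 * (?q / B) + ?q / B = (L2_norm f)\<^sup>2 - ?q / B" by simp
  also have "\<dots> \<le> (L2_norm f)\<^sup>2 - A * (L2_norm f)\<^sup>2 / B"
    using divide_right_mono[OF frame_rel_lower[OF assms], of B] B_pos by simp
  finally show ?thesis by (simp add: algebra_simps)
qed

text \<open>The equation \<open>S f = h\<close> is solved by the iteration \<open>x \<mapsto> x + (h - S x) / B\<close>, whose
  increments are mapped to each other by the contraction \<open>I - S / B\<close>.\<close>

lemma frame_rel_surj:
  assumes h: "h \<in> L2"
  shows "\<exists>f\<in>L2. frame_rel f h"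
proof -
  \<comment> \<open>The operator is made single-valued by choosing a representative of each sum.\<close>
  obtain S where S: "\<And>f. f \<in> L2 \<Longrightarrow> frame_rel f (S f)" using frame_rel_exists by metis
  then have S_L2: "\<And>f. f \<in> L2 \<Longrightarrow> S f \<in> L2" by (auto simp: frame_rel_def)
  define b where "b = complex_of_real (1 / B)"
  define x where "x = rec_nat (\<lambda>t. 0) (\<lambda>_ f t. f t + b * (h t - S f t))"
  have x_0: "x 0 = (\<lambda>t. 0)" and x_Suc: "\<And>k. x (Suc k) = (\<lambda>t. x k t + b * (h t - S (x k) t))"
    by (simp_all add: x_def)
  have x_L2: "x k \<in> L2" for k
    by (induction k) (auto simp: x_0 x_Suc intro!: L2_add L2_scale L2_diff S_L2 h)
  define d where "d k = (\<lambda>t. x (Suc k) t - x k t)" for k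
  have d_L2: "d k \<in> L2" for k unfolding d_def by (intro L2_diff x_L2)
  define q where "q = sqrt (max 0 (1 - A / B))"
  have q: "0 \<le> q" "q < 1" using A_pos B_pos by (auto simp: q_def)
  have d_norm: "L2_norm (d k) \<le> L2_norm (d 0) * q ^ k" for k
  proof (induction k)
    case (Suc k)
    have "frame_rel (d k) (\<lambda>t. S (x (Suc k)) t - S (x k) t)"
      unfolding d_def by (intro frame_rel_diff S x_L2)
    note contraction[OF this d_L2]
    also have "(\<lambda>t. d k t - complex_of_real (1 / B) * (S (x (Suc k)) t - S (x k) t)) = d (Suc k)"
      unfolding b_def[symmetric] by (simp add: d_def x_Suc fun_eq_iff algebra_simps)
    also have "(1 - A / B) * (L2_norm (d k))\<^sup>2 \<le> (q * L2_norm (d k))\<^sup>2"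
      by (simp add: q_def power_mult_distrib mult_right_mono)
    finally have "L2_norm (d (Suc k)) \<le> q * L2_norm (d k)"
      by (rule power2_le_imp_le) (simp add: q)
    also have "\<dots> \<le> q * (L2_norm (d 0) * q ^ k)" by (rule mult_left_mono[OF Suc q(1)])
    finally show ?case by (simp add: mult_ac)
  qed simp
  have "\<exists>f\<in>L2. (\<lambda>k. L2_norm (\<lambda>t. f t - x k t)) \<longlonglongrightarrow> 0"
    by (rule L2_complete[OF x_L2 q L2_norm_nonneg d_norm[unfolded d_def]])
  then obtain f where f: "f \<in> L2" and lim: "(\<lambda>k. L2_norm (\<lambda>t. f t - x k t)) \<longlonglongrightarrow> 0" by blast
  have "L2_norm (\<lambda>t. h t - S f t) \<le> B * (L2_norm (d 0) * q ^ k) + B * L2_norm (\<lambda>t. f t - x k t)" for k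
  proof -
    have "L2_norm (\<lambda>t. h t - S f t) \<le> L2_norm (\<lambda>t. h t - S (x k) t) + L2_norm (\<lambda>t. S (x k) t - S f t)"
      by (intro L2_triangle_diff h S_L2 x_L2 f)
    also have "L2_norm (\<lambda>t. h t - S (x k) t) = B * L2_norm (d k)"
    proof -
      have "d k = (\<lambda>t. b * (h t - S (x k) t))" by (simp add: d_def x_Suc)
      moreover have "cmod b = 1 / B" using B_pos by (simp add: b_def norm_divide)
      ultimately show ?thesis using B_pos by (simp only: L2_norm_scale) simp
    qed
    also have "B * L2_norm (d k) \<le> B * (L2_norm (d 0) * q ^ k)"
      using d_norm B_pos by (intro mult_left_mono) auto
    also have "L2_norm (\<lambda>t. S (x k) t - S f t) \<le> B * L2_norm (\<lambda>t. x k t - f t)"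
      by (intro frame_rel_norm_le frame_rel_diff S x_L2 f L2_diff)
    also have "L2_norm (\<lambda>t. x k t - f t) = L2_norm (\<lambda>t. f t - x k t)"
      by (rule L2_norm_minus_commute)
    finally show ?thesis by simp
  qed
  moreover have "(\<lambda>k. B * (L2_norm (d 0) * q ^ k) + B * L2_norm (\<lambda>t. f t - x k t)) \<longlonglongrightarrow> 0"
    using q by (intro tendsto_add_zero tendsto_mult_right_zero lim LIMSEQ_power_zero) auto
  ultimately have "L2_norm (\<lambda>t. h t - S f t) \<le> 0"
    by (intro tendsto_lowerbound[OF _ always_eventually]) auto
  then have "L2_norm (\<lambda>t. h t - S f t) = 0" using L2_norm_nonneg by (rule antisym)
  with S[OF f] h have "frame_rel f h" by (rule frame_rel_cong_norm)
  with f show ?thesis by blast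
qed

end

text \<open>Schur's test for the Gram matrix. If \<open>s\<close> is the left-hand side and \<open>y\<close> the sum of the vectors
  weighted with their coefficients, then \<open>s = \<langle>f, y\<rangle>\<close>, and \<open>\<parallel>y\<parallel>\<^sup>2 \<le> B s\<close> because a Hermitian matrix is
  bounded by its largest absolute row sum.\<close>

lemma Bessel_Schur:
  fixes e :: "'i \<Rightarrow> ('d::finite) signal"
  assumes X: "finite X" and e: "\<And>i. i \<in> X \<Longrightarrow> e i \<in> L2" and f: "f \<in> L2" and "0 \<le> B"
    and row: "\<And>i. i \<in> X \<Longrightarrow> (\<Sum>j\<in>X. cmod (L2_inner (e i) (e j))) \<le> B"
  shows "(\<Sum>i\<in>X. (cmod (L2_inner f (e i)))\<^sup>2) \<le> B * (L2_norm f)\<^sup>2"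
proof -
  define a where "a i = L2_inner f (e i)" for i
  define K where "K i j = cmod (L2_inner (e i) (e j))" for i j
  define y where "y = (\<lambda>t. \<Sum>i\<in>X. a i * e i t)"
  define s where "s = (\<Sum>i\<in>X. (cmod (a i))\<^sup>2)"
  have s_nonneg: "0 \<le> s" by (simp add: s_def sum_nonneg)
  have K_sym: "K i j = K j i" for i j 
    unfolding K_def by (subst L2_inner_commute) simp
  have y: "y \<in> L2" unfolding y_def by (intro L2_sum L2_scale e)
  have "L2_inner f y = (\<Sum>i\<in>X. cnj (a i) * a i)"
    unfolding y_def a_def by (subst L2_inner_sum_right) (auto intro!: L2_scale e f simp: L2_inner_scale_right)
  also have "\<dots> = of_real s"
    by (simp add: s_def complex_norm_square[symmetric] mult.commute[of "cnj _"] del: of_real_power)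
  finally have "s = cmod (L2_inner f y)" using s_nonneg by simp
  also have "\<dots> \<le> L2_norm f * L2_norm y" by (rule L2_Cauchy_Schwarz[OF f y])
  finally have s_le: "s \<le> L2_norm f * L2_norm y" .
  have "L2_inner y y = (\<Sum>i\<in>X. \<Sum>j\<in>X. a i * cnj (a j) * L2_inner (e i) (e j))"
  proof -
    have "L2_inner y y = (\<Sum>i\<in>X. a i * L2_inner (e i) y)"
      by (subst (1) y_def, subst L2_inner_sum_left) (auto intro!: L2_scale e y simp: L2_inner_scale_left)
    also have "\<dots> = (\<Sum>i\<in>X. a i * (\<Sum>j\<in>X. cnj (a j) * L2_inner (e i) (e j)))"
    proof (intro sum.cong refl arg_cong2[where f = "(*)"])
      fix i assume "i \<in> X"
      then show "L2_inner (e i) y = (\<Sum>j\<in>X. cnj (a j) * L2_inner (e i) (e j))"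
        unfolding y_def by (subst L2_inner_sum_right) (auto intro!: L2_scale e simp: L2_inner_scale_right)
    qed
    finally show ?thesis by (simp add: sum_distrib_left mult.assoc)
  qed
  then have "(L2_norm y)\<^sup>2 = Re (\<Sum>i\<in>X. \<Sum>j\<in>X. a i * cnj (a j) * L2_inner (e i) (e j))"
    by (simp add: L2_norm_square_Re)
  also have "\<dots> \<le> (\<Sum>i\<in>X. \<Sum>j\<in>X. cmod (a i) * cmod (a j) * K i j)"
    unfolding Re_sum by (intro sum_mono order_trans[OF complex_Re_le_cmod]) (simp add: norm_mult K_def)
  also have "\<dots> \<le> (\<Sum>i\<in>X. \<Sum>j\<in>X. ((cmod (a i))\<^sup>2 * K i j + (cmod (a j))\<^sup>2 * K i j) / 2)"
  proof (intro sum_mono)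
    fix i j
    have "cmod (a i) * cmod (a j) \<le> ((cmod (a i))\<^sup>2 + (cmod (a j))\<^sup>2) / 2"
      using sum_squares_bound[of "cmod (a i)" "cmod (a j)"] by simp
    from mult_right_mono[OF this, of "K i j"]
    show "cmod (a i) * cmod (a j) * K i j \<le> ((cmod (a i))\<^sup>2 * K i j + (cmod (a j))\<^sup>2 * K i j) / 2"
      by (simp add: K_def ring_distribs)
  qed
  also have "\<dots> = ((\<Sum>i\<in>X. (cmod (a i))\<^sup>2 * (\<Sum>j\<in>X. K i j)) + (\<Sum>i\<in>X. \<Sum>j\<in>X. (cmod (a j))\<^sup>2 * K i j)) / 2"
    by (simp add: sum.distrib sum_distrib_left add_divide_distrib flip: sum_divide_distrib)
  also have "(\<Sum>i\<in>X. \<Sum>j\<in>X. (cmod (a j))\<^sup>2 * K i j) = (\<Sum>j\<in>X. (cmod (a j))\<^sup>2 * (\<Sum>i\<in>X. K j i))"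
    by (subst sum.swap) (simp add: sum_distrib_left K_sym)
  also have "(\<Sum>i\<in>X. (cmod (a i))\<^sup>2 * (\<Sum>j\<in>X. K i j)) \<le> (\<Sum>i\<in>X. (cmod (a i))\<^sup>2 * B)"
    using row by (intro sum_mono mult_left_mono) (auto simp: K_def)
  finally have "(L2_norm y)\<^sup>2 \<le> (\<Sum>i\<in>X. (cmod (a i))\<^sup>2 * B)"
    by (simp only: add_divide_distrib field_sum_of_halves)
  then have "(L2_norm y)\<^sup>2 \<le> B * s" by (simp add: s_def sum_distrib_left mult.commute)
  then have "s\<^sup>2 \<le> (L2_norm f)\<^sup>2 * (B * s)"
    using power_mono[OF s_le s_nonneg, of 2] mult_left_mono[of "(L2_norm y)\<^sup>2" "B * s" "(L2_norm f)\<^sup>2"]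
    by (simp add: power_mult_distrib)
  then have "s * s \<le> s * (B * (L2_norm f)\<^sup>2)" by (simp add: power2_eq_square mult_ac)
  then have "s \<le> B * (L2_norm f)\<^sup>2"
    using s_nonneg \<open>0 \<le> B\<close> by (cases "s = 0") auto
  then show ?thesis by (simp add: s_def a_def)
qed

section \<open>Gaussian integrals and coherent states\<close>

lemma cis_sum: "cis (sum f X) = (\<Prod>i\<in>X. cis (f i))"
  by (induction X rule: infinite_finite_induct) (auto simp flip: cis_mult)

lemma measurable_cis [measurable]: "cis \<in> borel_measurable borel"
  by (intro borel_measurable_continuous_onI continuous_intros)

text \<open>A rescaling of the characteristic function of the standard normal distribution.\<close>

lemma Gaussian_integral_real:
  fixes a s :: real
  assumes s: "0 < s"
  shows "integrable lborel (\<lambda>t. cis (2 * pi * (a * t)) * complex_of_real (exp (- pi * s * t\<^sup>2)))" (is "integrable _ ?f")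
    and "(\<integral>t. cis (2 * pi * (a * t)) * complex_of_real (exp (- pi * s * t\<^sup>2)) \<partial>lborel)
      = complex_of_real (exp (- pi * a\<^sup>2 / s) / sqrt s)"
proof -
  define c where "c = sqrt (2 * pi * s)"
  have c: "c > 0" "c\<^sup>2 = 2 * pi * s" using s by (simp_all add: c_def)
  have dens: "std_normal_density (c * t) = exp (- pi * s * t\<^sup>2) / sqrt (2 * pi)" for t
    using c(2) by (simp add: std_normal_density_def power_mult_distrib field_simps)
  have "integrable lborel (\<lambda>t. std_normal_density (0 + c * t))"
    using c(1) by (intro lborel_integrable_real_affine integrable_normal_density) auto
  then have "integrable lborel (\<lambda>t. sqrt (2 * pi) * std_normal_density (0 + c * t))"
    by (rule integrable_mult_right)
  then have e: "integrable lborel (\<lambda>t. exp (- pi * s * t\<^sup>2))" by (simp add: dens)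
  show "integrable lborel ?f"
    by (rule Bochner_Integration.integrable_bound[OF e]) (auto simp: norm_mult)
  define \<tau> where "\<tau> = 2 * pi * a / c"
  have "complex_of_real (exp (- (\<tau>\<^sup>2) / 2)) = char std_normal_distribution \<tau>"
    by (simp add: char_std_normal_distribution)
  also have "\<dots> = (\<integral>x. std_normal_density x *\<^sub>R cis (\<tau> * x) \<partial>lborel)"
    unfolding char_def by (subst integral_density) (auto simp: cis_conv_exp)
  also have "\<dots> = c *\<^sub>R (\<integral>t. std_normal_density (0 + c * t) *\<^sub>R cis (\<tau> * (0 + c * t)) \<partial>lborel)"
    using c(1) by (subst lborel_integral_real_affine[where c = c and t = 0]) auto
  also have "(\<lambda>t. std_normal_density (0 + c * t) *\<^sub>R cis (\<tau> * (0 + c * t))) 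
    = (\<lambda>t. (1 / sqrt (2 * pi)) *\<^sub>R ?f t)"
    using c(1) by (simp add: dens \<tau>_def scaleR_conv_of_real fun_eq_iff mult.assoc)
  also have "c *\<^sub>R (\<integral>t. (1 / sqrt (2 * pi)) *\<^sub>R ?f t \<partial>lborel) = sqrt s *\<^sub>R integral\<^sup>L lborel ?f"
    by (simp add: c_def real_sqrt_mult)
  finally have "sqrt s *\<^sub>R integral\<^sup>L lborel ?f = complex_of_real (exp (- (\<tau>\<^sup>2) / 2))" ..
  moreover have "\<tau>\<^sup>2 / 2 = pi * a\<^sup>2 / s"
    using c s by (simp add: \<tau>_def power_divide power_mult_distrib field_simps power2_eq_square)
  ultimately show "integral\<^sup>L lborel ?f = complex_of_real (exp (- pi * a\<^sup>2 / s) / sqrt s)"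
    using s by (simp add: scaleR_conv_of_real field_simps)
qed

text \<open>Both the Gaussian and the character factor over an orthonormal basis.\<close>

lemma Gaussian_integral:
  fixes a :: "'a::euclidean_space"
  assumes s: "0 < s"
  shows "integrable lborel (\<lambda>t. cis (2 * pi * (a \<bullet> t)) * complex_of_real (exp (- pi * s * (t \<bullet> t))))" (is "integrable _ ?f")
    and "(\<integral>t. cis (2 * pi * (a \<bullet> t)) * complex_of_real (exp (- pi * s * (t \<bullet> t))) \<partial>lborel)
      = complex_of_real (exp (- pi * (a \<bullet> a) / s) / sqrt s ^ DIM('a))"
proof -
  interpret product_sigma_finite "\<lambda>_. lborel :: real measure" by standard
  let ?T = "\<lambda>f::'a \<Rightarrow> real. \<Sum>b\<in>Basis. f b *\<^sub>R b"
  let ?g = "\<lambda>b u. cis (2 * pi * ((a \<bullet> b) * u)) * complex_of_real (exp (- pi * s * u\<^sup>2))"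
  have prod: "?f (?T f) = (\<Prod>b\<in>Basis. ?g b (f b))" for f
  proof -
    have "a \<bullet> ?T f = (\<Sum>b\<in>Basis. (a \<bullet> b) * f b)"
      by (subst euclidean_inner) (simp add: inner_sum_left_Basis)
    moreover have "?T f \<bullet> ?T f = (\<Sum>b\<in>Basis. (f b)\<^sup>2)"
      by (subst euclidean_inner) (simp add: inner_sum_left_Basis power2_eq_square)
    ultimately show ?thesis
      by (simp add: sum_distrib_left cis_sum exp_sum prod.distrib flip: of_real_prod sum_negf)
  qed
  have T [measurable]: "?T \<in> measurable (\<Pi>\<^sub>M b\<in>Basis. lborel) borel"
    by measurable
  have f [measurable]: "?f \<in> borel_measurable borel" by measurable
  have "integrable (\<Pi>\<^sub>M b\<in>Basis. lborel) (\<lambda>f. ?f (?T f))"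
    unfolding prod by (intro product_integrable_prod Gaussian_integral_real(1)[OF s] finite_Basis)
  then show "integrable lborel ?f"
    by (subst lborel_eq, subst integrable_distr_eq) auto
  have "integral\<^sup>L lborel ?f = integral\<^sup>L (\<Pi>\<^sub>M b\<in>Basis. lborel) (\<lambda>f. ?f (?T f))"
    by (subst lborel_eq, subst integral_distr) auto
  also have "\<dots> = (\<Prod>b\<in>Basis. integral\<^sup>L lborel (?g b))"
    unfolding prod by (intro product_integral_prod Gaussian_integral_real(1)[OF s] finite_Basis)
  also have "\<dots> = (\<Prod>b\<in>Basis. complex_of_real (exp (- pi * (a \<bullet> b)\<^sup>2 / s) / sqrt s))"
    by (simp only: Gaussian_integral_real(2)[OF s])
  also have "\<dots> = complex_of_real ((\<Prod>b\<in>Basis. exp (- pi * (a \<bullet> b)\<^sup>2 / s)) / sqrt s ^ DIM('a))"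
    by (simp add: prod_dividef)
  also have "(\<Prod>b\<in>Basis. exp (- pi * (a \<bullet> b)\<^sup>2 / s)) = exp (- pi * (a \<bullet> a) / s)"
  proof -
    have "a \<bullet> a = (\<Sum>b\<in>Basis. (a \<bullet> b)\<^sup>2)" by (subst euclidean_inner) (simp add: power2_eq_square)
    then have "- pi * (a \<bullet> a) / s = (\<Sum>b\<in>Basis. - pi * (a \<bullet> b)\<^sup>2 / s)"
      by (simp add: sum_distrib_left sum_divide_distrib sum_negf)
    then show ?thesis by (simp only: exp_sum[OF finite_Basis])
  qed
  finally show "integral\<^sup>L lborel ?f = complex_of_real (exp (- pi * (a \<bullet> a) / s) / sqrt s ^ DIM('a))" .
qed

lemma Gaussian_integrable:
  assumes "0 < s"
  shows "integrable lborel (\<lambda>t::'a::euclidean_space. exp (- pi * s * (t \<bullet> t)))"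
    and "integral\<^sup>L lborel (\<lambda>t::'a. exp (- pi * s * (t \<bullet> t))) = 1 / sqrt s ^ DIM('a)"
proof -
  have "integrable lborel (\<lambda>t::'a. norm (cis (2 * pi * (0 \<bullet> t)) * complex_of_real (exp (- pi * s * (t \<bullet> t)))))"
    by (rule integrable_norm[OF Gaussian_integral(1)[OF assms]])
  then show "integrable lborel (\<lambda>t::'a. exp (- pi * s * (t \<bullet> t)))" by simp
  have "complex_of_real (integral\<^sup>L lborel (\<lambda>t::'a. exp (- pi * s * (t \<bullet> t)))) = complex_of_real (1 / sqrt s ^ DIM('a))"
    using Gaussian_integral(2)[OF assms, of "0::'a"] by (simp flip: integral_complex_of_real)
  then show "integral\<^sup>L lborel (\<lambda>t::'a. exp (- pi * s * (t \<bullet> t))) = 1 / sqrt s ^ DIM('a)"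
    by (simp only: of_real_eq_iff)
qed

lemma lborel_integral_translation:
  fixes f :: "'a::euclidean_space \<Rightarrow> 'b::{banach, second_countable_topology}"
  assumes [measurable]: "f \<in> borel_measurable borel"
  shows "(\<integral>t. f (a + t) \<partial>lborel) = (\<integral>t. f t \<partial>lborel)"
    and "integrable lborel (\<lambda>t. f (a + t)) \<longleftrightarrow> integrable lborel f"
  using integral_distr[of "\<lambda>t. a + t" lborel borel f] integrable_distr_eq[of "\<lambda>t. a + t" lborel borel f]
  by (simp_all add: lborel_distr_plus)

text \<open>The orbit of the Gaussian under the time-frequency shifts consists of the coherent states.\<close>

abbreviation coherent :: "('d::finite) phase \<Rightarrow> 'd signal" where
  "coherent z \<equiv> tf_shift z gaussian"

lemma coherent_eq: 
  "coherent (x, \<omega>) t = cis (2 * pi * (\<omega> \<bullet> t)) * complex_of_real (exp (- pi * ((t - x) \<bullet> (t - x))))"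
  by (simp add: tf_shift_def gaussian_def)

lemma coherent_measurable [measurable]: "coherent z \<in> borel_measurable borel"
proof (cases z)
  case (Pair x \<omega>)
  show ?thesis unfolding Pair coherent_eq[abs_def] by measurable
qed

lemma coherent_L2: 
  fixes z :: "('d::finite) phase"
  shows "coherent z \<in> L2"
proof (cases z)
  case (Pair x \<omega>)
  have "(cmod (coherent z t))\<^sup>2 = exp (- pi * 2 * ((- x + t) \<bullet> (- x + t)))" for t
    by (simp add: Pair coherent_eq norm_mult flip: exp_double)
  moreover have "integrable lborel (\<lambda>t. exp (- pi * 2 * ((- x + t) \<bullet> (- x + t))))"
    using Gaussian_integrable(1)[of 2, where 'a = "real ^ 'd"] 
    by (subst lborel_integral_translation(2)) auto
  ultimately have "integrable lborel (\<lambda>t. (cmod (coherent z t))\<^sup>2)" by simp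
  then have "integrable lebesgue (\<lambda>t. (cmod (coherent z t))\<^sup>2)"
    by (subst integrable_completion) auto
  then show ?thesis unfolding L2_def by (auto intro: measurable_completion)
qed

text \<open>The squared norm of the Gaussian, and hence of every coherent state. It depends on the dimension
  only, which is passed as a type.\<close>

definition gauss_const :: "'d::finite itself \<Rightarrow> real" where
  "gauss_const _ = 1 / sqrt 2 ^ CARD('d)"

lemma gauss_const_pos: "0 < gauss_const TYPE('d::finite)"
  by (simp add: gauss_const_def)

text \<open>Completing the square moves the product of two Gaussians to the midpoint \<open>m\<close> of their centres, at
  the cost of a factor in \<open>x - y\<close>; the remaining integral is the Fourier transform of a Gaussian at
  \<open>\<omega> - \<eta>\<close>.\<close>

lemma coherent_inner_norm:
  fixes z w :: "('d::finite) phase"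
  shows "cmod (L2_inner (coherent z) (coherent w)) 
    = gauss_const TYPE('d) * exp (- (pi / 2) * (norm (z - w))\<^sup>2)"
proof (cases z, cases w)
  fix x \<omega> y \<eta> assume z: "z = (x, \<omega>)" and w: "w = (y, \<eta>)"
  define m where "m = (1/2) *\<^sub>R (x + y)"
  let ?f = "\<lambda>t. coherent z t * cnj (coherent w t)"
  let ?G = "\<lambda>t. cis (2 * pi * ((\<omega> - \<eta>) \<bullet> t)) * complex_of_real (exp (- pi * 2 * (t \<bullet> t)))"
  have sq: "(m + t - x) \<bullet> (m + t - x) + (m + t - y) \<bullet> (m + t - y) 
      = 2 * (t \<bullet> t) + (1/2) * ((x - y) \<bullet> (x - y))" for t
    by (simp add: m_def algebra_simps inner_commute)
  have f_eq: "?f (m + t) = (cis (2 * pi * ((\<omega> - \<eta>) \<bullet> m)) * 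
      complex_of_real (exp (- (pi / 2) * ((x - y) \<bullet> (x - y))))) * ?G t" for t
  proof -
    have gen: "(cis p * complex_of_real (exp u)) * cnj (cis q * complex_of_real (exp v)) 
      = cis (p - q) * complex_of_real (exp (u + v))" for p q u v
    proof -
      have "cis (p - q) = cis p * cis (- q)" by (simp add: cis_mult)
      then show ?thesis by (simp add: cis_cnj exp_add)
    qed
    have "?f (m + t) = cis (2 * pi * (\<omega> \<bullet> (m + t)) - 2 * pi * (\<eta> \<bullet> (m + t))) *
      complex_of_real (exp (- pi * ((m + t - x) \<bullet> (m + t - x)) + - pi * ((m + t - y) \<bullet> (m + t - y))))"
      unfolding z w coherent_eq by (rule gen)
    also have "2 * pi * (\<omega> \<bullet> (m + t)) - 2 * pi * (\<eta> \<bullet> (m + t)) 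
        = 2 * pi * ((\<omega> - \<eta>) \<bullet> m) + 2 * pi * ((\<omega> - \<eta>) \<bullet> t)"
      by (simp add: algebra_simps)
    also have "- pi * ((m + t - x) \<bullet> (m + t - x)) + - pi * ((m + t - y) \<bullet> (m + t - y)) 
        = - pi * ((m + t - x) \<bullet> (m + t - x) + (m + t - y) \<bullet> (m + t - y))"
      by (rule distrib_left[symmetric])
    also have "\<dots> = - (pi / 2) * ((x - y) \<bullet> (x - y)) + (- pi * 2 * (t \<bullet> t))"
      unfolding sq by (simp add: field_simps)
    finally show ?thesis unfolding cis_mult[symmetric] exp_add by (simp add: mult_ac)
  qed
  have "L2_inner (coherent z) (coherent w) = integral\<^sup>L lborel ?f"
    unfolding L2_inner_def by (rule integral_completion) simp
  also have "\<dots> = (\<integral>t. ?f (m + t) \<partial>lborel)"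
    by (rule lborel_integral_translation(1)[symmetric]) simp
  also have "\<dots> = (cis (2 * pi * ((\<omega> - \<eta>) \<bullet> m)) * 
      complex_of_real (exp (- (pi / 2) * ((x - y) \<bullet> (x - y))))) * integral\<^sup>L lborel ?G"
    unfolding f_eq by (rule integral_mult_right_zero)
  also have "integral\<^sup>L lborel ?G = complex_of_real (exp (- pi * ((\<omega> - \<eta>) \<bullet> (\<omega> - \<eta>)) / 2) / sqrt 2 ^ CARD('d))"
    by (subst Gaussian_integral(2)) auto
  finally have "cmod (L2_inner (coherent z) (coherent w)) = 
    exp (- (pi / 2) * ((x - y) \<bullet> (x - y))) * exp (- (pi / 2) * ((\<omega> - \<eta>) \<bullet> (\<omega> - \<eta>))) / sqrt 2 ^ CARD('d)"
    by (simp add: norm_mult norm_divide norm_power)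
  also have "exp (- (pi / 2) * ((x - y) \<bullet> (x - y))) * exp (- (pi / 2) * ((\<omega> - \<eta>) \<bullet> (\<omega> - \<eta>)))
      = exp (- (pi / 2) * (norm (z - w))\<^sup>2)"
  proof -
    have "(norm (z - w))\<^sup>2 = (x - y) \<bullet> (x - y) + (\<omega> - \<eta>) \<bullet> (\<omega> - \<eta>)"
      by (simp add: z w norm_Pair flip: power2_norm_eq_inner)
    then show ?thesis by (simp only: distrib_left exp_add)
  qed
  finally show ?thesis by (simp add: gauss_const_def)
qed

lemma coherent_norm_square: 
  fixes z :: "('d::finite) phase"
  shows "(L2_norm (coherent z))\<^sup>2 = gauss_const TYPE('d)"
proof -
  have "(L2_norm (coherent z))\<^sup>2 = cmod (L2_inner (coherent z) (coherent z))"
    by (simp add: L2_inner_self norm_power)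
  then show ?thesis by (simp add: coherent_inner_norm)
qed

text \<open>The unimodular factor that brings \<open>coherent w\<close> closest to \<open>coherent z\<close> in norm. Nearby
  coherent states need it, since the phase of their inner product oscillates faster the farther
  they are from the origin.\<close>

definition align :: "('d::finite) phase \<Rightarrow> 'd phase \<Rightarrow> complex" where
  "align z w = sgn (L2_inner (coherent z) (coherent w))"

lemma align_norm: "cmod (align z w) = 1"
proof -
  have "cmod (L2_inner (coherent z) (coherent w)) > 0"
    unfolding coherent_inner_norm by (intro mult_pos_pos gauss_const_pos) simp
  then show ?thesis by (simp add: align_def norm_sgn)
qed

definition coherent_diff :: "('d::finite) phase \<Rightarrow> 'd phase \<Rightarrow> 'd signal" where
  "coherent_diff z w = (\<lambda>t. coherent z t - align z w * coherent w t)"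

lemma coherent_diff_L2: "coherent_diff z w \<in> L2"
  unfolding coherent_diff_def by (intro L2_diff L2_scale coherent_L2)

lemma coherent_diff_norm:
  fixes z w :: "('d::finite) phase"
  shows "(L2_norm (coherent_diff z w))\<^sup>2 = 2 * gauss_const TYPE('d) * (1 - exp (- (pi / 2) * (norm (z - w))\<^sup>2))"
proof -
  let ?i = "L2_inner (coherent z) (coherent w)"
  have "cnj (align z w) * ?i = complex_of_real (cmod ?i)"
    by (cases "?i = 0") (auto simp: align_def sgn_div_norm scaleR_conv_of_real 
        complex_norm_square[symmetric] mult.assoc mult.commute[of "cnj _"] power2_eq_square)
  then have "(L2_norm (coherent_diff z w))\<^sup>2 = 2 * gauss_const TYPE('d) - 2 * cmod ?i"
    unfolding coherent_diff_def
    by (subst L2_norm_diff_scale_square[OF coherent_L2 coherent_L2]) (simp add: align_norm coherent_norm_square)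
  then show ?thesis by (simp add: coherent_inner_norm algebra_simps)
qed

lemma L2_inner_diff_scale_le:
  assumes "f \<in> L2" "g \<in> L2" "f' \<in> L2" "g' \<in> L2" "cmod a = 1" "cmod b = 1"
  shows "cmod (L2_inner (\<lambda>t. f t - a * g t) (\<lambda>t. f' t - b * g' t))
    \<le> cmod (L2_inner f f') + cmod (L2_inner f g') + cmod (L2_inner g f') + cmod (L2_inner g g')"
proof -
  have "L2_inner (\<lambda>t. f t - a * g t) (\<lambda>t. f' t - b * g' t) =
    (L2_inner f f' - cnj b * L2_inner f g') - a * (L2_inner g f' - cnj b * L2_inner g g')"
    using assms by (simp add: L2_inner_diff_left L2_inner_diff_right L2_diff L2_scale
      L2_inner_scale_left L2_inner_scale_right)
  then have "cmod (L2_inner (\<lambda>t. f t - a * g t) (\<lambda>t. f' t - b * g' t)) 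
    \<le> cmod (L2_inner f f' - cnj b * L2_inner f g') + cmod (a * (L2_inner g f' - cnj b * L2_inner g g'))"
    by (simp only: norm_triangle_ineq4)
  also have "\<dots> \<le> (cmod (L2_inner f f') + cmod (cnj b * L2_inner f g')) 
    + (cmod (L2_inner g f') + cmod (cnj b * L2_inner g g'))"
    unfolding norm_mult[of a] assms(5) mult_1 by (intro add_mono norm_triangle_ineq4)
  also have "\<dots> = cmod (L2_inner f f') + cmod (L2_inner f g') + cmod (L2_inner g f') + cmod (L2_inner g g')"
    using assms(6) by (simp add: norm_mult)
  finally show ?thesis .
qed

text \<open>Moves the centre of a Gaussian to the origin, at the price of half of its decay rate and a
  constant factor.\<close>

lemma norm_add_square_ge: 
  fixes v e :: "'a::real_inner"
  shows "(norm v)\<^sup>2 / 2 - (norm e)\<^sup>2 \<le> (norm (v + e))\<^sup>2"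
proof -
  have "(norm v)\<^sup>2 \<le> (norm (v + e) + norm e)\<^sup>2"
    using norm_triangle_ineq4[of "v + e" e] by (intro power_mono) auto
  also have "\<dots> \<le> 2 * (norm (v + e))\<^sup>2 + 2 * (norm e)\<^sup>2"
    using sum_squares_bound[of "norm (v + e)" "norm e"] by (simp add: power2_sum)
  finally show ?thesis by simp
qed

text \<open>There are two bounds for the inner product: it is small by the Cauchy--Schwarz inequality,
  because aligned coherent states at nearby points almost agree, and it has
  Gaussian decay in \<open>l - l'\<close>, because each of its four constituents does. The geometric mean of
  the two is both small and summable over a lattice.\<close>

lemma coherent_diff_inner_le:
  fixes z w l l' :: "('d::finite) phase"
  assumes "norm (z - w) \<le> 1"
  shows "cmod (L2_inner (coherent_diff (l + z) (l + w)) (coherent_diff (l' + z) (l' + w)))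
    \<le> sqrt (8 * exp (pi / 2) * (1 - exp (- (pi / 2) * (norm (z - w))\<^sup>2))) * gauss_const TYPE('d) 
      * exp (- (pi / 8) * (norm (l - l'))\<^sup>2)"
proof -
  define c where "c = gauss_const TYPE('d)"
  have c: "c > 0" by (simp add: c_def gauss_const_pos)
  define D where "D = 1 - exp (- (pi / 2) * (norm (z - w))\<^sup>2)"
  have D: "0 \<le> D" by (simp add: D_def)
  define E where "E = exp (- (pi / 8) * (norm (l - l'))\<^sup>2)"
  let ?i = "cmod (L2_inner (coherent_diff (l + z) (l + w)) (coherent_diff (l' + z) (l' + w)))"
  have cross: "cmod (L2_inner (coherent p) (coherent q)) \<le> c * exp (pi / 2) * E\<^sup>2"
    if "norm ((p - q) - (l - l')) \<le> 1" for p q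
  proof -
    have "(norm (l - l'))\<^sup>2 / 2 - (norm ((p - q) - (l - l')))\<^sup>2 \<le> (norm (p - q))\<^sup>2"
      using norm_add_square_ge[of "l - l'" "(p - q) - (l - l')"] by simp
    moreover have "(norm ((p - q) - (l - l')))\<^sup>2 \<le> 1" using that by (simp add: power_le_one)
    ultimately have "(norm (l - l'))\<^sup>2 / 2 - 1 \<le> (norm (p - q))\<^sup>2" by linarith
    then have "- (pi / 2) * (norm (p - q))\<^sup>2 \<le> - (pi / 2) * ((norm (l - l'))\<^sup>2 / 2 - 1)"
      by (intro mult_left_mono_neg) auto
    also have "\<dots> = pi / 2 + 2 * (- (pi / 8) * (norm (l - l'))\<^sup>2)" by (simp add: algebra_simps)
    finally have "exp (- (pi / 2) * (norm (p - q))\<^sup>2) \<le> exp (pi / 2) * E\<^sup>2"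
      unfolding E_def exp_double[symmetric] exp_add[symmetric] by (simp only: exp_le_cancel_iff)
    then show ?thesis using c by (simp add: coherent_inner_norm c_def mult.assoc)
  qed
  have "?i \<le> c * exp (pi / 2) * E\<^sup>2 + c * exp (pi / 2) * E\<^sup>2 + c * exp (pi / 2) * E\<^sup>2 + c * exp (pi / 2) * E\<^sup>2"
    unfolding coherent_diff_def
    by (rule order_trans[OF L2_inner_diff_scale_le], (intro coherent_L2 align_norm)+, intro add_mono cross)
      (use assms in \<open>auto simp: norm_minus_commute algebra_simps\<close>)
  then have 1: "?i \<le> 4 * c * exp (pi / 2) * E\<^sup>2" by (simp add: mult_ac)
  have "?i \<le> L2_norm (coherent_diff (l + z) (l + w)) * L2_norm (coherent_diff (l' + z) (l' + w))"
    by (intro L2_Cauchy_Schwarz coherent_diff_L2)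
  also have "\<dots> = sqrt (2 * c * D) * sqrt (2 * c * D)"
    using coherent_diff_norm[of "l + z" "l + w"] coherent_diff_norm[of "l' + z" "l' + w"]
    by (metis D_def L2_norm_nonneg add_diff_cancel_left c_def real_sqrt_unique)
  also have "\<dots> = 2 * c * D" using c D by simp
  finally have 2: "?i \<le> 2 * c * D" .
  have "?i\<^sup>2 \<le> (4 * c * exp (pi / 2) * E\<^sup>2) * (2 * c * D)"
    unfolding power2_eq_square[of ?i] using 1 2 c by (intro mult_mono) auto
  also have "\<dots> = (sqrt (8 * exp (pi / 2) * D) * c * E)\<^sup>2"
    using D by (simp add: power_mult_distrib power2_eq_square)
  finally have "?i \<le> sqrt (8 * exp (pi / 2) * D) * c * E"
    by (rule power2_le_imp_le) (use c D in \<open>simp add: E_def\<close>)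
  then show ?thesis by (simp add: c_def D_def E_def)
qed

section \<open>Lattices in phase space\<close>

lemma sum_exp_minus_square_bounded:
  fixes a :: real
  assumes a: "0 < a"
  shows "\<exists>T\<ge>0. \<forall>G::int set. finite G \<longrightarrow> (\<Sum>m\<in>G. exp (- a * (real_of_int m)\<^sup>2)) \<le> T"
proof (intro exI conjI allI impI)
  define r where "r = exp (- a)"
  have r: "0 < r" "r < 1" using a by (simp_all add: r_def)
  let ?\<phi> = "\<lambda>m::int. exp (- a * (real_of_int m)\<^sup>2)"
  have \<phi>: "?\<phi> (int n) \<le> r ^ n" "?\<phi> (- int n) \<le> r ^ n" for n
  proof -
    have "n \<le> n ^ 2" by (simp add: power2_nat_le_imp_le)
    then have "real n \<le> (real n)\<^sup>2" by (metis of_nat_le_iff of_nat_power)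
    then have "- a * (real n)\<^sup>2 \<le> real n * - a" using a by simp
    then have "exp (- a * (real n)\<^sup>2) \<le> exp (real n * - a)" by (simp only: exp_le_cancel_iff)
    then show "?\<phi> (int n) \<le> r ^ n" "?\<phi> (- int n) \<le> r ^ n" 
      unfolding r_def exp_of_nat_mult[symmetric] by simp_all
  qed
  show "0 \<le> 2 / (1 - r)" using r by simp
  fix G :: "int set" assume G: "finite G"
  define N where "N = nat (Max (insert 0 (abs ` G)))"
  have N: "\<bar>m\<bar> \<le> int N" if "m \<in> G" for m 
    using that G unfolding N_def by (subst int_nat_eq) (auto intro!: Max_ge simp: Max_ge_iff)
  have geo: "(\<Sum>n\<le>N. r ^ n) \<le> 1 / (1 - r)"
    using r sum_gp0[of r N] by (simp add: divide_right_mono)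
  have "G \<subseteq> int ` {..N} \<union> (\<lambda>n. - int n) ` {..N}"
  proof
    fix m assume "m \<in> G"
    from N[OF this] have "nat \<bar>m\<bar> \<le> N" by simp
    then show "m \<in> int ` {..N} \<union> (\<lambda>n. - int n) ` {..N}"
      by (cases "m \<ge> 0") (auto intro!: image_eqI[of _ _ "nat \<bar>m\<bar>"])
  qed
  then have "sum ?\<phi> G \<le> sum ?\<phi> (int ` {..N} \<union> (\<lambda>n. - int n) ` {..N})"
    by (intro sum_mono2) auto
  also have "\<dots> \<le> sum ?\<phi> (int ` {..N}) + sum ?\<phi> ((\<lambda>n. - int n) ` {..N})"
    by (subst sum_Un) (auto intro!: sum_nonneg)
  also have "\<dots> = (\<Sum>n\<le>N. ?\<phi> (int n)) + (\<Sum>n\<le>N. ?\<phi> (- int n))"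
    by (subst sum.reindex, simp add: inj_on_def, subst sum.reindex) (auto simp: inj_on_def)
  also have "\<dots> \<le> (\<Sum>n\<le>N. r ^ n) + (\<Sum>n\<le>N. r ^ n)"
    by (intro add_mono sum_mono \<phi>)
  also have "\<dots> \<le> 2 / (1 - r)" using geo by simp
  finally show "sum ?\<phi> G \<le> 2 / (1 - r)" .
qed

text \<open>A Gaussian on integer vectors is a product over the coordinates, so its sum over a box is a
  product of one-dimensional sums.\<close>

lemma sum_Gaussian_int_vec_bounded:
  fixes a :: real
  assumes a: "0 < a"
  shows "\<exists>T. \<forall>Y::(real ^ 'n::finite) set. finite Y \<longrightarrow> (\<forall>k\<in>Y. \<forall>i. k $ i \<in> \<int>) 
    \<longrightarrow> (\<Sum>k\<in>Y. exp (- a * (norm k)\<^sup>2)) \<le> T"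
proof -
  obtain T where T: "0 \<le> T" "\<And>G::int set. finite G \<Longrightarrow> (\<Sum>m\<in>G. exp (- a * (real_of_int m)\<^sup>2)) \<le> T"
    using sum_exp_minus_square_bounded[OF a] by blast
  have "(\<Sum>k\<in>Y. exp (- a * (norm k)\<^sup>2)) \<le> T ^ CARD('n)" 
    if Y: "finite Y" "\<And>k i. k \<in> Y \<Longrightarrow> k $ i \<in> \<int>" for Y :: "(real ^ 'n) set"
  proof -
    let ?\<phi> = "\<lambda>m. exp (- a * (real_of_int m)\<^sup>2)"
    define \<iota> where "\<iota> k = (\<lambda>i. \<lfloor>k $ i\<rfloor>)" for k :: "real ^ 'n"
    define G where "G i = (\<lambda>k. \<lfloor>k $ i\<rfloor>) ` Y" for i
    have fl: "real_of_int \<lfloor>k $ i\<rfloor> = k $ i" if "k \<in> Y" for k i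
      using Y(2)[OF that, of i] by (metis Ints_cases floor_of_int)
    have inj: "inj_on \<iota> Y"
    proof (rule inj_onI)
      fix k k' assume k: "k \<in> Y" "k' \<in> Y" "\<iota> k = \<iota> k'"
      then have "\<lfloor>k $ i\<rfloor> = \<lfloor>k' $ i\<rfloor>" for i by (simp add: \<iota>_def fun_eq_iff)
      then show "k = k'" using fl k by (metis vec_eq_iff)
    qed
    have "(\<Sum>k\<in>Y. exp (- a * (norm k)\<^sup>2)) = (\<Sum>k\<in>Y. \<Prod>i\<in>UNIV. ?\<phi> (\<iota> k i))"
    proof (rule sum.cong[OF refl])
      fix k assume "k \<in> Y"
      have "(norm k)\<^sup>2 = (\<Sum>i\<in>UNIV. (k $ i)\<^sup>2)"
        unfolding power2_norm_eq_inner inner_vec_def by (simp add: power2_eq_square)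
      then have "- a * (norm k)\<^sup>2 = (\<Sum>i\<in>UNIV. - a * (real_of_int (\<iota> k i))\<^sup>2)"
        unfolding \<iota>_def fl[OF \<open>k \<in> Y\<close>] by (simp add: sum_distrib_left sum_negf)
      then show "exp (- a * (norm k)\<^sup>2) = (\<Prod>i\<in>UNIV. ?\<phi> (\<iota> k i))"
        by (simp only: exp_sum[OF finite])
    qed
    also have "\<dots> = (\<Sum>g\<in>\<iota> ` Y. \<Prod>i\<in>UNIV. ?\<phi> (g i))"
      by (simp add: sum.reindex[OF inj])
    also have "\<dots> \<le> (\<Sum>g\<in>PiE UNIV G. \<Prod>i\<in>UNIV. ?\<phi> (g i))"
      using Y(1) by (intro sum_mono2 finite_PiE) (auto simp: G_def \<iota>_def intro!: prod_nonneg)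
    also have "\<dots> = (\<Prod>i\<in>UNIV. \<Sum>m\<in>G i. ?\<phi> m)"
      using Y(1) by (subst prod_sum_PiE) (auto simp: G_def)
    also have "\<dots> \<le> (\<Prod>i\<in>(UNIV::'n set). T)"
      using Y(1) by (intro prod_mono conjI sum_nonneg T(2)) (auto simp: G_def)
    finally show ?thesis by simp
  qed
  then show ?thesis by blast
qed

text \<open>The only consequence of the matrix description that is used below: a lattice is the image of
  the integer vectors under a linear isomorphism.\<close>

lemma lattice_linear:
  fixes \<Lambda> :: "('d::finite) phase set"
  assumes "is_lattice \<Lambda>"
  obtains L :: "real ^ ('d + 'd) \<Rightarrow> 'd phase" where
    "linear L" "inj L" "surj L" "\<Lambda> = {L k | k. \<forall>i. k $ i \<in> \<int>}"
proof -
  obtain A :: "real ^ ('d + 'd) ^ ('d + 'd)" where A: "invertible A" 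
    "\<Lambda> = {to_phase (A *v k) | k. \<forall>i. k $ i \<in> \<int>}"
    using assms by (auto simp: is_lattice_def)
  have lin: "linear (to_phase :: real ^ ('d + 'd) \<Rightarrow> 'd phase)"
    by (rule linearI) (auto simp: to_phase_def vec_eq_iff)
  have inj: "inj (to_phase :: real ^ ('d + 'd) \<Rightarrow> 'd phase)"
  proof (rule injI)
    fix u v :: "real ^ ('d + 'd)" assume *: "to_phase u = to_phase v"
    have "u $ i = v $ i" for i
      using * by (cases i) (auto simp: to_phase_def vec_eq_iff)
    then show "u = v" by (simp add: vec_eq_iff)
  qed
  have surj: "surj (to_phase :: real ^ ('d + 'd) \<Rightarrow> 'd phase)"
  proof (rule surjI[where f = "\<lambda>z. \<chi> i. case i of Inl j \<Rightarrow> fst z $ j | Inr j \<Rightarrow> snd z $ j"])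
    fix z :: "'d phase"
    show "to_phase (\<chi> i. case i of Inl j \<Rightarrow> fst z $ j | Inr j \<Rightarrow> snd z $ j) = z"
      by (simp add: to_phase_def)
  qed
  show ?thesis
  proof (rule that[of "to_phase \<circ> (*v) A"])
    show "linear (to_phase \<circ> (*v) A)" by (intro linear_compose lin matrix_vector_mul_linear)
    show "inj (to_phase \<circ> (*v) A)" 
      by (intro inj_compose inj) (use A(1) in \<open>simp add: invertible_eq_bij bij_is_inj\<close>)
    show "surj (to_phase \<circ> (*v) A)" 
      by (intro comp_surj surj) (use A(1) in \<open>simp add: invertible_eq_bij bij_is_surj\<close>)
    show "\<Lambda> = {(to_phase \<circ> (*v) A) k | k. \<forall>i. k $ i \<in> \<int>}" using A(2) by simp
  qed
qed

lemma lattice_diff: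
  fixes \<Lambda> :: "('d::finite) phase set"
  assumes "is_lattice \<Lambda>" "l \<in> \<Lambda>" "l' \<in> \<Lambda>"
  shows "l - l' \<in> \<Lambda>"
proof -
  obtain L :: "real ^ ('d + 'd) \<Rightarrow> 'd phase" where L: "linear L" "\<Lambda> = {L k | k. \<forall>i. k $ i \<in> \<int>}"
    using assms(1) by (rule lattice_linear)
  then obtain k k' where "l = L k" "\<forall>i. k $ i \<in> \<int>" "l' = L k'" "\<forall>i. k' $ i \<in> \<int>" using assms by auto
  then show ?thesis unfolding L(2) mem_Collect_eq
    by (intro exI[of _ "k - k'"]) (simp add: linear_diff[OF L(1)])
qed

lemma lattice_countable:
  fixes \<Lambda> :: "('d::finite) phase set"
  assumes "is_lattice \<Lambda>"
  shows "countable \<Lambda>"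
proof -
  obtain L where L: "\<Lambda> = {L k | k :: real ^ ('d + 'd). \<forall>i. k $ i \<in> \<int>}"
    using assms by (rule lattice_linear)
  have "countable (\<int> :: real set)" unfolding Ints_def by simp
  then have "countable ((\<lambda>g. L (\<chi> i. g i)) ` (PiE UNIV (\<lambda>_. \<int>)))"
    by (intro countable_image countable_PiE) auto
  moreover have "\<Lambda> \<subseteq> (\<lambda>g. L (\<chi> i. g i)) ` (PiE UNIV (\<lambda>_. \<int>))"
  proof
    fix l assume "l \<in> \<Lambda>"
    then obtain k where k: "l = L k" "\<forall>i. k $ i \<in> \<int>" unfolding L by blast
    then show "l \<in> (\<lambda>g. L (\<chi> i. g i)) ` (PiE UNIV (\<lambda>_. \<int>))"
      by (intro image_eqI[of _ _ "\<lambda>i. k $ i"]) auto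
  qed
  ultimately show ?thesis by (rule countable_subset[rotated])
qed

text \<open>The image of the unit cube, by rounding coordinates down.\<close>

lemma lattice_cover:
  fixes \<Lambda> :: "('d::finite) phase set"
  assumes "is_lattice \<Lambda>"
  obtains Q where "compact Q" "\<And>z. \<exists>l\<in>\<Lambda>. z - l \<in> Q"
proof -
  obtain L where L: "linear L" "surj L" "\<Lambda> = {L k | k :: real ^ ('d + 'd). \<forall>i. k $ i \<in> \<int>}"
    using assms by (rule lattice_linear)
  show ?thesis
  proof (rule that[of "L ` cbox 0 (\<chi> i. 1)"])
    show "compact (L ` cbox 0 (\<chi> i. 1))"
      by (intro compact_continuous_image linear_continuous_on compact_cbox) 
        (use L(1) in \<open>simp add: linear_conv_bounded_linear\<close>)
    fix z
    obtain v where v: "z = L v" using L(2) by (metis surjD)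
    define k where "k = (\<chi> i. real_of_int \<lfloor>v $ i\<rfloor>)"
    have "z - L k = L (v - k)" by (simp add: v linear_diff[OF L(1)])
    moreover have "v - k \<in> cbox 0 (\<chi> i. 1)"
      unfolding mem_box_cart by (auto simp: k_def) linarith
    moreover have "L k \<in> \<Lambda>" unfolding L(3) by (auto simp: k_def)
    ultimately show "\<exists>l\<in>\<Lambda>. z - l \<in> L ` cbox 0 (\<chi> i. 1)" by (metis imageI)
  qed
qed

lemma lattice_Gaussian_sum_bounded:
  fixes \<Lambda> :: "('d::finite) phase set"
  assumes \<Lambda>: "is_lattice \<Lambda>" and a: "0 < a"
  shows "\<exists>T>0. \<forall>X l. finite X \<longrightarrow> X \<subseteq> \<Lambda> \<longrightarrow> l \<in> \<Lambda> \<longrightarrow> (\<Sum>l'\<in>X. exp (- a * (norm (l - l'))\<^sup>2)) \<le> T"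
proof -
  obtain L where L: "linear L" "inj L" "\<Lambda> = {L k | k :: real ^ ('d + 'd). \<forall>i. k $ i \<in> \<int>}"
    using \<Lambda> by (rule lattice_linear)
  obtain b where b: "0 < b" "\<And>v. b * norm v \<le> norm (L v)"
    using linear_inj_bounded_below_pos[OF L(1,2)] by blast
  have "0 < a * b\<^sup>2" using a b(1) by simp
  from sum_Gaussian_int_vec_bounded[OF this]
  obtain T where T: "\<forall>Y::(real ^ ('d + 'd)) set. finite Y \<longrightarrow> (\<forall>k\<in>Y. \<forall>i. k $ i \<in> \<int>) 
    \<longrightarrow> (\<Sum>k\<in>Y. exp (- (a * b\<^sup>2) * (norm k)\<^sup>2)) \<le> T" ..
  have "(\<Sum>l'\<in>X. exp (- a * (norm (l - l'))\<^sup>2)) \<le> max T 1" if "finite X" "X \<subseteq> \<Lambda>" "l \<in> \<Lambda>" for X l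
  proof -
    define Y where "Y = inv L ` ((\<lambda>l'. l - l') ` X)"
    have mem: "\<exists>k. l - l' = L k \<and> inv L (l - l') = k \<and> (\<forall>i. k $ i \<in> \<int>)" if "l' \<in> X" for l'
    proof -
      have "l - l' \<in> \<Lambda>" using lattice_diff[OF \<Lambda> \<open>l \<in> \<Lambda>\<close>, of l'] that \<open>X \<subseteq> \<Lambda>\<close> by blast
      then obtain k where "l - l' = L k" "\<forall>i. k $ i \<in> \<int>" unfolding L(3) by blast
      then show ?thesis using L(2) by simp
    qed
    have inj: "inj_on (\<lambda>l'. inv L (l - l')) X"
    proof (rule inj_onI)
      fix l' l'' assume *: "l' \<in> X" "l'' \<in> X" "inv L (l - l') = inv L (l - l'')"
      from mem[OF *(1)] mem[OF *(2)] *(3) have "l - l' = l - l''" by auto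
      then show "l' = l''" by simp
    qed
    have "(\<Sum>l'\<in>X. exp (- a * (norm (l - l'))\<^sup>2)) 
      \<le> (\<Sum>l'\<in>X. exp (- (a * b\<^sup>2) * (norm (inv L (l - l')))\<^sup>2))"
    proof (rule sum_mono)
      fix l' assume "l' \<in> X"
      then obtain k where k: "l - l' = L k" "inv L (l - l') = k" using mem by blast
      have "(b * norm k)\<^sup>2 \<le> (norm (L k))\<^sup>2" using b by (intro power_mono) auto
      then have "a * (b * norm k)\<^sup>2 \<le> a * (norm (L k))\<^sup>2" using a by simp
      then show "exp (- a * (norm (l - l'))\<^sup>2) \<le> exp (- (a * b\<^sup>2) * (norm (inv L (l - l')))\<^sup>2)"
        unfolding k(2) unfolding k(1) by (simp add: power_mult_distrib)
    qed
    also have "\<dots> = (\<Sum>k\<in>Y. exp (- (a * b\<^sup>2) * (norm k)\<^sup>2))"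
      unfolding Y_def image_image by (simp add: sum.reindex[OF inj])
    also have "\<dots> \<le> T"
    proof (rule T[rule_format])
      show "finite Y" using that by (simp add: Y_def)
      show "k $ i \<in> \<int>" if "k \<in> Y" for k i using that mem by (fastforce simp: Y_def)
    qed
    finally show ?thesis by simp
  qed
  then show ?thesis by (intro exI[of _ "max T 1"]) auto
qed

section \<open>Submultiplicative weights\<close>

text \<open>Outside a set of small measure in the ball of radius \<open>2\<close>, the weight is at most \<open>k\<close> for
  some \<open>k\<close>. Two copies of this exceptional set, one of them translated by \<open>z\<close>, are too small to
  cover the unit ball, so \<open>z\<close> is a difference of two points at which the weight is at most \<open>k\<close>.\<close>

lemma submultiplicative_bounded_near_0:
  fixes \<nu> :: "'a::euclidean_space \<Rightarrow> real"
  assumes meas: "\<nu> \<in> borel_measurable lebesgue" and pos: "\<And>z. 0 < \<nu> z"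
    and sub: "\<And>z w. \<nu> (z + w) \<le> \<nu> z * \<nu> w" and even: "\<And>z. \<nu> (- z) = \<nu> z"
  shows "\<exists>K. \<forall>z. norm z \<le> 1 \<longrightarrow> \<nu> z \<le> K"
proof -
  define B where "B k = {w \<in> ball 0 2. real k < \<nu> w}" for k
  have B_meas: "B k \<in> lmeasurable" for k
  proof (rule bounded_set_imp_lmeasurable)
    show "bounded (B k)" by (rule bounded_subset[of "ball 0 2"]) (auto simp: B_def)
    have "B k = ball 0 2 \<inter> {w \<in> space lebesgue. real k < \<nu> w}" by (auto simp: B_def)
    also have "\<dots> \<in> sets lebesgue"
      using meas by (intro sets.Int borel_measurable_less) auto
    finally show "B k \<in> sets lebesgue" .
  qed
  have "(\<lambda>k. measure lebesgue (B k)) \<longlonglongrightarrow> measure lebesgue (\<Inter>k. B k)"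
  proof (rule Lim_measure_decseq)
    show "range B \<subseteq> sets lebesgue" using B_meas by auto
    show "decseq B" by (auto simp: decseq_def B_def)
    show "emeasure lebesgue (B k) \<noteq> \<infinity>" for k
      using fmeasurableD2[OF B_meas[of k]] by simp
  qed
  moreover have "(\<Inter>k. B k) = {}"
  proof (intro equals0I)
    fix w assume "w \<in> (\<Inter>k. B k)"
    then have "real k < \<nu> w" for k by (auto simp: B_def)
    moreover obtain k where "\<nu> w < real k" using reals_Archimedean2 by blast
    ultimately show False by (meson less_asym)
  qed
  ultimately have "(\<lambda>k. measure lebesgue (B k)) \<longlonglongrightarrow> 0" by simp
  moreover have b: "0 < measure lebesgue (ball 0 1 :: 'a set) / 2"
    by (simp add: content_ball_pos)
  ultimately have "\<forall>\<^sub>F k in sequentially. measure lebesgue (B k) < measure lebesgue (ball 0 1 :: 'a set) / 2"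
    by (rule order_tendstoD)
  then obtain k where k: "measure lebesgue (B k) < measure lebesgue (ball 0 1 :: 'a set) / 2"
    by (auto simp: eventually_sequentially)
  have "\<nu> z \<le> (real k)\<^sup>2" if z: "norm z \<le> 1" for z
  proof (rule ccontr)
    assume less: "\<not> \<nu> z \<le> (real k)\<^sup>2"
    have "ball 0 1 \<subseteq> B k \<union> (+) z ` B k"
    proof
      fix w :: 'a assume "w \<in> ball 0 1"
      then have w: "norm w < 1" by simp
      then have wz: "norm (w - z) < 2" using z norm_triangle_ineq4[of w z] by linarith
      show "w \<in> B k \<union> (+) z ` B k"
      proof (rule ccontr)
        assume n: "w \<notin> B k \<union> (+) z ` B k"
        then have 1: "\<nu> w \<le> real k" using w by (auto simp: B_def)
        have "w - z \<notin> B k" using n by (auto simp: image_iff algebra_simps)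
        then have 2: "\<nu> (w - z) \<le> real k" using wz by (auto simp: B_def)
        have "\<nu> z = \<nu> (w + - (w - z))" by simp
        also have "\<dots> \<le> \<nu> w * \<nu> (w - z)" using sub[of w "- (w - z)"] even[of "w - z"] by simp
        also have "\<dots> \<le> real k * real k" using 1 2 pos by (intro mult_mono) (auto intro: less_imp_le)
        finally show False using less by (simp add: power2_eq_square)
      qed
    qed
    then have "measure lebesgue (ball 0 1 :: 'a set) \<le> measure lebesgue (B k \<union> (+) z ` B k)"
      by (intro measure_mono_fmeasurable fmeasurable.Un measurable_translation B_meas) auto
    also have "\<dots> \<le> measure lebesgue (B k) + measure lebesgue ((+) z ` B k)"
      by (intro measure_Un_le fmeasurableD measurable_translation B_meas)
    also have "\<dots> = 2 * measure lebesgue (B k)" by (simp add: measure_translation)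
    finally show False using k by simp
  qed
  then show ?thesis by blast
qed

text \<open>A vector of norm at most \<open>n\<close> is a sum of \<open>n\<close> vectors of norm at most \<open>1\<close>.\<close>

lemma submultiplicative_exponential_growth:
  fixes \<nu> :: "'a::euclidean_space \<Rightarrow> real"
  assumes meas: "\<nu> \<in> borel_measurable lebesgue" and pos: "\<And>z. 0 < \<nu> z"
    and sub: "\<And>z w. \<nu> (z + w) \<le> \<nu> z * \<nu> w" and even: "\<And>z. \<nu> (- z) = \<nu> z"
  shows "\<exists>C a. 0 \<le> a \<and> 0 \<le> C \<and> (\<forall>z. \<nu> z \<le> C * exp (a * norm z))"
proof -
  obtain K0 where K0: "\<And>z. norm z \<le> 1 \<Longrightarrow> \<nu> z \<le> K0"
    using submultiplicative_bounded_near_0[OF assms] by blast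
  define K where "K = max K0 1"
  have K: "1 \<le> K" "norm z \<le> 1 \<Longrightarrow> \<nu> z \<le> K" for z using K0[of z] by (auto simp: K_def)
  have pw: "\<nu> z \<le> K ^ Suc n" if "norm z \<le> real (Suc n)" for n z
    using that
  proof (induction n arbitrary: z)
    case (Suc n)
    let ?m = "real (Suc (Suc n))"
    have eq: "z = (real (Suc n) / ?m) *\<^sub>R z + (1 / ?m) *\<^sub>R z"
      unfolding scaleR_add_left[symmetric] add_divide_distrib[symmetric] by simp
    have "norm ((real (Suc n) / ?m) *\<^sub>R z) \<le> real (Suc n)"
      using mult_left_mono[OF Suc.prems, of "real (Suc n) / ?m"] by simp
    then have 1: "\<nu> ((real (Suc n) / ?m) *\<^sub>R z) \<le> K ^ Suc n" by (rule Suc.IH)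
    have "norm ((1 / ?m) *\<^sub>R z) \<le> 1" using Suc.prems by (simp add: field_simps)
    then have 2: "\<nu> ((1 / ?m) *\<^sub>R z) \<le> K" by (rule K)
    have "\<nu> z \<le> \<nu> ((real (Suc n) / ?m) *\<^sub>R z) * \<nu> ((1 / ?m) *\<^sub>R z)"
      by (subst eq) (rule sub)
    also have "\<dots> \<le> K ^ Suc n * K" using 1 2 pos K(1) by (intro mult_mono) (auto intro: less_imp_le)
    finally show ?case by (simp add: mult.commute)
  qed (use K in auto)
  have "\<nu> z \<le> K\<^sup>2 * exp (ln K * norm z)" for z
  proof -
    define n where "n = nat \<lfloor>norm z\<rfloor>"
    have n: "real n \<le> norm z" "norm z \<le> real (Suc n)" by (simp_all add: n_def) linarith
    have "\<nu> z \<le> K ^ Suc n" by (rule pw[OF n(2)])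
    also have "\<dots> = K * exp (ln K * real n)" 
      using K(1) by (simp add: exp_of_nat2_mult)
    also have "\<dots> \<le> K\<^sup>2 * exp (ln K * norm z)"
      using K(1) n(1) by (intro mult_mono) (auto simp: power2_eq_square intro!: mult_left_mono)
    finally show ?thesis .
  qed
  then show ?thesis using K(1) by (intro exI[of _ "K\<^sup>2"] exI[of _ "ln K"]) auto
qed

lemma coherent_M1:
  fixes z :: "('d::finite) phase"
  assumes "weight \<nu>" "submultiplicative \<nu>" "even_weight \<nu>"
  shows "coherent z \<in> M1 \<nu>"
proof -
  obtain C a where C: "0 \<le> a" "0 \<le> C" "\<And>w. \<nu> w \<le> C * exp (a * norm w)"
    using submultiplicative_exponential_growth[of \<nu>] assms
    by (auto simp: weight_def submultiplicative_def even_weight_def)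
  let ?c = "gauss_const TYPE('d)"
  define D where "D = ?c * C * exp (a * norm z + a\<^sup>2 / pi)"
  let ?E = "\<lambda>w. exp (- pi * (1/4) * ((- z + w) \<bullet> (- z + w)))"
  have bound: "cmod (stft gaussian (coherent z) w) * \<nu> w \<le> D * ?E w" for w
  proof -
    define s where "s = norm (z - w)"
    have s: "(- z + w) \<bullet> (- z + w) = s\<^sup>2" 
      unfolding s_def power2_norm_eq_inner[symmetric] by (simp add: norm_minus_commute)
    \<comment> \<open>The exponential growth of the weight is paid for with half of the decay rate of the transform.\<close>
    have "0 \<le> (pi * s - 2 * a)\<^sup>2 / (4 * pi)" by simp
    also have "\<dots> = (pi / 4) * s\<^sup>2 - a * s + a\<^sup>2 / pi"
      by (simp add: power2_eq_square field_simps)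
    finally have "a * s \<le> (pi / 4) * s\<^sup>2 + a\<^sup>2 / pi" by simp
    moreover have "a * norm w \<le> a * (norm z + s)"
      using norm_triangle_ineq4[of z "z - w"] C(1) by (intro mult_left_mono) (auto simp: s_def)
    ultimately have "- (pi / 2) * s\<^sup>2 + a * norm w \<le> (a * norm z + a\<^sup>2 / pi) + - pi * (1/4) * s\<^sup>2"
      by (simp add: algebra_simps)
    then have "exp (- (pi / 2) * s\<^sup>2) * exp (a * norm w) \<le> exp (a * norm z + a\<^sup>2 / pi) * exp (- pi * (1/4) * s\<^sup>2)"
      unfolding exp_add[symmetric] by (simp only: exp_le_cancel_iff)
    then have le: "?c * C * (exp (- (pi / 2) * s\<^sup>2) * exp (a * norm w)) 
      \<le> ?c * C * (exp (a * norm z + a\<^sup>2 / pi) * exp (- pi * (1/4) * s\<^sup>2))"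
      using C(2) gauss_const_pos[where 'd = 'd] by (intro mult_left_mono) auto
    have "cmod (stft gaussian (coherent z) w) * \<nu> w \<le> (?c * exp (- (pi / 2) * s\<^sup>2)) * (C * exp (a * norm w))"
      unfolding stft_def coherent_inner_norm s_def[symmetric]
      using C(3) gauss_const_pos[where 'd = 'd] by (intro mult_left_mono) auto
    also have "\<dots> \<le> D * exp (- pi * (1/4) * s\<^sup>2)"
      using le by (simp add: D_def mult_ac)
    finally show ?thesis unfolding s .
  qed
  have int: "integrable lborel (\<lambda>w. D * ?E w)"
  proof (rule integrable_mult_right)
    show "integrable lborel ?E"
      using Gaussian_integrable(1)[of "1/4", where 'a = "'d phase"]
      by (subst lborel_integral_translation(2)) auto
  qed
  have "M1_norm \<nu> (coherent z) \<le> (\<integral>\<^sup>+ w. ennreal (D * ?E w) \<partial>lebesgue)"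
    unfolding M1_norm_def by (intro nn_integral_mono ennreal_leI bound)
  also have "\<dots> = (\<integral>\<^sup>+ w. ennreal (D * ?E w) \<partial>lborel)"
    by (rule nn_integral_completion)
  also have "\<dots> < \<infinity>"
    using int C(2) gauss_const_pos[where 'd = 'd] 
    by (subst nn_integral_eq_integral) (auto simp: D_def intro!: AE_I2 mult_nonneg_nonneg)
  finally show ?thesis by (simp add: M1_def coherent_L2)
qed

section \<open>The energy of the short-time Fourier transform\<close>

text \<open>A form of Fubini's theorem in which integrability is clear from the factors.\<close>

lemma Fubini_bounded_kernel:
  fixes a :: "'a::euclidean_space \<Rightarrow> complex" and b :: "'b::euclidean_space \<Rightarrow> complex"
  assumes a: "integrable lborel a" and b: "integrable lborel b"
    and k [measurable]: "case_prod k \<in> borel_measurable (borel \<Otimes>\<^sub>M borel)"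
    and k_le: "\<And>x y. cmod (k x y) \<le> 1"
  shows "(\<integral>x. a x * (\<integral>y. b y * k x y \<partial>lborel) \<partial>lborel) = (\<integral>y. b y * (\<integral>x. a x * k x y \<partial>lborel) \<partial>lborel)"
proof -
  have [measurable]: "a \<in> borel_measurable borel" "b \<in> borel_measurable borel" 
    using a b by (auto dest: borel_measurable_integrable)
  have [measurable]: "k x \<in> borel_measurable borel" for x
    using measurable_Pair2[OF k, of x] by simp
  have by_int: "integrable lborel (\<lambda>y. b y * k x y)" for x
    by (rule Bochner_Integration.integrable_bound[OF b]) (auto simp: norm_mult k_le mult_left_le)
  have "integrable (lborel \<Otimes>\<^sub>M lborel) (\<lambda>(x, y). a x * (b y * k x y))"
  proof (rule lborel_pair.Fubini_integrable)
    show "(\<lambda>(x, y). a x * (b y * k x y)) \<in> borel_measurable (lborel \<Otimes>\<^sub>M lborel)"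
      by measurable
    show "AE x in lborel. integrable lborel (\<lambda>y. case (x, y) of (x, y) \<Rightarrow> a x * (b y * k x y))"
      using by_int by (intro AE_I2) simp
    show "integrable lborel (\<lambda>x. \<integral>y. cmod (case (x, y) of (x, y) \<Rightarrow> a x * (b y * k x y)) \<partial>lborel)"
    proof (rule Bochner_Integration.integrable_bound)
      show "integrable lborel (\<lambda>x. cmod (a x) * (\<integral>y. cmod (b y) \<partial>lborel))"
        using a by simp
      show "(\<lambda>x. \<integral>y. cmod (case (x, y) of (x, y) \<Rightarrow> a x * (b y * k x y)) \<partial>lborel) \<in> borel_measurable lborel"
        by measurable
      show "AE x in lborel. norm (\<integral>y. cmod (case (x, y) of (x, y) \<Rightarrow> a x * (b y * k x y)) \<partial>lborel)
        \<le> norm (cmod (a x) * (\<integral>y. cmod (b y) \<partial>lborel))"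
      proof (rule AE_I2)
        fix x
        have "(\<integral>y. cmod (b y * k x y) \<partial>lborel) \<le> (\<integral>y. cmod (b y) \<partial>lborel)"
          by (rule integral_mono[OF integrable_norm[OF by_int] integrable_norm[OF b]])
            (simp add: norm_mult k_le mult_left_le)
        then have "cmod (a x) * (\<integral>y. cmod (b y * k x y) \<partial>lborel) \<le> cmod (a x) * (\<integral>y. cmod (b y) \<partial>lborel)"
          by (rule mult_left_mono) simp
        then show "norm (\<integral>y. cmod (case (x, y) of (x, y) \<Rightarrow> a x * (b y * k x y)) \<partial>lborel)
          \<le> norm (cmod (a x) * (\<integral>y. cmod (b y) \<partial>lborel))"
          by (simp add: norm_mult[of "a x"] abs_of_nonneg integral_nonneg_AE)
      qed
    qed
  qed
  from lborel_pair.Fubini_integral[OF this] 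
  have "(\<integral>x. \<integral>y. a x * (b y * k x y) \<partial>lborel \<partial>lborel) = (\<integral>y. \<integral>x. a x * (b y * k x y) \<partial>lborel \<partial>lborel)"
    by simp
  then show ?thesis 
    by (simp only: mult.left_commute[of "a _" "b _"] integral_mult_right_zero) 
       (simp only: mult.left_commute[of "b _" "a _"] integral_mult_right_zero)
qed

lemma lborel_integral_affine:
  fixes f :: "'a::euclidean_space \<Rightarrow> 'b::{banach, second_countable_topology}"
  assumes [measurable]: "f \<in> borel_measurable borel" and c: "0 < c"
  shows "(\<integral>s. f s \<partial>lborel) = c ^ DIM('a) *\<^sub>R (\<integral>y. f (t + c *\<^sub>R y) \<partial>lborel)"
proof -
  let ?D = "distr lborel borel (\<lambda>x. t + c *\<^sub>R x)"
  have "integral\<^sup>L lborel f = integral\<^sup>L (density ?D (\<lambda>_. ennreal (\<bar>c\<bar> ^ DIM('a)))) f"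
    using arg_cong[OF lborel_affine[of c t], of "\<lambda>M. integral\<^sup>L M f"] c by simp
  also have "\<dots> = (\<integral>x. c ^ DIM('a) *\<^sub>R f x \<partial>?D)"
    using c by (subst integral_density) auto
  also have "\<dots> = (\<integral>y. c ^ DIM('a) *\<^sub>R f (t + c *\<^sub>R y) \<partial>lborel)"
    by (rule integral_distr) measurable
  finally show ?thesis by simp
qed

lemma continuous_compact_support_bounded:
  fixes h :: "'a::euclidean_space \<Rightarrow> complex"
  assumes cont: "continuous_on UNIV h" and supp: "\<And>t. R < norm t \<Longrightarrow> h t = 0"
  obtains M where "\<And>t. cmod (h t) \<le> M * indicator (cball 0 R) t" "0 \<le> M"
proof -
  have "compact (h ` cball 0 R)"
    by (intro compact_continuous_image continuous_on_subset[OF cont]) auto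
  then obtain M where M: "0 < M" "\<And>v. v \<in> h ` cball 0 R \<Longrightarrow> norm v \<le> M"
    using compact_imp_bounded bounded_pos by metis
  show ?thesis 
    by (rule that[of M]) (use M supp in \<open>auto simp: indicator_def not_le\<close>)
qed

lemma integrable_indicator_cball: "integrable lborel (\<lambda>t::'a::euclidean_space. M * indicator (cball 0 R) t :: real)"
  using emeasure_bounded_finite[OF bounded_cball, of "0::'a" R]
  by (intro integrable_mult_right integrable_real_indicator) simp_all

text \<open>One half of Plancherel's theorem. Damping the integrand on the right by the Gaussian of variance
  proportional to \<open>1 / \<delta>\<^sup>2\<close> only decreases it, and allows one to carry out the integration over \<open>\<omega>\<close> first. The
  result is the inner product of \<open>h\<close> with the average of its translates under the Gaussian
  probability density of scale \<open>\<delta>\<close>, which converges to \<open>\<parallel>h\<parallel>\<^sup>2\<close> as \<open>\<delta>\<close> tends to \<open>0\<close>.\<close>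

lemma Plancherel_lower:
  fixes h :: "'a::euclidean_space \<Rightarrow> complex"
  assumes cont: "continuous_on UNIV h" and supp: "\<And>t. R < norm t \<Longrightarrow> h t = 0"
  defines "H \<equiv> \<lambda>\<omega>. \<integral>t. h t * cis (- (2 * pi * (\<omega> \<bullet> t))) \<partial>lborel"
  shows "(\<integral>\<^sup>+t. ennreal ((cmod (h t))\<^sup>2) \<partial>lborel) \<le> (\<integral>\<^sup>+\<omega>. ennreal ((cmod (H \<omega>))\<^sup>2) \<partial>lborel)"
proof -
  obtain M where M: "\<And>t. cmod (h t) \<le> M * indicator (cball 0 R) t" "0 \<le> M"
    using continuous_compact_support_bounded[OF cont supp] by blast
  have M': "cmod (h t) \<le> M" for t
    using M(1)[of t] M(2) by (cases "norm t \<le> R") auto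
  have [measurable]: "h \<in> borel_measurable borel" by (rule borel_measurable_continuous_onI[OF cont])
  have h_int: "integrable lborel h"
    by (rule Bochner_Integration.integrable_bound[OF integrable_indicator_cball[of M R]])
      (use M in \<open>auto intro!: AE_I2 order_trans[OF M(1)]\<close>)
  have cnjh_int: "integrable lborel (\<lambda>t. cnj (h t))" using h_int by simp
  have [measurable]: "H \<in> borel_measurable borel" unfolding H_def by measurable
  have H_eq: "H \<omega> = (\<integral>t. h t * cis (- (2 * pi * (\<omega> \<bullet> t))) \<partial>lborel)" for \<omega>
    by (simp add: H_def)
  define N where "N = (\<integral>t. cmod (h t) \<partial>lborel)"
  have H_le: "cmod (H \<omega>) \<le> N" for \<omega>
    unfolding H_def N_def by (rule order_trans[OF integral_norm_bound]) (simp add: norm_mult)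
  define e where "e s \<omega> = exp (- pi * s * (\<omega> \<bullet> \<omega>))" for s :: real and \<omega> :: 'a
  have [measurable]: "e s \<in> borel_measurable borel" for s unfolding e_def by measurable
  have e_int: "integrable lborel (e s)" if "0 < s" for s
    unfolding e_def[abs_def] by (rule Gaussian_integrable[OF that])
  define J where "J \<delta> = (\<integral>\<omega>. (cmod (H \<omega>))\<^sup>2 * e (\<delta>\<^sup>2) \<omega> \<partial>lborel)" for \<delta>
  define A where "A \<delta> t = (\<integral>y. cnj (h (t + \<delta> *\<^sub>R y)) * complex_of_real (e 1 y) \<partial>lborel)" for \<delta> t
  have J_eq: "complex_of_real (J \<delta>) = (\<integral>t. h t * A \<delta> t \<partial>lborel)" if \<delta>: "0 < \<delta>" for \<delta>
  proof -
    have b_int: "integrable lborel (\<lambda>\<omega>. cnj (H \<omega>) * complex_of_real (e (\<delta>\<^sup>2) \<omega>))"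
    proof (rule Bochner_Integration.integrable_bound)
      show "integrable lborel (\<lambda>\<omega>. N * e (\<delta>\<^sup>2) \<omega>)" using \<delta> by (intro integrable_mult_right e_int) simp
      show "AE \<omega> in lborel. norm (cnj (H \<omega>) * complex_of_real (e (\<delta>\<^sup>2) \<omega>)) \<le> norm (N * e (\<delta>\<^sup>2) \<omega>)"
      proof (rule AE_I2)
        fix \<omega>
        have "0 \<le> N" using H_le norm_ge_zero order_trans by blast
        then show "norm (cnj (H \<omega>) * complex_of_real (e (\<delta>\<^sup>2) \<omega>)) \<le> norm (N * e (\<delta>\<^sup>2) \<omega>)"
          using H_le by (auto simp: norm_mult e_def intro!: mult_right_mono)
      qed
    qed measurable
    have "complex_of_real (J \<delta>) = (\<integral>\<omega>. complex_of_real ((cmod (H \<omega>))\<^sup>2 * e (\<delta>\<^sup>2) \<omega>) \<partial>lborel)"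
      unfolding J_def by (rule integral_complex_of_real[symmetric])
    also have "\<dots> = (\<integral>\<omega>. (cnj (H \<omega>) * complex_of_real (e (\<delta>\<^sup>2) \<omega>)) * 
        (\<integral>t. h t * cis (- (2 * pi * (\<omega> \<bullet> t))) \<partial>lborel) \<partial>lborel)"
      unfolding H_eq[symmetric] of_real_mult complex_norm_square by (simp only: mult_ac)
    also have "\<dots> = (\<integral>t. h t * (\<integral>\<omega>. (cnj (H \<omega>) * complex_of_real (e (\<delta>\<^sup>2) \<omega>)) * 
        cis (- (2 * pi * (\<omega> \<bullet> t))) \<partial>lborel) \<partial>lborel)"
      by (rule Fubini_bounded_kernel[OF b_int h_int]) auto
    also have "(\<lambda>t. \<integral>\<omega>. (cnj (H \<omega>) * complex_of_real (e (\<delta>\<^sup>2) \<omega>)) * cis (- (2 * pi * (\<omega> \<bullet> t))) \<partial>lborel) = A \<delta>"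
    proof
      fix t
      have "(\<integral>\<omega>. (cnj (H \<omega>) * complex_of_real (e (\<delta>\<^sup>2) \<omega>)) * cis (- (2 * pi * (\<omega> \<bullet> t))) \<partial>lborel)
        = (\<integral>\<omega>. complex_of_real (e (\<delta>\<^sup>2) \<omega>) * (\<integral>s. cnj (h s) * cis (2 * pi * ((s - t) \<bullet> \<omega>)) \<partial>lborel) \<partial>lborel)"
      proof (rule Bochner_Integration.integral_cong[OF refl])
        fix \<omega>
        have "cnj (H \<omega>) = (\<integral>s. cnj (h s * cis (- (2 * pi * (\<omega> \<bullet> s)))) \<partial>lborel)"
          unfolding H_def by (rule Bochner_Integration.integral_cnj[symmetric])
        then have "cnj (H \<omega>) * cis (- (2 * pi * (\<omega> \<bullet> t))) 
          = (\<integral>s. cnj (h s * cis (- (2 * pi * (\<omega> \<bullet> s)))) * cis (- (2 * pi * (\<omega> \<bullet> t))) \<partial>lborel)"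
          by simp
        also have "(\<lambda>s. cnj (h s * cis (- (2 * pi * (\<omega> \<bullet> s)))) * cis (- (2 * pi * (\<omega> \<bullet> t)))) 
          = (\<lambda>s. cnj (h s) * cis (2 * pi * ((s - t) \<bullet> \<omega>)))"
          by (simp add: fun_eq_iff cis_cnj mult.assoc cis_mult algebra_simps inner_commute)
        finally show "(cnj (H \<omega>) * complex_of_real (e (\<delta>\<^sup>2) \<omega>)) * cis (- (2 * pi * (\<omega> \<bullet> t)))
          = complex_of_real (e (\<delta>\<^sup>2) \<omega>) * (\<integral>s. cnj (h s) * cis (2 * pi * ((s - t) \<bullet> \<omega>)) \<partial>lborel)"
          by (simp add: mult_ac)
      qed
      also have "\<dots> = (\<integral>s. cnj (h s) * (\<integral>\<omega>. complex_of_real (e (\<delta>\<^sup>2) \<omega>) * cis (2 * pi * ((s - t) \<bullet> \<omega>)) \<partial>lborel) \<partial>lborel)"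
        using \<delta> by (intro Fubini_bounded_kernel cnjh_int integrable_of_real e_int) auto
      also have "\<dots> = (\<integral>s. cnj (h s) * complex_of_real (exp (- pi * ((s - t) \<bullet> (s - t)) / \<delta>\<^sup>2) / \<delta> ^ DIM('a)) \<partial>lborel)"
      proof -
        have "(\<integral>\<omega>. complex_of_real (e (\<delta>\<^sup>2) \<omega>) * cis (2 * pi * (u \<bullet> \<omega>)) \<partial>lborel)
          = complex_of_real (exp (- pi * (u \<bullet> u) / \<delta>\<^sup>2) / \<delta> ^ DIM('a))" for u
          using Gaussian_integral(2)[of "\<delta>\<^sup>2" u] \<delta> by (simp add: e_def mult.commute[of "complex_of_real _"])
        then show ?thesis by simp
      qed
      also have "\<dots> = \<delta> ^ DIM('a) *\<^sub>R (\<integral>y. cnj (h (t + \<delta> *\<^sub>R y)) * 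
          complex_of_real (exp (- pi * ((\<delta> *\<^sub>R y) \<bullet> (\<delta> *\<^sub>R y)) / \<delta>\<^sup>2) / \<delta> ^ DIM('a)) \<partial>lborel)"
        using lborel_integral_affine[OF _ \<delta>, where t = t
            and f = "\<lambda>s. cnj (h s) * complex_of_real (exp (- pi * ((s - t) \<bullet> (s - t)) / \<delta>\<^sup>2) / \<delta> ^ DIM('a))"]
        by simp
      also have "\<dots> = A \<delta> t"
        unfolding A_def integral_scaleR_right[symmetric] 
        using \<delta> by (intro Bochner_Integration.integral_cong refl) 
          (simp add: e_def scaleR_conv_of_real power2_eq_square)
      finally show "(\<integral>\<omega>. (cnj (H \<omega>) * complex_of_real (e (\<delta>\<^sup>2) \<omega>)) * cis (- (2 * pi * (\<omega> \<bullet> t))) \<partial>lborel) = A \<delta> t" .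
    qed
    finally show ?thesis .
  qed
  define \<delta> where "\<delta> n = 1 / real (Suc n)" for n
  have \<delta>: "0 < \<delta> n" for n by (simp add: \<delta>_def)
  have \<delta>_lim: "\<delta> \<longlonglongrightarrow> 0" unfolding \<delta>_def by (rule lim_1_over_n[THEN LIMSEQ_Suc, unfolded])
  have e1: "integrable lborel (\<lambda>y. M * e 1 y)" "(\<integral>y. e 1 y \<partial>lborel) = 1"
    subgoal by (intro integrable_mult_right e_int) simp
    subgoal using Gaussian_integrable(2)[of 1, where 'a = 'a] by (simp add: e_def)
    done
  have A_lim: "(\<lambda>n. A (\<delta> n) t) \<longlonglongrightarrow> cnj (h t)" for t
  proof -
    have "(\<lambda>n. A (\<delta> n) t) \<longlonglongrightarrow> (\<integral>y. cnj (h t) * complex_of_real (e 1 y) \<partial>lborel)"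
      unfolding A_def
    proof (rule integral_dominated_convergence[OF _ _ e1(1)])
      show "AE y in lborel. (\<lambda>n. cnj (h (t + \<delta> n *\<^sub>R y)) * complex_of_real (e 1 y)) 
        \<longlonglongrightarrow> cnj (h t) * complex_of_real (e 1 y)"
      proof (rule AE_I2)
        fix y
        have "(\<lambda>n. t + \<delta> n *\<^sub>R y) \<longlonglongrightarrow> t + 0 *\<^sub>R y" by (intro tendsto_intros \<delta>_lim)
        then have "(\<lambda>n. h (t + \<delta> n *\<^sub>R y)) \<longlonglongrightarrow> h t"
          using continuous_on_tendsto_compose[OF cont] by fastforce
        then show "(\<lambda>n. cnj (h (t + \<delta> n *\<^sub>R y)) * complex_of_real (e 1 y)) 
          \<longlonglongrightarrow> cnj (h t) * complex_of_real (e 1 y)"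
          by (intro tendsto_intros)
      qed
      show "AE y in lborel. norm (cnj (h (t + \<delta> n *\<^sub>R y)) * complex_of_real (e 1 y)) \<le> M * e 1 y" for n
        by (intro AE_I2) (auto simp: norm_mult e_def intro!: mult_right_mono M')
    qed measurable
    also have "(\<integral>y. cnj (h t) * complex_of_real (e 1 y) \<partial>lborel) = cnj (h t)"
      by (simp add: e1(2))
    finally show ?thesis .
  qed
  have A_le: "cmod (A (\<delta> n) t) \<le> M" for n t
  proof -
    have le: "norm (cnj (h (t + \<delta> n *\<^sub>R y)) * complex_of_real (e 1 y)) \<le> M * e 1 y" for y
      by (auto simp: norm_mult e_def intro!: mult_right_mono M')
    have int: "integrable lborel (\<lambda>y. cnj (h (t + \<delta> n *\<^sub>R y)) * complex_of_real (e 1 y))"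
    proof (rule Bochner_Integration.integrable_bound[OF e1(1)])
      show "AE y in lborel. norm (cnj (h (t + \<delta> n *\<^sub>R y)) * complex_of_real (e 1 y)) \<le> norm (M * e 1 y)"
        by (intro AE_I2 order_trans[OF le]) simp
    qed measurable
    have "cmod (A (\<delta> n) t) \<le> (\<integral>y. norm (cnj (h (t + \<delta> n *\<^sub>R y)) * complex_of_real (e 1 y)) \<partial>lborel)"
      unfolding A_def by (rule integral_norm_bound)
    also have "\<dots> \<le> (\<integral>y. M * e 1 y \<partial>lborel)"
      by (rule integral_mono[OF integrable_norm[OF int] e1(1) le])
    finally have "cmod (A (\<delta> n) t) \<le> (\<integral>y. M * e 1 y \<partial>lborel)" .
    then show ?thesis by (simp add: e1(2))
  qed
  have [measurable]: "A (\<delta> n) \<in> borel_measurable borel" for n unfolding A_def by measurable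
  have "(\<lambda>n. \<integral>t. h t * A (\<delta> n) t \<partial>lborel) \<longlonglongrightarrow> (\<integral>t. h t * cnj (h t) \<partial>lborel)"
  proof (rule integral_dominated_convergence)
    show "integrable lborel (\<lambda>t. cmod (h t) * M)" using h_int by simp
    show "AE t in lborel. (\<lambda>n. h t * A (\<delta> n) t) \<longlonglongrightarrow> h t * cnj (h t)"
      by (intro AE_I2 tendsto_mult tendsto_const A_lim)
    show "AE t in lborel. norm (h t * A (\<delta> n) t) \<le> cmod (h t) * M" for n
      by (intro AE_I2) (auto simp: norm_mult intro!: mult_left_mono A_le)
  qed measurable
  then have "(\<lambda>n. complex_of_real (J (\<delta> n))) \<longlonglongrightarrow> complex_of_real (\<integral>t. (cmod (h t))\<^sup>2 \<partial>lborel)"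
    by (simp add: J_eq[OF \<delta>] complex_norm_square[symmetric] del: of_real_power flip: integral_complex_of_real)
  then have J_lim: "(\<lambda>n. J (\<delta> n)) \<longlonglongrightarrow> (\<integral>t. (cmod (h t))\<^sup>2 \<partial>lborel)"
    by (simp only: tendsto_of_real_iff)
  have "integrable lborel (\<lambda>t. (cmod (h t))\<^sup>2)"
  proof (rule Bochner_Integration.integrable_bound)
    show "integrable lborel (\<lambda>t. M * cmod (h t))" using h_int by simp
  qed (auto simp: power2_eq_square M(2) intro!: AE_I2 mult_right_mono M')
  then have "(\<integral>\<^sup>+t. ennreal ((cmod (h t))\<^sup>2) \<partial>lborel) = ennreal (\<integral>t. (cmod (h t))\<^sup>2 \<partial>lborel)"
    by (intro nn_integral_eq_integral) auto
  also have "\<dots> \<le> (\<integral>\<^sup>+\<omega>. ennreal ((cmod (H \<omega>))\<^sup>2) \<partial>lborel)"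
  proof (rule LIMSEQ_le_const2)
    show "(\<lambda>n. ennreal (J (\<delta> n))) \<longlonglongrightarrow> ennreal (\<integral>t. (cmod (h t))\<^sup>2 \<partial>lborel)"
      by (intro tendsto_ennrealI J_lim)
    show "\<exists>N. \<forall>n\<ge>N. ennreal (J (\<delta> n)) \<le> (\<integral>\<^sup>+\<omega>. ennreal ((cmod (H \<omega>))\<^sup>2) \<partial>lborel)"
    proof (intro exI allI impI)
      fix n
      have "integrable lborel (\<lambda>\<omega>. (cmod (H \<omega>))\<^sup>2 * e ((\<delta> n)\<^sup>2) \<omega>)"
      proof (rule Bochner_Integration.integrable_bound)
        show "integrable lborel (\<lambda>\<omega>. N\<^sup>2 * e ((\<delta> n)\<^sup>2) \<omega>)" using \<delta>[of n] by (intro integrable_mult_right e_int) simp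
      qed (auto simp: e_def abs_mult intro!: AE_I2 mult_right_mono power_mono H_le)
      then have "ennreal (J (\<delta> n)) = (\<integral>\<^sup>+\<omega>. ennreal ((cmod (H \<omega>))\<^sup>2 * e ((\<delta> n)\<^sup>2) \<omega>) \<partial>lborel)"
        unfolding J_def by (intro nn_integral_eq_integral[symmetric]) (auto simp: e_def)
      also have "\<dots> \<le> (\<integral>\<^sup>+\<omega>. ennreal ((cmod (H \<omega>))\<^sup>2) \<partial>lborel)"
        by (intro nn_integral_mono ennreal_leI mult_left_le) (auto simp: e_def)
      finally show "ennreal (J (\<delta> n)) \<le> (\<integral>\<^sup>+\<omega>. ennreal ((cmod (H \<omega>))\<^sup>2) \<partial>lborel)" .
    qed
  qed
  finally show ?thesis .
qed

text \<open>For a fixed time shift \<open>x\<close>, the coefficients as a function of the frequency form the Fourier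
  transform of \<open>f\<close> times the translated Gaussian; \<open>Plancherel_lower\<close> applies, and then the
  integration over \<open>x\<close> separates.\<close>

lemma coherent_total_energy_lower:
  fixes f :: "('d::finite) signal"
  assumes cont: "continuous_on UNIV f" and supp: "\<And>t. R < norm t \<Longrightarrow> f t = 0"
  shows "ennreal (gauss_const TYPE('d)) * (\<integral>\<^sup>+t. ennreal ((cmod (f t))\<^sup>2) \<partial>lborel) 
      \<le> (\<integral>\<^sup>+z. ennreal ((cmod (L2_inner f (coherent z)))\<^sup>2) \<partial>lborel)"
    and "(\<lambda>z. L2_inner f (coherent z)) \<in> borel_measurable borel"
proof -
  have [measurable]: "f \<in> borel_measurable borel" by (rule borel_measurable_continuous_onI[OF cont])
  let ?g = "\<lambda>u::real ^ 'd. exp (- pi * (u \<bullet> u))"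
  have inner: "L2_inner f (coherent (x, \<omega>)) 
    = (\<integral>t. (f t * complex_of_real (?g (t - x))) * cis (- (2 * pi * (\<omega> \<bullet> t))) \<partial>lborel)" for x \<omega>
    unfolding L2_inner_def
    by (subst integral_completion) (auto simp: coherent_eq cis_cnj mult_ac)
  have "(\<lambda>z. L2_inner f (coherent z)) = (\<lambda>z. \<integral>t. (f t * complex_of_real (?g (t - fst z))) * 
      cis (- (2 * pi * (snd z \<bullet> t))) \<partial>lborel)"
    using inner by (auto simp: fun_eq_iff)
  also have "\<dots> \<in> borel_measurable borel" unfolding borel_prod[symmetric] by measurable
  finally show F [measurable]: "(\<lambda>z. L2_inner f (coherent z)) \<in> borel_measurable borel" .
  have sq: "(cmod (f t * complex_of_real (?g u)))\<^sup>2 = (cmod (f t))\<^sup>2 * exp (- pi * 2 * (u \<bullet> u))" for t u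
    by (simp add: norm_mult power_mult_distrib flip: exp_double)
  have "ennreal (gauss_const TYPE('d)) * (\<integral>\<^sup>+t. ennreal ((cmod (f t))\<^sup>2) \<partial>lborel) 
    = (\<integral>\<^sup>+t. ennreal ((cmod (f t))\<^sup>2) * (\<integral>\<^sup>+x. ennreal (exp (- pi * 2 * ((t - x) \<bullet> (t - x)))) \<partial>lborel) \<partial>lborel)"
  proof -
    have "(\<integral>\<^sup>+x. ennreal (exp (- pi * 2 * ((t - x) \<bullet> (t - x)))) \<partial>lborel) = ennreal (gauss_const TYPE('d))" for t :: "real ^ 'd"
    proof -
      let ?G = "\<lambda>u::real ^ 'd. exp (- pi * 2 * (u \<bullet> u))"
      have "(t - x) \<bullet> (t - x) = (- t + x) \<bullet> (- t + x)" for x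
        by (simp add: algebra_simps inner_commute)
      then have "(\<integral>\<^sup>+x. ennreal (?G (t - x)) \<partial>lborel) = (\<integral>\<^sup>+x. ennreal (?G (- t + x)) \<partial>lborel)"
        by simp
      also have "\<dots> = ennreal (\<integral>x. ?G (- t + x) \<partial>lborel)"
      proof (intro nn_integral_eq_integral AE_I2)
        show "integrable lborel (\<lambda>x. ?G (- t + x))"
          using Gaussian_integrable(1)[of 2, where 'a = "real ^ 'd"]
          by (subst lborel_integral_translation(2)) auto
      qed simp
      also have "(\<integral>x. ?G (- t + x) \<partial>lborel) = gauss_const TYPE('d)"
        using Gaussian_integrable(2)[of 2, where 'a = "real ^ 'd"]
        by (subst lborel_integral_translation(1)) (auto simp: gauss_const_def)
      finally show ?thesis .
    qed
    then show ?thesis by (simp add: nn_integral_cmult[symmetric] mult.commute)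
  qed
  also have "\<dots> = (\<integral>\<^sup>+t. (\<integral>\<^sup>+x. ennreal ((cmod (f t * complex_of_real (?g (t - x))))\<^sup>2) \<partial>lborel) \<partial>lborel)"
    unfolding sq by (simp add: ennreal_mult' nn_integral_cmult)
  also have "\<dots> = (\<integral>\<^sup>+x. (\<integral>\<^sup>+t. ennreal ((cmod (f t * complex_of_real (?g (t - x))))\<^sup>2) \<partial>lborel) \<partial>lborel)"
    by (rule lborel_pair.Fubini') measurable
  also have "\<dots> \<le> (\<integral>\<^sup>+x. (\<integral>\<^sup>+\<omega>. ennreal ((cmod (L2_inner f (coherent (x, \<omega>))))\<^sup>2) \<partial>lborel) \<partial>lborel)"
  proof (rule nn_integral_mono)
    fix x
    show "(\<integral>\<^sup>+t. ennreal ((cmod (f t * complex_of_real (?g (t - x))))\<^sup>2) \<partial>lborel)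
      \<le> (\<integral>\<^sup>+\<omega>. ennreal ((cmod (L2_inner f (coherent (x, \<omega>))))\<^sup>2) \<partial>lborel)"
      unfolding inner
      by (rule Plancherel_lower[of _ R]) (auto intro!: continuous_intros cont simp: supp)
  qed
  also have "\<dots> = (\<integral>\<^sup>+z. ennreal ((cmod (L2_inner f (coherent z)))\<^sup>2) \<partial>(lborel \<Otimes>\<^sub>M lborel))"
    by (rule lborel.nn_integral_fst) (simp add: lborel_prod)
  also have "\<dots> = (\<integral>\<^sup>+z. ennreal ((cmod (L2_inner f (coherent z)))\<^sup>2) \<partial>lborel)"
    by (simp add: lborel_prod)
  finally show "ennreal (gauss_const TYPE('d)) * (\<integral>\<^sup>+t. ennreal ((cmod (f t))\<^sup>2) \<partial>lborel) 
      \<le> (\<integral>\<^sup>+z. ennreal ((cmod (L2_inner f (coherent z)))\<^sup>2) \<partial>lborel)" .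
qed

section \<open>Density of continuous functions with compact support\<close>

text \<open>A measurable function is almost everywhere a limit of continuous functions. Composing these with
  a continuous retraction onto a disc and multiplying by a continuous cutoff keeps the limit, and
  provides the uniform bounds that dominated convergence needs.\<close>

lemma bounded_lebesgue_approx_continuous:
  fixes f :: "'a::euclidean_space \<Rightarrow> complex"
  assumes meas: "f \<in> borel_measurable lebesgue" and n: "0 < n"
    and bound: "\<And>t. cmod (f t) \<le> n" and supp: "\<And>t. n < norm t \<Longrightarrow> f t = 0"
  obtains g :: "nat \<Rightarrow> 'a \<Rightarrow> complex" where
    "\<And>k. continuous_on UNIV (g k)" "\<And>k t. n + 1 < norm t \<Longrightarrow> g k t = 0" 
    "\<And>k t. cmod (g k t) \<le> n" "AE t in lebesgue. (\<lambda>k. g k t) \<longlonglongrightarrow> f t"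
proof -
  have "f measurable_on UNIV"
    using measurable_on_iff_borel_measurable[of UNIV f] meas by simp
  then obtain N u where N: "negligible N" and u: "\<And>k. continuous_on UNIV (u k)"
    and lim: "\<And>t. t \<notin> N \<Longrightarrow> (\<lambda>k. u k t) \<longlonglongrightarrow> f t"
    unfolding measurable_on_def by auto
  define clip where "clip v = (n / max n (cmod v)) *\<^sub>R v" for v
  have clip_cont: "continuous_on UNIV clip"
    unfolding clip_def using n by (intro continuous_intros) (auto simp: max_def)
  have clip_le: "cmod (clip v) \<le> n" for v
    using n by (auto simp: clip_def max_def field_simps)
  have clip_id: "clip v = v" if "cmod v \<le> n" for v
    using n that by (simp add: clip_def max_def)
  define \<psi> where "\<psi> t = max 0 (min 1 (n + 1 - norm t))" for t :: 'a
  have \<psi>_cont: "continuous_on UNIV \<psi>" unfolding \<psi>_def by (intro continuous_intros)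
  have \<psi>: "0 \<le> \<psi> t" "\<psi> t \<le> 1" for t by (auto simp: \<psi>_def)
  show ?thesis
  proof (rule that[of "\<lambda>k t. \<psi> t *\<^sub>R clip (u k t)"])
    show "continuous_on UNIV (\<lambda>t. \<psi> t *\<^sub>R clip (u k t))" for k
      by (intro continuous_on_scaleR \<psi>_cont continuous_on_compose2[OF clip_cont u]) auto
    show "\<psi> t *\<^sub>R clip (u k t) = 0" if "n + 1 < norm t" for k t using that by (simp add: \<psi>_def)
    show "cmod (\<psi> t *\<^sub>R clip (u k t)) \<le> n" for k t
    proof -
      have "\<psi> t * cmod (clip (u k t)) \<le> 1 * n" by (intro mult_mono \<psi> clip_le) auto
      then show ?thesis using \<psi>(1)[of t] by simp
    qed
    have "(\<lambda>k. \<psi> t *\<^sub>R clip (u k t)) \<longlonglongrightarrow> f t" if "t \<notin> N" for t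
    proof -
      have "(\<lambda>k. \<psi> t *\<^sub>R clip (u k t)) \<longlonglongrightarrow> \<psi> t *\<^sub>R clip (f t)"
        by (intro tendsto_scaleR tendsto_const continuous_on_tendsto_compose[OF clip_cont lim[OF that]]) auto
      moreover have "\<psi> t *\<^sub>R clip (f t) = f t"
        using clip_id[OF bound, of t] supp[of t] by (cases "n < norm t") (auto simp: \<psi>_def)
      ultimately show ?thesis by simp
    qed
    moreover have "N \<in> null_sets lebesgue" using N by (simp add: negligible_iff_null_sets)
    ultimately show "AE t in lebesgue. (\<lambda>k. \<psi> t *\<^sub>R clip (u k t)) \<longlonglongrightarrow> f t"
      by (intro AE_I'[of N]) auto
  qed
qed

lemma L2_norm_tendsto_0:
  fixes f :: "('d::finite) signal"
  assumes [measurable]: "f \<in> borel_measurable lebesgue" "\<And>k. g k \<in> borel_measurable lebesgue"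
    and lim: "AE t in lebesgue. (\<lambda>k. g k t) \<longlonglongrightarrow> f t"
    and w: "integrable lebesgue w" and dom: "\<And>k t. (cmod (f t - g k t))\<^sup>2 \<le> w t"
  shows "(\<lambda>k. L2_norm (\<lambda>t. f t - g k t)) \<longlonglongrightarrow> 0"
proof -
  have "(\<lambda>k. \<integral>t. (cmod (f t - g k t))\<^sup>2 \<partial>lebesgue) \<longlonglongrightarrow> (\<integral>(t::real^'d). 0 \<partial>lebesgue)"
  proof (rule integral_dominated_convergence[OF _ _ w])
    show "AE t in lebesgue. (\<lambda>k. (cmod (f t - g k t))\<^sup>2) \<longlonglongrightarrow> 0"
      using lim
    proof (rule AE_mp, intro AE_I2 impI)
      fix t assume "(\<lambda>k. g k t) \<longlonglongrightarrow> f t"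
      then have "(\<lambda>k. (cmod (f t - g k t))\<^sup>2) \<longlonglongrightarrow> (cmod (f t - f t))\<^sup>2" by (intro tendsto_intros)
      then show "(\<lambda>k. (cmod (f t - g k t))\<^sup>2) \<longlonglongrightarrow> 0" by simp
    qed
    show "AE t in lebesgue. norm ((cmod (f t - g k t))\<^sup>2) \<le> w t" for k using dom by (intro AE_I2) simp
  qed measurable
  then have "(\<lambda>k. sqrt (\<integral>t. (cmod (f t - g k t))\<^sup>2 \<partial>lebesgue)) \<longlonglongrightarrow> sqrt 0"
    by (intro tendsto_real_sqrt) simp
  then show ?thesis by (simp add: L2_norm_def)
qed

lemma L2_dense_continuous_compact_support:
  fixes f :: "('d::finite) signal"
  assumes f: "f \<in> L2" and \<epsilon>: "0 < \<epsilon>"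
  shows "\<exists>g\<in>L2. continuous_on UNIV g \<and> (\<exists>R. \<forall>t. R < norm t \<longrightarrow> g t = 0) \<and> L2_norm (\<lambda>t. f t - g t) < \<epsilon>"
proof -
  have [measurable]: "f \<in> borel_measurable lebesgue" by (rule L2_measurable[OF f])
  define cut where "cut n t = (if norm t \<le> real n \<and> cmod (f t) \<le> real n then f t else 0)" for n t
  have cut_meas [measurable]: "cut n \<in> borel_measurable lebesgue" for n
  proof -
    have "(\<lambda>t::real^'d. norm t) \<in> borel_measurable lebesgue" by (intro measurable_completion) measurable
    then show ?thesis unfolding cut_def by measurable
  qed
  have "(\<lambda>n. L2_norm (\<lambda>t. f t - cut n t)) \<longlonglongrightarrow> 0"
  proof (rule L2_norm_tendsto_0[OF _ _ _ L2_integrable[OF f]])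
    show "AE t in lebesgue. (\<lambda>n. cut n t) \<longlonglongrightarrow> f t"
    proof (rule AE_I2)
      fix t
      obtain m where m: "max (norm t) (cmod (f t)) < real m" using reals_Archimedean2 by blast
      show "(\<lambda>n. cut n t) \<longlonglongrightarrow> f t"
      proof (rule tendsto_eventually)
        show "\<forall>\<^sub>F n in sequentially. cut n t = f t"
          using eventually_ge_at_top[of m] by eventually_elim (use m in \<open>auto simp: cut_def\<close>)
      qed
    qed
    show "(cmod (f t - cut n t))\<^sup>2 \<le> (cmod (f t))\<^sup>2" for n t by (auto simp: cut_def)
  qed measurable
  then have "\<forall>\<^sub>F n in sequentially. L2_norm (\<lambda>t. f t - cut n t) < \<epsilon> / 2"
    using \<epsilon> by (intro order_tendstoD) auto
  then obtain n0 where n0: "\<And>n. n0 \<le> n \<Longrightarrow> L2_norm (\<lambda>t. f t - cut n t) < \<epsilon> / 2"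
    by (auto simp: eventually_sequentially)
  define n where "n = Suc n0"
  have n: "L2_norm (\<lambda>t. f t - cut n t) < \<epsilon> / 2" "0 < real n" using n0[of n] by (simp_all add: n_def)
  have cut_le: "cmod (cut n t) \<le> real n" for t by (simp add: cut_def)
  have cut_supp: "cut n t = 0" if "real n < norm t" for t using that by (simp add: cut_def)
  obtain g where g: "\<And>k. continuous_on UNIV (g k)" "\<And>k t. real n + 1 < norm t \<Longrightarrow> g k t = 0" 
    "\<And>k t. cmod (g k t) \<le> real n" "AE t in lebesgue. (\<lambda>k. g k t) \<longlonglongrightarrow> cut n t"
    using bounded_lebesgue_approx_continuous[OF cut_meas[of n] n(2) cut_le cut_supp] by blast
  let ?w = "\<lambda>t::real^'d. (2 * real n)\<^sup>2 * indicator (cball 0 (real n + 1)) t :: real"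
  have w: "integrable lebesgue ?w"
    using emeasure_bounded_finite[OF bounded_cball, of "0::real^'d" "real n + 1"]
    by (intro integrable_mult_right integrable_real_indicator) simp_all
  have g_meas: "g k \<in> borel_measurable borel" for k by (rule borel_measurable_continuous_onI[OF g(1)])
  have [measurable]: "g k \<in> borel_measurable lebesgue" for k
    using g_meas[of k] by (intro measurable_completion) simp
  have dom: "(cmod (cut n t - g k t))\<^sup>2 \<le> ?w t" for k t
  proof (cases "norm t \<le> real n + 1")
    case True
    have "cmod (cut n t - g k t) \<le> 2 * real n"
      using norm_triangle_ineq4[of "cut n t" "g k t"] cut_le[of t] g(3)[of k t] by linarith
    then have "(cmod (cut n t - g k t))\<^sup>2 \<le> (2 * real n)\<^sup>2" by (intro power_mono) auto
    then show ?thesis using True by simp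
  next
    case False
    then show ?thesis using g(2)[of t k] by (simp add: cut_def)
  qed
  have "(\<lambda>k. L2_norm (\<lambda>t. cut n t - g k t)) \<longlonglongrightarrow> 0"
    by (rule L2_norm_tendsto_0[OF cut_meas _ g(4) w dom]) measurable
  then have "\<forall>\<^sub>F k in sequentially. L2_norm (\<lambda>t. cut n t - g k t) < \<epsilon> / 2"
    using \<epsilon> by (intro order_tendstoD) auto
  then obtain k where k: "L2_norm (\<lambda>t. cut n t - g k t) < \<epsilon> / 2" by (auto simp: eventually_sequentially)
  have cut_L2: "cut n \<in> L2"
  proof -
    have "integrable lebesgue (\<lambda>t. (cmod (cut n t))\<^sup>2)"
    proof (rule Bochner_Integration.integrable_bound[OF L2_integrable[OF f]])
      show "AE t in lebesgue. norm ((cmod (cut n t))\<^sup>2) \<le> norm ((cmod (f t))\<^sup>2)"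
        by (intro AE_I2) (simp add: cut_def)
    qed measurable
    then show ?thesis by (simp add: L2_def)
  qed
  have "(\<lambda>t. cut n t - g k t) \<in> L2"
  proof -
    have "integrable lebesgue (\<lambda>t. (cmod (cut n t - g k t))\<^sup>2)"
      by (rule Bochner_Integration.integrable_bound[OF w]) 
        (use dom in \<open>auto intro!: AE_I2 order_trans[OF dom]\<close>)
    then show ?thesis by (simp add: L2_def)
  qed
  from L2_diff[OF cut_L2 this] have g_L2: "g k \<in> L2" by simp
  have "L2_norm (\<lambda>t. f t - g k t) < \<epsilon>"
    using L2_triangle_diff[OF f cut_L2 g_L2] n(1) k by simp
  then show ?thesis using g_L2 g(1,2) by blast
qed

section \<open>Sampling coherent states on translates of a lattice\<close>

text \<open>The Gabor system is indexed by pairs; with this index set the frame relation of the family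
  is literally the frame operator of the system.\<close>

lemma multi_window_gabor_frame_of_L2_frame:
  fixes \<Lambda> :: "('d::finite) phase set"
  assumes "L2_frame (\<lambda>(j, l). tf_shift l (\<phi> j)) ({1..n} \<times> \<Lambda>) B A" "\<And>j. j \<in> {1..n} \<Longrightarrow> \<phi> j \<in> L2"
  shows "multi_window_gabor_frame n \<phi> \<Lambda>"
proof -
  interpret L2_frame "\<lambda>(j, l). tf_shift l (\<phi> j)" "{1..n} \<times> \<Lambda>" B A by (rule assms(1))
  have "(\<lambda>(j, l) t. L2_inner f (tf_shift l (\<phi> j)) * tf_shift l (\<phi> j) t)
    = (\<lambda>i t. L2_inner f (case i of (j, l) \<Rightarrow> tf_shift l (\<phi> j)) * (case i of (j, l) \<Rightarrow> tf_shift l (\<phi> j)) t)" for f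
    by (auto simp: fun_eq_iff)
  then have eq: "frame_op n \<phi> \<Lambda> f h \<longleftrightarrow> frame_rel f h" for f h
    unfolding frame_op_def frame_rel_def by (simp only:)
  show ?thesis
    unfolding multi_window_gabor_frame_def eq
    using assms(2) frame_rel_exists frame_rel_norm_le frame_rel_surj norm_le_frame_rel by blast
qed

text \<open>Time-frequency shifts compose up to a unimodular factor, which is invisible in the
  absolute values of the coefficients.\<close>

lemma tf_shift_coherent:
  fixes l z :: "('d::finite) phase"
  shows "\<exists>u. cmod u = 1 \<and> tf_shift l (coherent z) = (\<lambda>t. u * coherent (l + z) t)"
proof (cases l, cases z)
  fix a b x \<omega> assume l: "l = (a, b)" and z: "z = (x, \<omega>)"
  have "tf_shift l (coherent z) t = cis (- (2 * pi * (\<omega> \<bullet> a))) * coherent (l + z) t" for t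
  proof -
    have "tf_shift l (coherent z) t = cis (2 * pi * (b \<bullet> t)) * coherent (x, \<omega>) (t - a)"
      by (simp add: tf_shift_def l z)
    also have "\<dots> = (cis (2 * pi * (b \<bullet> t)) * cis (2 * pi * (\<omega> \<bullet> (t - a)))) *
        complex_of_real (exp (- pi * ((t - a - x) \<bullet> (t - a - x))))"
      by (simp only: coherent_eq mult.assoc)
    also have "cis (2 * pi * (b \<bullet> t)) * cis (2 * pi * (\<omega> \<bullet> (t - a))) 
        = cis (- (2 * pi * (\<omega> \<bullet> a))) * cis (2 * pi * ((b + \<omega>) \<bullet> t))"
      by (simp add: cis_mult algebra_simps)
    also have "t - a - x = t - (a + x)" by simp
    finally have "tf_shift l (coherent z) t = cis (- (2 * pi * (\<omega> \<bullet> a))) * (cis (2 * pi * ((b + \<omega>) \<bullet> t)) *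
        complex_of_real (exp (- pi * ((t - (a + x)) \<bullet> (t - (a + x))))))"
      by (simp only: mult.assoc)
    moreover have "coherent (l + z) t = cis (2 * pi * ((b + \<omega>) \<bullet> t)) *
        complex_of_real (exp (- pi * ((t - (a + x)) \<bullet> (t - (a + x)))))"
      by (simp only: l z add_Pair coherent_eq)
    ultimately show ?thesis by (simp only:)
  qed
  then show ?thesis by (intro exI[of _ "cis (- (2 * pi * (\<omega> \<bullet> a)))"]) auto
qed

lemma tf_shift_coherent_L2: "tf_shift l (coherent z) \<in> L2"
  using tf_shift_coherent[of l z] L2_scale[OF coherent_L2] by metis

lemma tf_shift_coherent_coeff: "cmod (L2_inner f (tf_shift l (coherent z))) = cmod (L2_inner f (coherent (l + z)))"
  using tf_shift_coherent[of l z] by (auto simp: L2_inner_scale_right norm_mult)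

lemma coherent_Bessel:
  fixes z :: "('d::finite) phase"
  assumes X: "finite X" "X \<subseteq> \<Lambda>" and f: "f \<in> L2" and "0 \<le> T"
    and T: "\<And>l. l \<in> \<Lambda> \<Longrightarrow> (\<Sum>l'\<in>X. exp (- (pi / 8) * (norm (l - l'))\<^sup>2)) \<le> T"
  shows "(\<Sum>l\<in>X. (cmod (L2_inner f (coherent (l + z))))\<^sup>2) \<le> gauss_const TYPE('d) * T * (L2_norm f)\<^sup>2"
proof (rule Bessel_Schur[OF X(1) coherent_L2 f])
  let ?c = "gauss_const TYPE('d)"
  show "0 \<le> ?c * T" using \<open>0 \<le> T\<close> gauss_const_pos[where 'd = 'd] by simp
  fix l assume l: "l \<in> X"
  have "(\<Sum>l'\<in>X. cmod (L2_inner (coherent (l + z)) (coherent (l' + z))))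
    \<le> (\<Sum>l'\<in>X. ?c * exp (- (pi / 8) * (norm (l - l'))\<^sup>2))"
    unfolding coherent_inner_norm using gauss_const_pos[where 'd = 'd]
    by (intro sum_mono mult_left_mono) (auto intro!: mult_right_mono)
  also have "\<dots> \<le> ?c * T"
    unfolding sum_distrib_left[symmetric] using T[of l] l X gauss_const_pos[where 'd = 'd] 
    by (intro mult_left_mono) auto
  finally show "(\<Sum>l'\<in>X. cmod (L2_inner (coherent (l + z)) (coherent (l' + z)))) \<le> ?c * T" .
qed

lemma coherent_diff_Bessel:
  fixes z w :: "('d::finite) phase"
  assumes X: "finite X" "X \<subseteq> \<Lambda>" and f: "f \<in> L2" and zw: "norm (z - w) \<le> 1" and "0 \<le> T"
    and T: "\<And>l. l \<in> \<Lambda> \<Longrightarrow> (\<Sum>l'\<in>X. exp (- (pi / 8) * (norm (l - l'))\<^sup>2)) \<le> T"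
  shows "(\<Sum>l\<in>X. (cmod (L2_inner f (coherent_diff (l + z) (l + w))))\<^sup>2) 
    \<le> sqrt (8 * exp (pi / 2) * (1 - exp (- (pi / 2) * (norm (z - w))\<^sup>2))) * gauss_const TYPE('d) * T * (L2_norm f)\<^sup>2"
proof (rule Bessel_Schur[OF X(1) coherent_diff_L2 f])
  let ?c = "sqrt (8 * exp (pi / 2) * (1 - exp (- (pi / 2) * (norm (z - w))\<^sup>2))) * gauss_const TYPE('d)"
  have c: "0 \<le> ?c" using gauss_const_pos[where 'd = 'd] by simp
  show "0 \<le> ?c * T" using \<open>0 \<le> T\<close> c by simp
  fix l assume l: "l \<in> X"
  have "(\<Sum>l'\<in>X. cmod (L2_inner (coherent_diff (l + z) (l + w)) (coherent_diff (l' + z) (l' + w))))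
    \<le> (\<Sum>l'\<in>X. ?c * exp (- (pi / 8) * (norm (l - l'))\<^sup>2))"
    by (intro sum_mono coherent_diff_inner_le zw)
  also have "\<dots> \<le> ?c * T"
    unfolding sum_distrib_left[symmetric] using T[of l] l X c by (intro mult_left_mono) auto
  finally show "(\<Sum>l'\<in>X. cmod (L2_inner (coherent_diff (l + z) (l + w)) (coherent_diff (l' + z) (l' + w)))) \<le> ?c * T" .
qed

lemma nn_integral_count_space_le:
  assumes "countable A" and le: "\<And>X. finite X \<Longrightarrow> X \<subseteq> A \<Longrightarrow> (\<Sum>x\<in>X. f x) \<le> (W::ennreal)"
  shows "(\<integral>\<^sup>+x. f x \<partial>count_space A) \<le> W"
proof (cases "A = {}")
  case False
  define X where "X n = from_nat_into A ` {..n}" for n :: nat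
  have X: "finite (X n)" "X n \<subseteq> A" for n
    using from_nat_into[OF False] by (auto simp: X_def)
  have "(\<integral>\<^sup>+x. f x \<partial>count_space A) = (\<integral>\<^sup>+x. (SUP n. f x * indicator (X n) x) \<partial>count_space A)"
  proof (rule nn_integral_cong)
    fix x assume "x \<in> space (count_space A)"
    then obtain n where "x = from_nat_into A n" 
      using from_nat_into_surj[OF assms(1)] by (metis space_count_space)
    then have "x \<in> X n" by (simp add: X_def)
    then have "f x \<le> (SUP n. f x * indicator (X n) x)" by (intro SUP_upper2[of n]) auto
    moreover have "(SUP n. f x * indicator (X n) x) \<le> f x" 
      by (intro SUP_least) (auto simp: indicator_def)
    ultimately show "f x = (SUP n. f x * indicator (X n) x)" by (rule antisym)
  qed
  also have "\<dots> = (SUP n. \<integral>\<^sup>+x. f x * indicator (X n) x \<partial>count_space A)"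
  proof (rule nn_integral_monotone_convergence_SUP)
    have "X m \<subseteq> X n" if "m \<le> n" for m n using that by (auto simp: X_def)
    then show "incseq (\<lambda>n x. f x * indicator (X n) x)"
      by (fastforce simp: incseq_def le_fun_def indicator_def)
  qed simp
  also have "\<dots> \<le> W"
  proof (rule SUP_least)
    fix n
    have "(\<integral>\<^sup>+x. f x * indicator (X n) x \<partial>count_space A) = (\<Sum>x\<in>X n. f x * indicator (X n) x)"
      using X[of n] by (intro nn_integral_count_space') (auto simp: indicator_def)
    then show "(\<integral>\<^sup>+x. f x * indicator (X n) x \<partial>count_space A) \<le> W" using le[OF X] by simp
  qed
  finally show ?thesis .
qed (simp add: nn_integral_empty)

text \<open>The translates of \<open>Q\<close> may overlap, hence an inequality. It reduces the integral to
  an average over \<open>q \<in> Q\<close> of the sums of \<open>F\<close> over the shifted lattices \<open>q + \<Lambda>\<close>.\<close>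

lemma nn_integral_le_over_cells:
  fixes F :: "'a::euclidean_space \<Rightarrow> ennreal"
  assumes "countable \<Lambda>" and Q [measurable]: "Q \<in> sets borel" and cover: "\<And>z. \<exists>l\<in>\<Lambda>. z - l \<in> Q"
    and F [measurable]: "F \<in> borel_measurable borel"
    and le: "\<And>q. q \<in> Q \<Longrightarrow> (\<integral>\<^sup>+l. F (l + q) \<partial>count_space \<Lambda>) \<le> W"
  shows "(\<integral>\<^sup>+z. F z \<partial>lborel) \<le> W * emeasure lborel Q"
proof -
  have "(\<integral>\<^sup>+z. F z \<partial>lborel) \<le> (\<integral>\<^sup>+z. \<integral>\<^sup>+l. F z * indicator Q (z - l) \<partial>count_space \<Lambda> \<partial>lborel)"
  proof (rule nn_integral_mono)
    fix z
    obtain l where l: "l \<in> \<Lambda>" "z - l \<in> Q" using cover by blast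
    then have "F z = (\<integral>\<^sup>+l'. F z * indicator Q (z - l') * indicator {l} l' \<partial>count_space \<Lambda>)"
      by (subst nn_integral_count_space'[of "{l}"]) (auto simp: indicator_def)
    also have "\<dots> \<le> (\<integral>\<^sup>+l. F z * indicator Q (z - l) \<partial>count_space \<Lambda>)"
      by (intro nn_integral_mono) (auto simp: indicator_def)
    finally show "F z \<le> (\<integral>\<^sup>+l. F z * indicator Q (z - l) \<partial>count_space \<Lambda>)" .
  qed
  also have "\<dots> = (\<integral>\<^sup>+l. \<integral>\<^sup>+z. F z * indicator Q (z - l) \<partial>lborel \<partial>count_space \<Lambda>)"
    by (rule nn_integral_count_space_nn_integral[OF assms(1)]) measurable
  also have "\<dots> = (\<integral>\<^sup>+l. \<integral>\<^sup>+q. F (l + q) * indicator Q q \<partial>lborel \<partial>count_space \<Lambda>)"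
  proof (rule nn_integral_cong)
    fix l
    have "(\<integral>\<^sup>+z. F z * indicator Q (z - l) \<partial>lborel) = (\<integral>\<^sup>+z. F z * indicator Q (z - l) \<partial>distr lborel borel ((+) l))"
      by (simp add: lborel_distr_plus)
    also have "\<dots> = (\<integral>\<^sup>+q. F (l + q) * indicator Q q \<partial>lborel)"
      by (subst nn_integral_distr) auto
    finally show "(\<integral>\<^sup>+z. F z * indicator Q (z - l) \<partial>lborel) = (\<integral>\<^sup>+q. F (l + q) * indicator Q q \<partial>lborel)" .
  qed
  also have "\<dots> = (\<integral>\<^sup>+q. \<integral>\<^sup>+l. F (l + q) * indicator Q q \<partial>count_space \<Lambda> \<partial>lborel)"
    by (rule nn_integral_count_space_nn_integral[OF assms(1), symmetric]) measurable
  also have "\<dots> \<le> (\<integral>\<^sup>+q. W * indicator Q q \<partial>lborel)"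
    using le by (intro nn_integral_mono) (auto simp: indicator_def)
  also have "\<dots> = W * emeasure lborel Q" by (rule nn_integral_cmult_indicator) simp
  finally show ?thesis .
qed

theorem theorem13:
  fixes \<Lambda> :: "((real ^ 'd::finite) \<times> (real ^ 'd)) set"
    and \<nu> :: "(real ^ 'd) \<times> (real ^ 'd) \<Rightarrow> real"
  assumes "is_lattice \<Lambda>"
    and "weight \<nu>"
    and "submultiplicative \<nu>"
    and "even_weight \<nu>"
  shows "\<exists>(n::nat) (\<phi> :: nat \<Rightarrow> real ^ 'd \<Rightarrow> complex).
           (\<forall>j\<in>{1..n}. \<phi> j \<in> M1 \<nu>) \<and> multi_window_gabor_frame n \<phi> \<Lambda>"
proof -
  let ?c = "gauss_const TYPE('d)"
  have c: "0 < ?c" by (rule gauss_const_pos)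
  obtain Q where Q: "compact Q" "\<And>z. \<exists>l\<in>\<Lambda>. z - l \<in> Q" using assms(1) by (rule lattice_cover) blast
  have Q_borel: "Q \<in> sets borel" using Q(1) by (simp add: borel_compact)
  define V where "V = measure lborel Q"
  have V: "emeasure lborel Q = ennreal V" "0 \<le> V"
    using emeasure_bounded_finite[OF compact_imp_bounded[OF Q(1)]] 
    by (auto simp: V_def intro!: emeasure_eq_ennreal_measure)
  obtain T where T: "0 < T" "\<And>X l. \<lbrakk>finite X; X \<subseteq> \<Lambda>; l \<in> \<Lambda>\<rbrakk> \<Longrightarrow> (\<Sum>l'\<in>X. exp (- (pi / 8) * (norm (l - l'))\<^sup>2)) \<le> T"
    using lattice_Gaussian_sum_bounded[OF assms(1), of "pi / 8"] by auto
  define \<eta> where "\<eta> s = sqrt (8 * exp (pi / 2) * (1 - exp (- (pi / 2) * s\<^sup>2))) * ?c * T" for s :: real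
  \<comment> \<open>The constant \<open>\<kappa>\<close> is chosen such that \<open>2 \<kappa> V\<close>, the total sampling error over \<open>Q\<close>, is at most half of the energy constant.\<close>
  define \<kappa> where "\<kappa> = ?c / (4 * (V + 1))"
  have \<kappa>: "0 < \<kappa>" "2 * \<kappa> * V \<le> ?c / 2" using c V(2) by (simp_all add: \<kappa>_def field_simps)
  have "(\<eta> \<longlongrightarrow> \<eta> 0) (nhds 0)" unfolding \<eta>_def by (intro tendsto_intros filterlim_ident) 
  moreover have "\<eta> 0 < \<kappa>" using \<kappa>(1) by (simp add: \<eta>_def)
  ultimately have "\<forall>\<^sub>F s in nhds 0. \<eta> s < \<kappa>" by (rule order_tendstoD)
  then obtain \<epsilon>0 where \<epsilon>0: "0 < \<epsilon>0" "\<And>s. \<bar>s\<bar> < \<epsilon>0 \<Longrightarrow> \<eta> s < \<kappa>"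
    by (auto simp: eventually_nhds_metric dist_real_def)
  define \<epsilon> where "\<epsilon> = min \<epsilon>0 1"
  have \<epsilon>: "0 < \<epsilon>" "\<epsilon> \<le> 1" "\<epsilon> \<le> \<epsilon>0" using \<epsilon>0(1) by (simp_all add: \<epsilon>_def)
  obtain Z where Z: "finite Z" "Q \<subseteq> (\<Union>z\<in>Z. ball z \<epsilon>)"
    using Q(1) \<epsilon>(1) unfolding compact_eq_totally_bounded by blast
  define n where "n = card Z"
  obtain \<zeta> where \<zeta>: "bij_betw \<zeta> {1..n} Z" using ex_bij_betw_nat_finite_1[OF Z(1)] by (auto simp: n_def)
  define \<phi> where "\<phi> j = coherent (\<zeta> j)" for j
  define I where "I = {1..n} \<times> \<Lambda>"
  define e where "e = (\<lambda>(j, l). tf_shift l (\<phi> j))"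
  have coeff_e: "cmod (L2_inner f (e (j, l))) = cmod (L2_inner f (coherent (l + \<zeta> j)))" for f j l
    by (simp add: e_def \<phi>_def tf_shift_coherent_coeff)
  have e_L2: "e i \<in> L2" for i by (cases i) (simp add: e_def \<phi>_def tf_shift_coherent_L2)
  define B where "B = real n * (?c * T) + 1"
  interpret L2_Bessel e I B
  proof
    show "e i \<in> L2" for i by (rule e_L2)
    show "0 < B" using c T(1) by (simp add: B_def add_nonneg_pos)
    fix X and f :: "'d signal" assume X: "finite X" "X \<subseteq> I" and f: "f \<in> L2"
    define Y where "Y = snd ` X"
    have Y: "finite Y" "Y \<subseteq> \<Lambda>" "X \<subseteq> {1..n} \<times> Y" using X by (force simp: Y_def I_def)+
    have "(\<Sum>i\<in>X. (cmod (L2_inner f (e i)))\<^sup>2) \<le> (\<Sum>i\<in>{1..n} \<times> Y. (cmod (L2_inner f (e i)))\<^sup>2)"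
      using Y by (intro sum_mono2) auto
    also have "\<dots> = (\<Sum>j\<in>{1..n}. \<Sum>l\<in>Y. (cmod (L2_inner f (coherent (l + \<zeta> j))))\<^sup>2)"
      unfolding coeff_e[symmetric] sum.cartesian_product by (intro sum.cong) auto
    also have "\<dots> \<le> (\<Sum>j\<in>{1..n}. ?c * T * (L2_norm f)\<^sup>2)"
      using T Y by (intro sum_mono coherent_Bessel[of Y \<Lambda>] f) auto
    also have "\<dots> \<le> B * (L2_norm f)\<^sup>2" by (simp add: B_def algebra_simps)
    finally show "(\<Sum>i\<in>X. (cmod (L2_inner f (e i)))\<^sup>2) \<le> B * (L2_norm f)\<^sup>2" .
  qed
  let ?S = "\<lambda>f. \<Sum>\<^sub>\<infinity>i\<in>I. (cmod (L2_inner f (e i)))\<^sup>2"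
  \<comment> \<open>Moving the sampling points \<open>l + q\<close> to nearby points \<open>l + \<zeta> j\<close> costs a factor \<open>2\<close> and an error proportional to \<open>\<kappa>\<close>.\<close>
  have cell: "(\<Sum>l\<in>X. (cmod (L2_inner f (coherent (l + q))))\<^sup>2) \<le> 2 * ?S f + 2 * \<kappa> * (L2_norm f)\<^sup>2"
    if q: "q \<in> Q" and f: "f \<in> L2" and X: "finite X" "X \<subseteq> \<Lambda>" for f q X
  proof -
    obtain z where z: "z \<in> Z" "norm (q - z) < \<epsilon>" using Z(2) q by (auto simp: dist_norm norm_minus_commute)
    then obtain j where j: "j \<in> {1..n}" "z = \<zeta> j" using \<zeta> by (auto simp: bij_betw_def)
    let ?d = "\<lambda>l. L2_inner f (coherent_diff (l + q) (l + z))"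
    have "(cmod (L2_inner f (coherent (l + q))))\<^sup>2 \<le> 2 * (cmod (L2_inner f (coherent (l + z))))\<^sup>2 + 2 * (cmod (?d l))\<^sup>2" for l
    proof -
      have "?d l = L2_inner f (coherent (l + q)) - cnj (align (l + q) (l + z)) * L2_inner f (coherent (l + z))"
        unfolding coherent_diff_def
        by (simp add: L2_inner_diff_right f coherent_L2 L2_scale L2_inner_scale_right)
      then have "L2_inner f (coherent (l + q)) = cnj (align (l + q) (l + z)) * L2_inner f (coherent (l + z)) + ?d l" 
        by simp
      then have "cmod (L2_inner f (coherent (l + q))) \<le> cmod (cnj (align (l + q) (l + z)) * L2_inner f (coherent (l + z))) + cmod (?d l)"
        by (metis norm_triangle_ineq)
      also have "\<dots> = cmod (L2_inner f (coherent (l + z))) + cmod (?d l)" by (simp add: norm_mult align_norm)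
      finally have "(cmod (L2_inner f (coherent (l + q))))\<^sup>2 \<le> (cmod (L2_inner f (coherent (l + z))) + cmod (?d l))\<^sup>2"
        by (intro power_mono) auto
      then show ?thesis
        using sum_squares_bound[of "cmod (L2_inner f (coherent (l + z)))" "cmod (?d l)"] by (simp add: power2_sum)
    qed
    then have "(\<Sum>l\<in>X. (cmod (L2_inner f (coherent (l + q))))\<^sup>2) 
      \<le> (\<Sum>l\<in>X. 2 * (cmod (L2_inner f (coherent (l + z))))\<^sup>2 + 2 * (cmod (?d l))\<^sup>2)"
      by (intro sum_mono)
    also have "\<dots> = 2 * (\<Sum>l\<in>X. (cmod (L2_inner f (coherent (l + z))))\<^sup>2) + 2 * (\<Sum>l\<in>X. (cmod (?d l))\<^sup>2)"
      by (simp add: sum.distrib sum_distrib_left)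
    also have "(\<Sum>l\<in>X. (cmod (L2_inner f (coherent (l + z))))\<^sup>2) = (\<Sum>i\<in>{j} \<times> X. (cmod (L2_inner f (e i)))\<^sup>2)"
      unfolding j(2) coeff_e[symmetric]
      by (rule sum.reindex_bij_witness[of _ snd "Pair j"]) auto
    also have "\<dots> \<le> ?S f"
      using X j by (intro finite_sum_le_infsum coeff_summable f) (auto simp: I_def)
    also have "(\<Sum>l\<in>X. (cmod (?d l))\<^sup>2) \<le> \<eta> (norm (q - z)) * (L2_norm f)\<^sup>2"
      unfolding \<eta>_def using z(2) \<epsilon>(2) T X by (intro coherent_diff_Bessel[of X \<Lambda>] f) auto
    also have "\<dots> \<le> \<kappa> * (L2_norm f)\<^sup>2"
      using \<epsilon>0(2)[of "norm (q - z)"] z(2) \<epsilon>(3) by (intro mult_right_mono) auto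
    finally show ?thesis by simp
  qed
  define D where "D = {g :: 'd signal. continuous_on UNIV g \<and> (\<exists>R. \<forall>t. R < norm t \<longrightarrow> g t = 0)}"
  define a where "a = ?c / (4 * (V + 1))"
  have a: "0 < a" using c V(2) by (simp add: a_def)
  \<comment> \<open>Averaging over \<open>q \<in> Q\<close> bounds the total energy by the samples plus an error that is absorbed on the left.\<close>
  have lower: "a * (L2_norm g)\<^sup>2 \<le> ?S g" if "g \<in> D" and g: "g \<in> L2" for g
  proof -
    obtain R where cont: "continuous_on UNIV g" and R: "\<And>t. R < norm t \<Longrightarrow> g t = 0" 
      using \<open>g \<in> D\<close> by (auto simp: D_def)
    note energy = coherent_total_energy_lower[OF cont R]
    let ?F = "\<lambda>z. ennreal ((cmod (L2_inner g (coherent z)))\<^sup>2)"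
    define W where "W = 2 * ?S g + 2 * \<kappa> * (L2_norm g)\<^sup>2"
    have W: "0 \<le> W" using \<kappa>(1) by (auto simp: W_def intro!: add_nonneg_nonneg infsum_nonneg)
    have meas: "?F \<in> borel_measurable borel" using energy(2) by measurable
    have "ennreal (?c * (L2_norm g)\<^sup>2) = ennreal ?c * (\<integral>\<^sup>+t. ennreal ((cmod (g t))\<^sup>2) \<partial>lebesgue)"
      using c by (simp add: L2_norm_square_nn[OF g] ennreal_mult)
    also have "(\<integral>\<^sup>+t. ennreal ((cmod (g t))\<^sup>2) \<partial>lebesgue) = (\<integral>\<^sup>+t. ennreal ((cmod (g t))\<^sup>2) \<partial>lborel)"
      by (rule nn_integral_completion)
    also have "ennreal ?c * \<dots> \<le> (\<integral>\<^sup>+z. ?F z \<partial>lborel)" by (rule energy(1))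
    also have "\<dots> \<le> ennreal W * emeasure lborel Q"
    proof (rule nn_integral_le_over_cells[OF lattice_countable[OF assms(1)] Q_borel Q(2) meas])
      fix q assume q: "q \<in> Q"
      show "(\<integral>\<^sup>+l. ?F (l + q) \<partial>count_space \<Lambda>) \<le> ennreal W"
      proof (rule nn_integral_count_space_le[OF lattice_countable[OF assms(1)]])
        fix X assume "finite X" "X \<subseteq> \<Lambda>"
        then show "(\<Sum>l\<in>X. ?F (l + q)) \<le> ennreal W"
          using cell[OF q g] by (simp add: W_def ennreal_leI)
      qed
    qed
    also have "\<dots> = ennreal (W * V)" using W V by (simp add: ennreal_mult)
    finally have "?c * (L2_norm g)\<^sup>2 \<le> W * V" using W V by simp
    also have "\<dots> = 2 * V * ?S g + (2 * \<kappa> * V) * (L2_norm g)\<^sup>2" by (simp add: W_def algebra_simps)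
    also have "\<dots> \<le> 2 * (V + 1) * ?S g + (?c / 2) * (L2_norm g)\<^sup>2"
      using \<kappa>(2) by (intro add_mono mult_right_mono infsum_nonneg) auto
    finally have "?c * (L2_norm g)\<^sup>2 \<le> (4 * (V + 1)) * ?S g" by (simp add: algebra_simps)
    then show ?thesis using V(2) by (simp add: a_def field_simps)
  qed
  have "L2_frame e I B (a / 4)"
  proof
    show "0 < a / 4" using a by simp
    fix f :: "'d signal" assume f: "f \<in> L2"
    show "a / 4 * (L2_norm f)\<^sup>2 \<le> ?S f"
    proof (rule lower_bound_from_dense[where D = D, OF a _ lower f])
      fix f :: "'d signal" and r :: real assume "f \<in> L2" "0 < r"
      then show "\<exists>g\<in>D. g \<in> L2 \<and> L2_norm (\<lambda>t. f t - g t) < r"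
        using L2_dense_continuous_compact_support by (fastforce simp: D_def)
    qed
  qed
  then have "multi_window_gabor_frame n \<phi> \<Lambda>"
    unfolding e_def I_def by (rule multi_window_gabor_frame_of_L2_frame) (simp add: \<phi>_def coherent_L2)
  moreover have "\<forall>j\<in>{1..n}. \<phi> j \<in> M1 \<nu>"
    using coherent_M1[OF assms(2-4)] by (simp add: \<phi>_def)
  ultimately show ?thesis by blast
qed

end
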